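(* Let $(M,g)$ be a Riemannian manifold of dimension $n>1$ with constant sectional curvature $c$, let $A>0$, and let $\lambda,\mu:(0,\infty)\to\mathbf{R}$ be smooth functions satisfying $$\lambda>0,\qquad \frac{2c-A^2t\lambda^2}{\lambda+2t\lambda'}>0,\qquad \lambda+2t\mu>0\qquad\text{for all } t>0 .$$ On $T^*_0M$ let $J$ be the natural complex structure of diagonal type $$J\frac{\delta}{\delta q^i}=J^{(1)}_{ij}\frac{\partial}{\partial p_j},\qquad J\frac{\partial}{\partial p_i}=-J_{(2)}^{ij}\frac{\delta}{\delta q^j},$$ $$J^{(1)}_{ij}=At\lambda\, g_{ij}+\frac{c-A^2t\lambda(\lambda+t\lambda')}{At(\lambda+2t\lambda')}\,p_ip_j,\qquad J_{(2)}^{ij}=\frac{1}{At\lambda}\,g^{ij}-\frac{c-A^2t\lambda(\lambda+t\lambda')}{At^2\lambda(2c-A^2t\lambda^2)}\,g^{0i}g^{0j},$$ and let $G$ be the natural Riemannian metric of diagonal type $G=(c_1g_{ij}+d_1p_ip_j)dq^idq^j+(c_2g^{ij}+d_2g^{0i}g^{0j})Dp_iDp_j$, where $$c_1=At\lambda^2,\qquad c_2=\frac{1}{At},\qquad d_1=\frac{\lambda[c-A^2t\lambda(\lambda+t\lambda')]+\mu t(2c-A^2t\lambda^2)}{At(\lambda+2t\lambda')},$$ $$d_2=\frac{-c+A^2t\lambda(\lambda+t\lambda')+\mu A^2t^2(\lambda+2t\lambda')}{At^2(2c-A^2t\lambda^2)}.$$ Then $(G,J)$ is a Hermitian structure on $T^*_0M$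 (so one obtains a class of Hermitian structures depending on the two parameters $\lambda$ and $\mu$).
   Context: Everything is smooth; repeated indices are summed over $1,\dots,n$. $(M,g)$ is a smooth $n$-dimensional Riemannian manifold, $\pi:T^*M\to M$ its cotangent bundle, $T^*_0M$ is $T^*M$ minus the zero section. A chart $(U,x^1,\dots,x^n)$ of $M$ induces the chart $(\pi^{-1}(U),q^1,\dots,q^n,p_1,\dots,p_n)$ of $T^*M$, where $q^i=x^i\circ\pi$ and $p=p_i\,dx^i_{\pi(p)}$. With $\Gamma^k_{ih}$ the Christoffel symbols of $g$, put $\Gamma^0_{ih}=p_k\Gamma^k_{ih}$, $\frac{\delta}{\delta q^i}=\frac{\partial}{\partial q^i}+\Gamma^0_{ih}\frac{\partial}{\partial p_h}$, $Dp_i=dp_i-\Gamma^0_{ij}dq^j$. The vector fields $\frac{\delta}{\delta q^i},\frac{\partial}{\partial p_i}$ form a local frame with dual coframe $dq^i,Dp_i$. Further, $(g^{ij})$ is the inverse of $(g_{ij})$, $g^{0i}=p_hg^{hi}$, and $t=\frac12 g^{ij}p_ip_j>0$ on $T^*_0M$ is the energy density. The functions of $t$ (such as $\lambda$, $\mu$, $\lambda'=d\lambda/dt$) are evaluated at the energy density. $(G,J)$ is Hermitian if $J$ is a complex structure (integrable almost complex structure), $G$ is a Riemannian metric, and $G(JX,JY)=G(X,Y)$ for all vector fields $X,Y$ on $T^*_0M$. *)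

theory Defs
  imports "HOL-Analysis.Analysis"
begin

section \<open>Smooth maps and smooth manifolds\<close>

text \<open>\<open>C_on k S f\<close>: \<open>f\<close> is \<open>k\<close> times continuously differentiable on the (open) set \<open>S\<close>.\<close>

primrec C_on :: "nat \<Rightarrow> 'a::real_normed_vector set \<Rightarrow> ('a \<Rightarrow> 'b::real_normed_vector) \<Rightarrow> bool" where
  "C_on 0 S f \<longleftrightarrow> continuous_on S f"
| "C_on (Suc k) S f \<longleftrightarrow> (\<forall>x\<in>S. f differentiable (at x)) \<and>
     (\<forall>v. C_on k S (\<lambda>x. frechet_derivative f (at x) v))"

definition smooth_on :: "'a::real_normed_vector set \<Rightarrow> ('a \<Rightarrow> 'b::real_normed_vector) \<Rightarrow> bool" where
  "smooth_on S f \<longleftrightarrow> (\<forall>k. C_on k S f)"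

text \<open>An atlas is an indexed family of charts \<open>coord \<AA> \<alpha> : patch \<AA> \<alpha> \<rightarrow> 'e\<close>, \<open>\<alpha> \<in> index \<AA>\<close>, into a
  Euclidean space \<open>'e\<close>. The values of \<open>coord \<AA> \<alpha>\<close> outside \<open>patch \<AA> \<alpha>\<close> are irrelevant. The
  topology of the underlying set is the one for which all charts are homeomorphisms onto open sets.
  Since the atlas is arbitrary, it may in particular be a maximal one.\<close>

record ('i, 'm, 'e) atlas =
  index :: "'i set"
  patch :: "'i \<Rightarrow> 'm set"
  coord :: "'i \<Rightarrow> 'm \<Rightarrow> 'e"

definition carrier :: "('i, 'm, 'e) atlas \<Rightarrow> 'm set" where
  "carrier \<AA> = (\<Union>\<alpha>\<in>index \<AA>. patch \<AA> \<alpha>)"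

definition coord_range :: "('i, 'm, 'e) atlas \<Rightarrow> 'i \<Rightarrow> 'e set" where
  "coord_range \<AA> \<alpha> = coord \<AA> \<alpha> ` patch \<AA> \<alpha>"

definition overlap :: "('i, 'm, 'e) atlas \<Rightarrow> 'i \<Rightarrow> 'i \<Rightarrow> 'e set" where
  "overlap \<AA> \<alpha> \<beta> = coord \<AA> \<alpha> ` (patch \<AA> \<alpha> \<inter> patch \<AA> \<beta>)"

definition transition :: "('i, 'm, 'e) atlas \<Rightarrow> 'i \<Rightarrow> 'i \<Rightarrow> 'e \<Rightarrow> 'e" where
  "transition \<AA> \<alpha> \<beta> z = coord \<AA> \<beta> (inv_into (patch \<AA> \<alpha>) (coord \<AA> \<alpha>) z)"

definition smooth_atlas :: "('i, 'm, 'e::euclidean_space) atlas \<Rightarrow> bool" where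
  "smooth_atlas \<AA> \<longleftrightarrow>
     (\<forall>\<alpha>\<in>index \<AA>. inj_on (coord \<AA> \<alpha>) (patch \<AA> \<alpha>)) \<and>
     (\<forall>\<alpha>\<in>index \<AA>. \<forall>\<beta>\<in>index \<AA>. open (overlap \<AA> \<alpha> \<beta>) \<and>
        smooth_on (overlap \<AA> \<alpha> \<beta>) (transition \<AA> \<alpha> \<beta>))"

definition atlas_topology :: "('i, 'm, 'e::euclidean_space) atlas \<Rightarrow> 'm topology" where
  "atlas_topology \<AA> = topology (\<lambda>S. S \<subseteq> carrier \<AA> \<and>
     (\<forall>\<alpha>\<in>index \<AA>. open (coord \<AA> \<alpha> ` (S \<inter> patch \<AA> \<alpha>))))"

lemma openin_atlas_topology:
  assumes "smooth_atlas \<AA>"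
  shows "openin (atlas_topology \<AA>) S \<longleftrightarrow> S \<subseteq> carrier \<AA> \<and>
     (\<forall>\<alpha>\<in>index \<AA>. open (coord \<AA> \<alpha> ` (S \<inter> patch \<AA> \<alpha>)))"
proof -
  let ?P = "\<lambda>S. S \<subseteq> carrier \<AA> \<and> (\<forall>\<alpha>\<in>index \<AA>. open (coord \<AA> \<alpha> ` (S \<inter> patch \<AA> \<alpha>)))"
  have int: "?P (S \<inter> T)" if S: "?P S" and T: "?P T" for S T
  proof -
    have "open (coord \<AA> \<alpha> ` (S \<inter> T \<inter> patch \<AA> \<alpha>))" if \<alpha>: "\<alpha> \<in> index \<AA>" for \<alpha>
    proof -
      have "inj_on (coord \<AA> \<alpha>) (patch \<AA> \<alpha>)"
        using assms \<alpha> by (auto simp: smooth_atlas_def)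
      then have "coord \<AA> \<alpha> ` (S \<inter> T \<inter> patch \<AA> \<alpha>) =
          coord \<AA> \<alpha> ` (S \<inter> patch \<AA> \<alpha>) \<inter> coord \<AA> \<alpha> ` (T \<inter> patch \<AA> \<alpha>)"
        by (auto simp: inj_on_def)
      then show ?thesis using S T \<alpha> by auto
    qed
    then show ?thesis using S by auto
  qed
  have un: "?P (\<Union>K)" if K: "\<forall>S\<in>K. ?P S" for K
  proof -
    have "coord \<AA> \<alpha> ` (\<Union>K \<inter> patch \<AA> \<alpha>) = (\<Union>S\<in>K. coord \<AA> \<alpha> ` (S \<inter> patch \<AA> \<alpha>))" for \<alpha>
      by auto
    then show ?thesis using K by auto
  qed
  have "istopology ?P"
    unfolding istopology_def using int un by blast
  then show ?thesis
    unfolding atlas_topology_def by (simp add: topology_inverse')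
qed

lemma topspace_atlas_topology:
  assumes "smooth_atlas \<AA>"
  shows "topspace (atlas_topology \<AA>) = carrier \<AA>"
proof
  show "topspace (atlas_topology \<AA>) \<subseteq> carrier \<AA>"
    using openin_atlas_topology[OF assms] by (metis openin_topspace)
  have "carrier \<AA> \<inter> patch \<AA> \<alpha> = patch \<AA> \<alpha> \<inter> patch \<AA> \<alpha>" if "\<alpha> \<in> index \<AA>" for \<alpha>
    using that by (auto simp: carrier_def)
  moreover have "open (coord \<AA> \<alpha> ` (patch \<AA> \<alpha> \<inter> patch \<AA> \<alpha>))" if "\<alpha> \<in> index \<AA>" for \<alpha>
    using assms that unfolding smooth_atlas_def overlap_def by blast
  ultimately have "openin (atlas_topology \<AA>) (carrier \<AA>)"
    using openin_atlas_topology[OF assms] by auto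
  then show "carrier \<AA> \<subseteq> topspace (atlas_topology \<AA>)"
    by (rule openin_subset)
qed

definition smooth_manifold :: "('i, 'm, 'e::euclidean_space) atlas \<Rightarrow> bool" where
  "smooth_manifold \<AA> \<longleftrightarrow> smooth_atlas \<AA> \<and>
     Hausdorff_space (atlas_topology \<AA>) \<and> second_countable (atlas_topology \<AA>)"


section \<open>Tensor fields and Hermitian structures\<close>

text \<open>A tensor field is given by its local representative in every chart \<open>\<alpha>\<close>, as a function of the
  coordinates \<open>z \<in> coord_range \<AA> \<alpha>\<close>; the representatives in two charts have to be related by the
  differential of the transition map. Tangent vectors at \<open>z\<close> are represented by elements of
  \<open>'e\<close>.\<close>

type_synonym ('i, 'e) vec_field = "'i \<Rightarrow> 'e \<Rightarrow> 'e"
type_synonym ('i, 'e) bil_field = "'i \<Rightarrow> 'e \<Rightarrow> 'e \<Rightarrow> 'e \<Rightarrow> real"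
type_synonym ('i, 'e) end_field = "'i \<Rightarrow> 'e \<Rightarrow> 'e \<Rightarrow> 'e"

definition dtrans :: "('i, 'm, 'e::euclidean_space) atlas \<Rightarrow> 'i \<Rightarrow> 'i \<Rightarrow> 'e \<Rightarrow> 'e \<Rightarrow> 'e" where
  "dtrans \<AA> \<alpha> \<beta> z = frechet_derivative (transition \<AA> \<alpha> \<beta>) (at z)"

definition vector_field :: "('i, 'm, 'e::euclidean_space) atlas \<Rightarrow> ('i, 'e) vec_field \<Rightarrow> bool" where
  "vector_field \<AA> X \<longleftrightarrow>
     (\<forall>\<alpha>\<in>index \<AA>. smooth_on (coord_range \<AA> \<alpha>) (X \<alpha>)) \<and>
     (\<forall>\<alpha>\<in>index \<AA>. \<forall>\<beta>\<in>index \<AA>. \<forall>z\<in>overlap \<AA> \<alpha> \<beta>.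
        X \<beta> (transition \<AA> \<alpha> \<beta> z) = dtrans \<AA> \<alpha> \<beta> z (X \<alpha> z))"

definition riemannian_metric :: "('i, 'm, 'e::euclidean_space) atlas \<Rightarrow> ('i, 'e) bil_field \<Rightarrow> bool" where
  "riemannian_metric \<AA> g \<longleftrightarrow>
     (\<forall>\<alpha>\<in>index \<AA>.
        (\<forall>u v. smooth_on (coord_range \<AA> \<alpha>) (\<lambda>z. g \<alpha> z u v)) \<and>
        (\<forall>z\<in>coord_range \<AA> \<alpha>. bilinear (g \<alpha> z) \<and> (\<forall>u v. g \<alpha> z u v = g \<alpha> z v u) \<and>
           (\<forall>u. u \<noteq> 0 \<longrightarrow> g \<alpha> z u u > 0))) \<and>
     (\<forall>\<alpha>\<in>index \<AA>. \<forall>\<beta>\<in>index \<AA>. \<forall>z\<in>overlap \<AA> \<alpha> \<beta>. \<forall>u v.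
        g \<beta> (transition \<AA> \<alpha> \<beta> z) (dtrans \<AA> \<alpha> \<beta> z u) (dtrans \<AA> \<alpha> \<beta> z v) = g \<alpha> z u v)"

definition endomorphism_field :: "('i, 'm, 'e::euclidean_space) atlas \<Rightarrow> ('i, 'e) end_field \<Rightarrow> bool" where
  "endomorphism_field \<AA> J \<longleftrightarrow>
     (\<forall>\<alpha>\<in>index \<AA>.
        (\<forall>u. smooth_on (coord_range \<AA> \<alpha>) (\<lambda>z. J \<alpha> z u)) \<and>
        (\<forall>z\<in>coord_range \<AA> \<alpha>. linear (J \<alpha> z))) \<and>
     (\<forall>\<alpha>\<in>index \<AA>. \<forall>\<beta>\<in>index \<AA>. \<forall>z\<in>overlap \<AA> \<alpha> \<beta>. \<forall>u.
        J \<beta> (transition \<AA> \<alpha> \<beta> z) (dtrans \<AA> \<alpha> \<beta> z u) = dtrans \<AA> \<alpha> \<beta> z (J \<alpha> z u))"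

definition almost_complex_structure ::
    "('i, 'm, 'e::euclidean_space) atlas \<Rightarrow> ('i, 'e) end_field \<Rightarrow> bool" where
  "almost_complex_structure \<AA> J \<longleftrightarrow> endomorphism_field \<AA> J \<and>
     (\<forall>\<alpha>\<in>index \<AA>. \<forall>z\<in>coord_range \<AA> \<alpha>. \<forall>u. J \<alpha> z (J \<alpha> z u) = - u)"

text \<open>\<open>[X,Y] = D Y (X) - D X (Y)\<close> in every chart.\<close>

definition lie_bracket ::
    "('i, 'e::euclidean_space) vec_field \<Rightarrow> ('i, 'e) vec_field \<Rightarrow> ('i, 'e) vec_field" where
  "lie_bracket X Y = (\<lambda>\<alpha> z. frechet_derivative (Y \<alpha>) (at z) (X \<alpha> z)
                          - frechet_derivative (X \<alpha>) (at z) (Y \<alpha> z))"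

definition act ::
    "('i, 'e) end_field \<Rightarrow> ('i, 'e) vec_field \<Rightarrow> ('i, 'e) vec_field" where
  "act J X = (\<lambda>\<alpha> z. J \<alpha> z (X \<alpha> z))"

definition nijenhuis ::
    "('i, 'e::euclidean_space) end_field \<Rightarrow> ('i, 'e) vec_field \<Rightarrow> ('i, 'e) vec_field \<Rightarrow> ('i, 'e) vec_field"
  where
  "nijenhuis J X Y = (\<lambda>\<alpha> z.
       lie_bracket (act J X) (act J Y) \<alpha> z
     - act J (lie_bracket (act J X) Y) \<alpha> z
     - act J (lie_bracket X (act J Y)) \<alpha> z
     - lie_bracket X Y \<alpha> z)"

text \<open>Integrability of an almost complex structure means vanishing torsion (Nijenhuis tensor), as in
  Kobayashi and Nomizu.\<close>

definition complex_structure :: "('i, 'm, 'e::euclidean_space) atlas \<Rightarrow> ('i, 'e) end_field \<Rightarrow> bool" where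
  "complex_structure \<AA> J \<longleftrightarrow> almost_complex_structure \<AA> J \<and>
     (\<forall>X Y. vector_field \<AA> X \<and> vector_field \<AA> Y \<longrightarrow>
        (\<forall>\<alpha>\<in>index \<AA>. \<forall>z\<in>coord_range \<AA> \<alpha>. nijenhuis J X Y \<alpha> z = 0))"

definition hermitian_structure ::
    "('i, 'm, 'e::euclidean_space) atlas \<Rightarrow> ('i, 'e) bil_field \<Rightarrow> ('i, 'e) end_field \<Rightarrow> bool" where
  "hermitian_structure \<AA> G J \<longleftrightarrow> complex_structure \<AA> J \<and> riemannian_metric \<AA> G \<and>
     (\<forall>X Y. vector_field \<AA> X \<and> vector_field \<AA> Y \<longrightarrow>
        (\<forall>\<alpha>\<in>index \<AA>. \<forall>z\<in>coord_range \<AA> \<alpha>.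
           G \<alpha> z (act J X \<alpha> z) (act J Y \<alpha> z) = G \<alpha> z (X \<alpha> z) (Y \<alpha> z)))"


section \<open>Levi-Civita connection and curvature in coordinates\<close>

definition partial_deriv :: "(real^'n::finite \<Rightarrow> 'b::real_normed_vector) \<Rightarrow> 'n \<Rightarrow> real^'n \<Rightarrow> 'b" where
  "partial_deriv f i q = frechet_derivative f (at q) (axis i 1)"

definition g_low :: "('i, real^'n::finite) bil_field \<Rightarrow> 'i \<Rightarrow> real^'n \<Rightarrow> 'n \<Rightarrow> 'n \<Rightarrow> real" where
  "g_low g \<alpha> q i j = g \<alpha> q (axis i 1) (axis j 1)"

definition g_up :: "('i, real^'n::finite) bil_field \<Rightarrow> 'i \<Rightarrow> real^'n \<Rightarrow> 'n \<Rightarrow> 'n \<Rightarrow> real" where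
  "g_up g \<alpha> q i j = matrix_inv (\<chi> k l. g_low g \<alpha> q k l) $ i $ j"

text \<open>\<open>christoffel g \<alpha> q k i h\<close> is \<open>\<Gamma>\<^sup>k\<^sub>i\<^sub>h\<close>.\<close>

definition christoffel ::
    "('i, real^'n::finite) bil_field \<Rightarrow> 'i \<Rightarrow> real^'n \<Rightarrow> 'n \<Rightarrow> 'n \<Rightarrow> 'n \<Rightarrow> real" where
  "christoffel g \<alpha> q k i h = (1/2) * (\<Sum>l\<in>UNIV. g_up g \<alpha> q k l *
     (partial_deriv (\<lambda>x. g_low g \<alpha> x l h) i q + partial_deriv (\<lambda>x. g_low g \<alpha> x l i) h q
        - partial_deriv (\<lambda>x. g_low g \<alpha> x i h) l q))"

text \<open>\<open>riemann g \<alpha> q h k i j\<close> is the component \<open>R\<^sup>h\<^sub>k\<^sub>i\<^sub>j\<close>, where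
  \<open>R(\<partial>\<^sub>i,\<partial>\<^sub>j)\<partial>\<^sub>k = R\<^sup>h\<^sub>k\<^sub>i\<^sub>j \<partial>\<^sub>h\<close> and \<open>R(X,Y) = [\<nabla>\<^sub>X,\<nabla>\<^sub>Y] - \<nabla>\<^sub>[\<^sub>X\<^sub>,\<^sub>Y\<^sub>]\<close>.\<close>

definition riemann ::
    "('i, real^'n::finite) bil_field \<Rightarrow> 'i \<Rightarrow> real^'n \<Rightarrow> 'n \<Rightarrow> 'n \<Rightarrow> 'n \<Rightarrow> 'n \<Rightarrow> real" where
  "riemann g \<alpha> q h k i j =
     partial_deriv (\<lambda>x. christoffel g \<alpha> x h j k) i q - partial_deriv (\<lambda>x. christoffel g \<alpha> x h i k) j q
     + (\<Sum>l\<in>UNIV. christoffel g \<alpha> q h i l * christoffel g \<alpha> q l j k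
                - christoffel g \<alpha> q h j l * christoffel g \<alpha> q l i k)"

text \<open>\<open>curvature g \<alpha> q u v w = R(u,v)w\<close>\<close>

definition curvature ::
    "('i, real^'n::finite) bil_field \<Rightarrow> 'i \<Rightarrow> real^'n \<Rightarrow> real^'n \<Rightarrow> real^'n \<Rightarrow> real^'n \<Rightarrow> real^'n" where
  "curvature g \<alpha> q u v w = (\<chi> h. \<Sum>k\<in>UNIV. \<Sum>i\<in>UNIV. \<Sum>j\<in>UNIV.
     riemann g \<alpha> q h k i j * w $ k * u $ i * v $ j)"

definition sectional_curvature ::
    "('i, real^'n::finite) bil_field \<Rightarrow> 'i \<Rightarrow> real^'n \<Rightarrow> real^'n \<Rightarrow> real^'n \<Rightarrow> real" where
  "sectional_curvature g \<alpha> q u v = g \<alpha> q (curvature g \<alpha> q u v v) u /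
     (g \<alpha> q u u * g \<alpha> q v v - (g \<alpha> q u v)\<^sup>2)"

definition constant_sectional_curvature ::
    "('i, 'm, real^'n::finite) atlas \<Rightarrow> ('i, real^'n) bil_field \<Rightarrow> real \<Rightarrow> bool" where
  "constant_sectional_curvature \<AA> g c \<longleftrightarrow>
     (\<forall>\<alpha>\<in>index \<AA>. \<forall>q\<in>coord_range \<AA> \<alpha>. \<forall>u v. u \<noteq> v \<and> independent {u, v} \<longrightarrow>
        sectional_curvature g \<alpha> q u v = c)"


section \<open>The cotangent bundle without its zero section\<close>

text \<open>A covector at \<open>x\<close> is the family \<open>\<xi>\<close> of its component vectors \<open>\<xi> \<alpha> = (p\<^sub>1,\<dots>,p\<^sub>n)\<close> with respect
  to the coordinate differentials of the charts \<open>\<alpha>\<close> around \<open>x\<close>; these obey the covariant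
  transformation law \<open>p\<^sub>i = p'\<^sub>j \<partial>x'\<^sup>j/\<partial>x\<^sup>i\<close>. For the other indices \<open>\<xi>\<close> takes the dummy
  value \<open>0\<close>.\<close>

definition cotangent_space :: "('i, 'm, real^'n::finite) atlas \<Rightarrow> 'm \<Rightarrow> ('i \<Rightarrow> real^'n) set" where
  "cotangent_space \<AA> x = {\<xi>.
     (\<forall>\<alpha>. \<not> (\<alpha> \<in> index \<AA> \<and> x \<in> patch \<AA> \<alpha>) \<longrightarrow> \<xi> \<alpha> = 0) \<and>
     (\<forall>\<alpha>\<in>index \<AA>. \<forall>\<beta>\<in>index \<AA>. x \<in> patch \<AA> \<alpha> \<inter> patch \<AA> \<beta> \<longrightarrow>
        (\<forall>i. \<xi> \<alpha> $ i = (\<Sum>j\<in>UNIV. \<xi> \<beta> $ j * dtrans \<AA> \<alpha> \<beta> (coord \<AA> \<alpha> x) (axis i 1) $ j)))}"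

definition nonzero_cotangent :: "('i, 'm, real^'n::finite) atlas \<Rightarrow> ('m \<times> ('i \<Rightarrow> real^'n)) set" where
  "nonzero_cotangent \<AA> = {(x, \<xi>). x \<in> carrier \<AA> \<and> \<xi> \<in> cotangent_space \<AA> x \<and> \<xi> \<noteq> (\<lambda>\<alpha>. 0)}"

text \<open>The induced charts \<open>(q\<^sup>1,\<dots>,q\<^sup>n,p\<^sub>1,\<dots>,p\<^sub>n)\<close>, written as pairs \<open>(q,p)\<close>.\<close>

definition nonzero_cotangent_atlas ::
    "('i, 'm, real^'n::finite) atlas \<Rightarrow> ('i, 'm \<times> ('i \<Rightarrow> real^'n), (real^'n) \<times> (real^'n)) atlas" where
  "nonzero_cotangent_atlas \<AA> = \<lparr>
     index = index \<AA>,
     patch = (\<lambda>\<alpha>. {(x, \<xi>) \<in> nonzero_cotangent \<AA>. x \<in> patch \<AA> \<alpha>}),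
     coord = (\<lambda>\<alpha> (x, \<xi>). (coord \<AA> \<alpha> x, \<xi> \<alpha>))\<rparr>"


section \<open>Natural structures of diagonal type\<close>

text \<open>In this section \<open>(q, p)\<close> are induced coordinates and \<open>fst v\<close>, \<open>snd v\<close> are the
  \<open>\<partial>/\<partial>q\<close>- and \<open>\<partial>/\<partial>p\<close>-components of a tangent vector \<open>v\<close> of the cotangent bundle.\<close>

definition Gamma0 ::
    "('i, real^'n::finite) bil_field \<Rightarrow> 'i \<Rightarrow> (real^'n) \<times> (real^'n) \<Rightarrow> 'n \<Rightarrow> 'n \<Rightarrow> real" where
  "Gamma0 g \<alpha> = (\<lambda>(q, p) i h. \<Sum>k\<in>UNIV. p $ k * christoffel g \<alpha> q k i h)"

text \<open>\<open>\<delta>/\<delta>q\<^sup>i\<close>\<close>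

definition delta_q ::
    "('i, real^'n::finite) bil_field \<Rightarrow> 'i \<Rightarrow> (real^'n) \<times> (real^'n) \<Rightarrow> 'n \<Rightarrow> (real^'n) \<times> (real^'n)" where
  "delta_q g \<alpha> z i = (axis i 1, \<chi> h. Gamma0 g \<alpha> z i h)"

text \<open>\<open>\<partial>/\<partial>p\<^sub>i\<close>\<close>

definition partial_p :: "'n::finite \<Rightarrow> (real^'n) \<times> (real^'n)" where
  "partial_p i = (0, axis i 1)"

definition dq :: "'n::finite \<Rightarrow> (real^'n) \<times> (real^'n) \<Rightarrow> real" where
  "dq i v = fst v $ i"

definition Dp ::
    "('i, real^'n::finite) bil_field \<Rightarrow> 'i \<Rightarrow> (real^'n) \<times> (real^'n) \<Rightarrow> 'n \<Rightarrow> (real^'n) \<times> (real^'n) \<Rightarrow> real"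
  where
  "Dp g \<alpha> z i v = snd v $ i - (\<Sum>j\<in>UNIV. Gamma0 g \<alpha> z i j * dq j v)"

definition g0_up ::
    "('i, real^'n::finite) bil_field \<Rightarrow> 'i \<Rightarrow> (real^'n) \<times> (real^'n) \<Rightarrow> 'n \<Rightarrow> real" where
  "g0_up g \<alpha> = (\<lambda>(q, p) i. \<Sum>h\<in>UNIV. p $ h * g_up g \<alpha> q h i)"

definition energy :: "('i, real^'n::finite) bil_field \<Rightarrow> 'i \<Rightarrow> (real^'n) \<times> (real^'n) \<Rightarrow> real" where
  "energy g \<alpha> = (\<lambda>(q, p). (1/2) * (\<Sum>i\<in>UNIV. \<Sum>j\<in>UNIV. g_up g \<alpha> q i j * p $ i * p $ j))"

text \<open>The tensors \<open>f\<^sub>1(t) g\<^sub>i\<^sub>j + f\<^sub>2(t) p\<^sub>i p\<^sub>j\<close> and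
  \<open>f\<^sub>1(t) g\<^sup>i\<^sup>j + f\<^sub>2(t) g\<^sup>0\<^sup>i g\<^sup>0\<^sup>j\<close>, where \<open>t\<close> is the energy density.\<close>

definition nat_low ::
    "('i, real^'n::finite) bil_field \<Rightarrow> (real \<Rightarrow> real) \<Rightarrow> (real \<Rightarrow> real) \<Rightarrow>
     'i \<Rightarrow> (real^'n) \<times> (real^'n) \<Rightarrow> 'n \<Rightarrow> 'n \<Rightarrow> real" where
  "nat_low g f\<^sub>1 f\<^sub>2 \<alpha> z i j =
     f\<^sub>1 (energy g \<alpha> z) * g_low g \<alpha> (fst z) i j + f\<^sub>2 (energy g \<alpha> z) * snd z $ i * snd z $ j"

definition nat_up ::
    "('i, real^'n::finite) bil_field \<Rightarrow> (real \<Rightarrow> real) \<Rightarrow> (real \<Rightarrow> real) \<Rightarrow>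
     'i \<Rightarrow> (real^'n) \<times> (real^'n) \<Rightarrow> 'n \<Rightarrow> 'n \<Rightarrow> real" where
  "nat_up g f\<^sub>1 f\<^sub>2 \<alpha> z i j =
     f\<^sub>1 (energy g \<alpha> z) * g_up g \<alpha> (fst z) i j + f\<^sub>2 (energy g \<alpha> z) * g0_up g \<alpha> z i * g0_up g \<alpha> z j"

text \<open>The endomorphism with \<open>J \<delta>/\<delta>q\<^sup>i = J\<^sup>(\<^sup>1\<^sup>)\<^sub>i\<^sub>j \<partial>/\<partial>p\<^sub>j\<close> and
  \<open>J \<partial>/\<partial>p\<^sub>i = - J\<^sub>(\<^sub>2\<^sub>)\<^sup>i\<^sup>j \<delta>/\<delta>q\<^sup>j\<close>, extended linearly by means of the dual
  coframe; see \<open>natural_J_delta_q\<close> and \<open>natural_J_partial_p\<close> below.\<close>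

definition natural_J ::
    "('i, real^'n::finite) bil_field \<Rightarrow> (real \<Rightarrow> real) \<Rightarrow> (real \<Rightarrow> real) \<Rightarrow> (real \<Rightarrow> real) \<Rightarrow> (real \<Rightarrow> real) \<Rightarrow>
     ('i, (real^'n) \<times> (real^'n)) end_field" where
  "natural_J g a\<^sub>1 b\<^sub>1 a\<^sub>2 b\<^sub>2 \<alpha> z v =
     (\<Sum>i\<in>UNIV. dq i v *\<^sub>R (\<Sum>j\<in>UNIV. nat_low g a\<^sub>1 b\<^sub>1 \<alpha> z i j *\<^sub>R partial_p j)) +
     (\<Sum>i\<in>UNIV. Dp g \<alpha> z i v *\<^sub>R - (\<Sum>j\<in>UNIV. nat_up g a\<^sub>2 b\<^sub>2 \<alpha> z i j *\<^sub>R delta_q g \<alpha> z j))"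

definition natural_G ::
    "('i, real^'n::finite) bil_field \<Rightarrow> (real \<Rightarrow> real) \<Rightarrow> (real \<Rightarrow> real) \<Rightarrow> (real \<Rightarrow> real) \<Rightarrow> (real \<Rightarrow> real) \<Rightarrow>
     ('i, (real^'n) \<times> (real^'n)) bil_field" where
  "natural_G g c\<^sub>1 d\<^sub>1 c\<^sub>2 d\<^sub>2 \<alpha> z v w =
     (\<Sum>i\<in>UNIV. \<Sum>j\<in>UNIV. nat_low g c\<^sub>1 d\<^sub>1 \<alpha> z i j * dq i v * dq j w) +
     (\<Sum>i\<in>UNIV. \<Sum>j\<in>UNIV. nat_up g c\<^sub>2 d\<^sub>2 \<alpha> z i j * Dp g \<alpha> z i v * Dp g \<alpha> z j w)"

lemma dq_delta_q [simp]: "dq i (delta_q g \<alpha> z j) = (if i = j then 1 else 0)"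
  by (simp add: dq_def delta_q_def axis_def)

lemma dq_partial_p [simp]: "dq i (partial_p j) = 0"
  by (simp add: dq_def partial_p_def)

lemma Dp_partial_p [simp]: "Dp g \<alpha> z i (partial_p j) = (if i = j then 1 else 0)"
  by (simp add: Dp_def) (simp add: partial_p_def axis_def)

lemma natural_J_partial_p:
  "natural_J g a\<^sub>1 b\<^sub>1 a\<^sub>2 b\<^sub>2 \<alpha> z (partial_p i) =
     - (\<Sum>j\<in>UNIV. nat_up g a\<^sub>2 b\<^sub>2 \<alpha> z i j *\<^sub>R delta_q g \<alpha> z j)"
  unfolding natural_J_def
  by (simp add: if_distrib[of "\<lambda>x. x *\<^sub>R _"] sum_negf cong: if_cong)

lemma christoffel_sym:
  assumes "smooth_atlas \<AA>" "riemannian_metric \<AA> g" "\<alpha> \<in> index \<AA>" "q \<in> coord_range \<AA> \<alpha>"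
  shows "christoffel g \<alpha> q k i h = christoffel g \<alpha> q k h i"
proof -
  have opn: "open (coord_range \<AA> \<alpha>)"
    using assms(1,3) unfolding smooth_atlas_def overlap_def coord_range_def by (metis Int_absorb)
  have sym: "g_low g \<alpha> x i h = g_low g \<alpha> x h i" if "x \<in> coord_range \<AA> \<alpha>" for x
    using assms(2,3) that unfolding riemannian_metric_def g_low_def by blast
  have "((\<lambda>x. g_low g \<alpha> x i h) has_derivative D) (at q) \<longleftrightarrow>
        ((\<lambda>x. g_low g \<alpha> x h i) has_derivative D) (at q)" for D
    by (intro iffI; erule has_derivative_transform_within_open[OF _ opn assms(4)]) (simp_all add: sym)
  then have *: "partial_deriv (\<lambda>x. g_low g \<alpha> x i h) l q = partial_deriv (\<lambda>x. g_low g \<alpha> x h i) l q" for l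
    unfolding partial_deriv_def frechet_derivative_def by simp
  show ?thesis
    unfolding christoffel_def * by (simp only: add.commute)
qed

lemma coord_range_nonzero_cotangent_atlas:
  fixes \<AA> :: "('i, 'm, real^'n::finite) atlas"
  assumes at: "smooth_atlas \<AA>" and \<alpha>: "\<alpha> \<in> index \<AA>"
  shows "coord_range (nonzero_cotangent_atlas \<AA>) \<alpha> = coord_range \<AA> \<alpha> \<times> (- {0})"
proof -
  have inj: "inj_on (coord \<AA> \<beta>) (patch \<AA> \<beta>)" if "\<beta> \<in> index \<AA>" for \<beta>
    using at that by (auto simp: smooth_atlas_def)
  have opn: "open (overlap \<AA> \<beta> \<gamma>)" if "\<beta> \<in> index \<AA>" "\<gamma> \<in> index \<AA>" for \<beta> \<gamma>
    using at that by (auto simp: smooth_atlas_def)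
  have tr: "transition \<AA> \<beta> \<gamma> (coord \<AA> \<beta> x) = coord \<AA> \<gamma> x"
    if "\<beta> \<in> index \<AA>" "x \<in> patch \<AA> \<beta>" for \<beta> \<gamma> x
    using inj[OF that(1)] that(2) by (simp add: transition_def)
  have der: "(transition \<AA> \<beta> \<gamma> has_derivative dtrans \<AA> \<beta> \<gamma> (coord \<AA> \<beta> x)) (at (coord \<AA> \<beta> x))"
    if "\<beta> \<in> index \<AA>" "\<gamma> \<in> index \<AA>" "x \<in> patch \<AA> \<beta>" "x \<in> patch \<AA> \<gamma>" for \<beta> \<gamma> x
  proof -
    have "C_on (Suc 0) (overlap \<AA> \<beta> \<gamma>) (transition \<AA> \<beta> \<gamma>)"
      using at that unfolding smooth_atlas_def smooth_on_def by blast
    moreover have "coord \<AA> \<beta> x \<in> overlap \<AA> \<beta> \<gamma>"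
      using that by (auto simp: overlap_def)
    ultimately have "transition \<AA> \<beta> \<gamma> differentiable (at (coord \<AA> \<beta> x))" by simp
    then show ?thesis unfolding dtrans_def by (simp add: frechet_derivative_works)
  qed
  have diag: "dtrans \<AA> \<alpha> \<alpha> (coord \<AA> \<alpha> x) = (\<lambda>v. v)" if x: "x \<in> patch \<AA> \<alpha>" for x
  proof -
    have "coord \<AA> \<alpha> x \<in> overlap \<AA> \<alpha> \<alpha>" using x by (auto simp: overlap_def)
    moreover have "y = transition \<AA> \<alpha> \<alpha> y" if "y \<in> overlap \<AA> \<alpha> \<alpha>" for y
      using that tr[OF \<alpha>] by (auto simp: overlap_def)
    ultimately have "(transition \<AA> \<alpha> \<alpha> has_derivative (\<lambda>v. v)) (at (coord \<AA> \<alpha> x))"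
      by (intro has_derivative_transform_within_open[OF has_derivative_ident opn[OF \<alpha> \<alpha>]]) auto
    then show ?thesis using der[OF \<alpha> \<alpha> x x] has_derivative_unique by blast
  qed
  have chain: "dtrans \<AA> \<beta> \<alpha> (coord \<AA> \<beta> x) v =
      dtrans \<AA> \<gamma> \<alpha> (coord \<AA> \<gamma> x) (dtrans \<AA> \<beta> \<gamma> (coord \<AA> \<beta> x) v)"
    if \<beta>: "\<beta> \<in> index \<AA>" and \<gamma>: "\<gamma> \<in> index \<AA>"
      and x: "x \<in> patch \<AA> \<alpha>" "x \<in> patch \<AA> \<beta>" "x \<in> patch \<AA> \<gamma>" for \<beta> \<gamma> x v
  proof -
    let ?V = "coord \<AA> \<beta> ` (patch \<AA> \<beta> \<inter> patch \<AA> \<alpha> \<inter> patch \<AA> \<gamma>)"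
    have "?V = overlap \<AA> \<beta> \<alpha> \<inter> overlap \<AA> \<beta> \<gamma>"
      using inj[OF \<beta>] unfolding overlap_def inj_on_def by blast
    then have V: "open ?V" using opn \<alpha> \<beta> \<gamma> by auto
    have "(transition \<AA> \<gamma> \<alpha> \<circ> transition \<AA> \<beta> \<gamma> has_derivative
        dtrans \<AA> \<gamma> \<alpha> (coord \<AA> \<gamma> x) \<circ> dtrans \<AA> \<beta> \<gamma> (coord \<AA> \<beta> x)) (at (coord \<AA> \<beta> x))"
      using der[OF \<beta> \<gamma> x(2,3)] der[OF \<gamma> \<alpha> x(3,1)] tr[OF \<beta> x(2)] by (intro diff_chain_at) auto
    moreover have "(transition \<AA> \<gamma> \<alpha> \<circ> transition \<AA> \<beta> \<gamma>) y = transition \<AA> \<beta> \<alpha> y" if "y \<in> ?V" for y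
      using that tr \<beta> \<gamma> by auto
    moreover have "coord \<AA> \<beta> x \<in> ?V" using x by auto
    ultimately have "(transition \<AA> \<beta> \<alpha> has_derivative
        dtrans \<AA> \<gamma> \<alpha> (coord \<AA> \<gamma> x) \<circ> dtrans \<AA> \<beta> \<gamma> (coord \<AA> \<beta> x)) (at (coord \<AA> \<beta> x))"
      using has_derivative_transform_within_open[OF _ V] by blast
    then have "dtrans \<AA> \<beta> \<alpha> (coord \<AA> \<beta> x) =
        dtrans \<AA> \<gamma> \<alpha> (coord \<AA> \<gamma> x) \<circ> dtrans \<AA> \<beta> \<gamma> (coord \<AA> \<beta> x)"
      using der[OF \<beta> \<alpha> x(2,1)] has_derivative_unique by blast
    then show ?thesis by simp
  qed
  have "(coord \<AA> \<alpha> x, p) \<in> coord_range (nonzero_cotangent_atlas \<AA>) \<alpha>"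
    if x: "x \<in> patch \<AA> \<alpha>" and p: "p \<noteq> 0" for x p
  proof -
    define \<xi> where "\<xi> \<beta> = (if \<beta> \<in> index \<AA> \<and> x \<in> patch \<AA> \<beta>
      then \<chi> i. \<Sum>k\<in>UNIV. p $ k * dtrans \<AA> \<beta> \<alpha> (coord \<AA> \<beta> x) (axis i 1) $ k else 0)" for \<beta>
    have \<xi>\<alpha>: "\<xi> \<alpha> = p"
      using \<alpha> x by (simp add: \<xi>_def diag vec_eq_iff axis_def if_distrib cong: if_cong)
    have law: "\<xi> \<beta> $ i = (\<Sum>j\<in>UNIV. \<xi> \<gamma> $ j * dtrans \<AA> \<beta> \<gamma> (coord \<AA> \<beta> x) (axis i 1) $ j)"
      if \<beta>: "\<beta> \<in> index \<AA>" "x \<in> patch \<AA> \<beta>" and \<gamma>: "\<gamma> \<in> index \<AA>" "x \<in> patch \<AA> \<gamma>" for \<beta> \<gamma> i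
    proof -
      let ?L = "dtrans \<AA> \<gamma> \<alpha> (coord \<AA> \<gamma> x)" and ?v = "dtrans \<AA> \<beta> \<gamma> (coord \<AA> \<beta> x) (axis i 1)"
      have lin: "linear ?L" using der[OF \<gamma>(1) \<alpha> \<gamma>(2) x] has_derivative_linear by blast
      have "?L ?v = ?L (\<Sum>j\<in>UNIV. ?v $ j *\<^sub>R axis j 1)"
        using basis_expansion[of ?v] by (simp only: scalar_mult_eq_scaleR)
      also have "\<dots> = (\<Sum>j\<in>UNIV. ?v $ j *\<^sub>R ?L (axis j 1))"
        using lin by (simp add: linear_sum linear_scale)
      finally have Lv: "?L ?v $ k = (\<Sum>j\<in>UNIV. ?v $ j * ?L (axis j 1) $ k)" for k by simp
      have "\<xi> \<beta> $ i = (\<Sum>k\<in>UNIV. p $ k * ?L ?v $ k)"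
        using \<beta> by (simp add: \<xi>_def flip: chain[OF \<beta>(1) \<gamma>(1) x \<beta>(2) \<gamma>(2)])
      also have "\<dots> = (\<Sum>k\<in>UNIV. \<Sum>j\<in>UNIV. p $ k * ?L (axis j 1) $ k * ?v $ j)"
        unfolding Lv by (simp add: sum_distrib_left mult_ac)
      also have "\<dots> = (\<Sum>j\<in>UNIV. \<Sum>k\<in>UNIV. p $ k * ?L (axis j 1) $ k * ?v $ j)"
        by (rule sum.swap)
      also have "\<dots> = (\<Sum>j\<in>UNIV. \<xi> \<gamma> $ j * ?v $ j)"
        using \<gamma> by (simp add: \<xi>_def sum_distrib_right)
      finally show ?thesis .
    qed
    have "\<xi> \<in> cotangent_space \<AA> x"
      unfolding cotangent_space_def using law by (auto simp: \<xi>_def)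
    moreover have "\<xi> \<noteq> (\<lambda>\<alpha>. 0)" using \<xi>\<alpha> p by auto
    ultimately have "(x, \<xi>) \<in> patch (nonzero_cotangent_atlas \<AA>) \<alpha>"
      using x \<alpha> by (auto simp: nonzero_cotangent_atlas_def nonzero_cotangent_def carrier_def)
    moreover have "coord (nonzero_cotangent_atlas \<AA>) \<alpha> (x, \<xi>) = (coord \<AA> \<alpha> x, p)"
      by (simp add: nonzero_cotangent_atlas_def \<xi>\<alpha>)
    ultimately show ?thesis unfolding coord_range_def by (metis imageI)
  qed
  moreover have "\<xi> \<alpha> \<noteq> 0" if x: "x \<in> patch \<AA> \<alpha>" and \<xi>: "\<xi> \<in> cotangent_space \<AA> x" "\<xi> \<noteq> (\<lambda>\<alpha>. 0)" for x \<xi>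
  proof
    assume z: "\<xi> \<alpha> = 0"
    have "\<xi> \<beta> = 0" for \<beta>
    proof (cases "\<beta> \<in> index \<AA> \<and> x \<in> patch \<AA> \<beta>")
      case True
      then have "\<xi> \<beta> $ i = (\<Sum>j\<in>UNIV. \<xi> \<alpha> $ j * dtrans \<AA> \<beta> \<alpha> (coord \<AA> \<beta> x) (axis i 1) $ j)" for i
        using \<xi>(1) \<alpha> x unfolding cotangent_space_def by blast
      then show ?thesis using z by (simp add: vec_eq_iff)
    next
      case False
      then show ?thesis using \<xi>(1) unfolding cotangent_space_def by blast
    qed
    then show False using \<xi>(2) by auto
  qed
  ultimately show ?thesis
    by (auto simp: coord_range_def nonzero_cotangent_atlas_def nonzero_cotangent_def)
qed

lemma natural_J_delta_q:
  assumes "smooth_atlas \<AA>" "riemannian_metric \<AA> g" "\<alpha> \<in> index \<AA>"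
    and "z \<in> coord_range (nonzero_cotangent_atlas \<AA>) \<alpha>"
  shows "natural_J g a\<^sub>1 b\<^sub>1 a\<^sub>2 b\<^sub>2 \<alpha> z (delta_q g \<alpha> z i) =
     (\<Sum>j\<in>UNIV. nat_low g a\<^sub>1 b\<^sub>1 \<alpha> z i j *\<^sub>R partial_p j)"
proof -
  have "fst z \<in> coord_range \<AA> \<alpha>"
    using assms(4) unfolding coord_range_nonzero_cotangent_atlas[OF assms(1,3)] by (simp add: mem_Times_iff)
  then have "Gamma0 g \<alpha> z i h = Gamma0 g \<alpha> z h i" for h
    unfolding Gamma0_def case_prod_beta by (simp only: christoffel_sym[OF assms(1-3), of _ _ i h])
  then have "Dp g \<alpha> z h (delta_q g \<alpha> z i) = 0" for h
    unfolding Dp_def dq_def delta_q_def by (simp add: axis_def if_distrib cong: if_cong)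
  then show ?thesis
    unfolding natural_J_def by (simp add: if_distrib[of "\<lambda>x. x *\<^sub>R _"] cong: if_cong)
qed

end

theory Submission
  imports Defs
begin

text \<open>
  At a covector \<open>p\<close> over \<open>q\<close> the connection splits a tangent vector of the cotangent bundle
  into a horizontal part, identified with a vector \<open>u\<close> at \<open>q\<close>, and a vertical part, identified
  with a covector \<open>w\<close> at \<open>q\<close>. In this splitting \<open>J(u,w) = (- K\<^sub>2 w, K\<^sub>1 u)\<close>, where
  \<open>K\<^sub>1 = a\<^sub>1 g + b\<^sub>1 p \<otimes> p\<close> maps vectors to covectors and \<open>K\<^sub>2\<close>, built in the same way from
  \<open>a\<^sub>2, b\<^sub>2\<close> and the inverse metric, maps covectors to vectors; \<open>G\<close> is the orthogonal sum of two
  forms of the same kind. Such a map acts by one factor on the line of \<open>p\<close>, namely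
  \<open>a + 2 t b\<close>, and by the other factor \<open>a\<close> on its orthogonal complement. Hence the algebraic part
  of the claim consists of scalar identities and inequalities, one for each factor:
  \<open>a\<^sub>1 a\<^sub>2 = 1\<close> and \<open>(a\<^sub>1 + 2 t b\<^sub>1) (a\<^sub>2 + 2 t b\<^sub>2) = 1\<close> give \<open>J\<^sup>2 = -1\<close>; the factors of \<open>G\<close>
  are those of \<open>J\<close> multiplied by \<open>\<lambda>\<close> on the complement and by \<open>\<lambda> + 2 t \<mu>\<close> on the line, so
  that \<open>J\<close> is an isometry of \<open>G\<close>, and all of them are positive (\<open>natural_coefficients\<close>,
  \<open>natural_J_squared\<close>, \<open>natural_G_J\<close>, \<open>natural_G_pos\<close>).

  Integrability is where the curvature enters. The Nijenhuis tensor \<open>N\<close> is a bilinear form in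
  the values of the fields with \<open>N(Jx,y) = - J N(x,y)\<close>, so it suffices to evaluate it on the
  horizontal lifts \<open>u\<^sup>h, v\<^sup>h\<close> of fixed coordinate vectors. There it has a horizontal and a
  vertical component, and their vanishing means
  \<open>[u\<^sup>h, K\<^sub>1 v] = [v\<^sup>h, K\<^sub>1 u]\<close> and \<open>[K\<^sub>1 u, K\<^sub>1 v] = [u\<^sup>h, v\<^sup>h]\<close>. The first equation holds for every
  choice of \<open>a\<^sub>1, b\<^sub>1\<close>, because \<open>g\<close>, \<open>p\<close> and \<open>t\<close> are parallel along horizontal curves
  (\<open>bracket_hor_vert\<close>). In the second equation the left-hand side is
  \<open>a\<^sub>1 a\<^sub>1' + b\<^sub>1 (2 t a\<^sub>1' - a\<^sub>1)\<close> times \<open>\<langle>p,u\<rangle> g v - \<langle>p,v\<rangle> g u\<close> (\<open>bracket_vert_vert\<close>),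
  and the right-hand side is the covector \<open>\<langle>p, R(u,v) -\<rangle>\<close> (\<open>bracket_hor_hor\<close>), which for constant
  sectional curvature \<open>c\<close> is \<open>c\<close> times the same expression (\<open>constant_curvature_tensor\<close>). The
  formula for \<open>b\<^sub>1\<close> is the solution of \<open>a\<^sub>1 a\<^sub>1' + b\<^sub>1 (2 t a\<^sub>1' - a\<^sub>1) = c\<close> for
  \<open>a\<^sub>1 = A t \<lambda>\<close>.

  It remains to see that \<open>G\<close> and \<open>J\<close> do not depend on the chart. The Koszul formula determines the
  Christoffel symbols and thereby yields their transformation law; it makes the vertical part of a
  tangent vector a covector (\<open>vert_transform\<close>), and everything else is built from \<open>g\<close> and \<open>p\<close>.

  To keep these computations free of indices, tensors are treated as families of multilinear maps on
  the coordinate space, and covectors are paired with vectors by the inner product of that space.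
\<close>

section \<open>Calculus of smooth maps\<close>

lemma C_on_Suc_D: "C_on (Suc k) S f \<Longrightarrow> C_on k S f"
proof (induction k arbitrary: f)
  case 0
  then show ?case
    by (simp add: continuous_at_imp_continuous_on differentiable_imp_continuous_within)
next
  case (Suc k)
  have "C_on k S (\<lambda>x. frechet_derivative f (at x) v)" for v
  proof (rule Suc.IH)
    show "C_on (Suc k) S (\<lambda>x. frechet_derivative f (at x) v)"
      using Suc.prems unfolding C_on.simps(2)[of "Suc k"] by blast
  qed
  with Suc.prems show ?case by simp
qed

lemma C_on_cong:
  assumes "open S" "\<And>x. x \<in> S \<Longrightarrow> f x = g x" "C_on k S f"
  shows "C_on k S g"
  using assms(2,3)
proof (induction k arbitrary: f g)
  case 0
  then show ?case using continuous_on_cong by (metis C_on.simps(1))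
next
  case (Suc k)
  have der: "(g has_derivative frechet_derivative f (at x)) (at x)" if "x \<in> S" for x
  proof -
    have "(f has_derivative frechet_derivative f (at x)) (at x)"
      using Suc.prems(2) that by (simp add: frechet_derivative_works)
    then show ?thesis
      using Suc.prems(1) has_derivative_transform_within_open[OF _ \<open>open S\<close> that] by blast
  qed
  have "g differentiable (at x)" if "x \<in> S" for x
    using der[OF that] by (rule differentiableI)
  moreover have "C_on k S (\<lambda>x. frechet_derivative g (at x) v)" for v
  proof (rule Suc.IH)
    show "C_on k S (\<lambda>x. frechet_derivative f (at x) v)" using Suc.prems(2) by simp
    show "frechet_derivative f (at x) v = frechet_derivative g (at x) v" if "x \<in> S" for x
      using frechet_derivative_at[OF der[OF that]] by simp
  qed
  ultimately show ?case by simp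
qed

lemma C_on_SucI:
  assumes "open S" "\<And>x. x \<in> S \<Longrightarrow> (f has_derivative f' x) (at x)"
    and "\<And>v. C_on k S (\<lambda>x. f' x v)"
  shows "C_on (Suc k) S f"
proof -
  have "f' x v = frechet_derivative f (at x) v" if "x \<in> S" for x v
    using frechet_derivative_at[OF assms(2)[OF that]] by simp
  then have "C_on k S (\<lambda>x. frechet_derivative f (at x) v)" for v
    by (intro C_on_cong[OF assms(1) _ assms(3)[of v]])
  moreover have "f differentiable (at x)" if "x \<in> S" for x
    using assms(2)[OF that] by (rule differentiableI)
  ultimately show ?thesis by simp
qed

lemma C_on_SucD:
  assumes "C_on (Suc k) S f"
  shows "x \<in> S \<Longrightarrow> (f has_derivative frechet_derivative f (at x)) (at x)"
    and "C_on k S (\<lambda>x. frechet_derivative f (at x) v)"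
  using assms by (simp_all add: frechet_derivative_works)

lemma C_on_const: "open S \<Longrightarrow> C_on k S (\<lambda>x. c)"
proof (induction k arbitrary: c)
  case (Suc k)
  show ?case
    by (rule C_on_SucI[where f' = "\<lambda>x v. 0"]) (use Suc in auto)
qed simp

lemma C_on_bounded_linear:
  assumes S: "open S" and L: "bounded_linear L" and "C_on k S f"
  shows "C_on k S (\<lambda>x. L (f x))"
  using assms(3)
proof (induction k arbitrary: f)
  case 0
  then show ?case using bounded_linear.continuous_on[OF L] by simp
next
  case (Suc k)
  show ?case
  proof (rule C_on_SucI[OF S])
    show "((\<lambda>x. L (f x)) has_derivative (\<lambda>v. L (frechet_derivative f (at x) v))) (at x)"
      if "x \<in> S" for x
      using bounded_linear.has_derivative[OF L C_on_SucD(1)[OF Suc.prems that]] .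
    show "C_on k S (\<lambda>x. L (frechet_derivative f (at x) v))" for v
      by (rule Suc.IH) (rule C_on_SucD(2)[OF Suc.prems])
  qed
qed

lemma C_on_add:
  assumes S: "open S" and "C_on k S f" "C_on k S g"
  shows "C_on k S (\<lambda>x. f x + g x)"
  using assms(2,3)
proof (induction k arbitrary: f g)
  case 0
  then show ?case by (simp add: continuous_on_add)
next
  case (Suc k)
  show ?case
    by (rule C_on_SucI[OF S, where f' = "\<lambda>x v. frechet_derivative f (at x) v + frechet_derivative g (at x) v"])
      (use Suc.prems in \<open>auto intro!: Suc.IH has_derivative_add simp: frechet_derivative_works\<close>)
qed

text \<open>By the Leibniz rule the derivative of a product is a sum of products of maps that are at least \<open>k\<close> times
  differentiable, so the induction on \<open>k\<close> closes.\<close>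

lemma C_on_bilinear:
  assumes S: "open S" and B: "bounded_bilinear B" and "C_on k S f" "C_on k S g"
  shows "C_on k S (\<lambda>x. B (f x) (g x))"
  using assms(3,4)
proof (induction k arbitrary: f g)
  case 0
  then show ?case using bounded_bilinear.continuous_on[OF B] by simp
next
  case (Suc k)
  show ?case
  proof (rule C_on_SucI[OF S])
    show "((\<lambda>x. B (f x) (g x)) has_derivative
        (\<lambda>v. B (f x) (frechet_derivative g (at x) v) + B (frechet_derivative f (at x) v) (g x))) (at x)"
      if "x \<in> S" for x
      using bounded_bilinear.FDERIV[OF B] C_on_SucD(1)[OF Suc.prems(1) that]
        C_on_SucD(1)[OF Suc.prems(2) that] by blast
    show "C_on k S (\<lambda>x. B (f x) (frechet_derivative g (at x) v) + B (frechet_derivative f (at x) v) (g x))" for v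
      using Suc.prems by (intro C_on_add[OF S] Suc.IH) (simp_all add: C_on_Suc_D del: C_on.simps(2) add: C_on_SucD(2))
  qed
qed

lemma C_on_sum:
  assumes "open S" "\<And>i. i \<in> I \<Longrightarrow> C_on k S (f i)"
  shows "C_on k S (\<lambda>x. \<Sum>i\<in>I. f i x)"
proof (cases "finite I")
  case True
  then show ?thesis using assms(2)
    by (induction I) (auto simp: C_on_const[OF assms(1)] intro: C_on_add[OF assms(1)])
next
  case False
  then show ?thesis by (simp add: C_on_const[OF assms(1)])
qed

lemma C_on_ident: "open S \<Longrightarrow> C_on k S (\<lambda>x. x)"
proof (induction k)
  case (Suc k)
  show ?case
    by (rule C_on_SucI[where f' = "\<lambda>x v. v"]) (use Suc in \<open>auto intro: C_on_const\<close>)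
qed simp

text \<open>The chain rule \<open>D(f \<circ> g)(v) = \<Sum>\<^sub>b (Dg(v) \<bullet> b) (D\<^sub>b f \<circ> g)\<close> over a basis
  exhibits the derivative of a composition as a sum of products of maps that are one step less
  regular, which is what the induction needs.\<close>

lemma C_on_compose:
  fixes f :: "'b::euclidean_space \<Rightarrow> 'c::real_normed_vector"
  assumes S: "open S" and "C_on k T f" "C_on k S g" and gT: "\<And>x. x \<in> S \<Longrightarrow> g x \<in> T"
  shows "C_on k S (\<lambda>x. f (g x))"
  using assms(2,3)
proof (induction k arbitrary: f)
  case 0
  then show ?case
    using continuous_on_compose2[of T f S g] gT by auto
next
  case (Suc k)
  define d where "d x v = (\<Sum>b\<in>Basis. (frechet_derivative g (at x) v \<bullet> b) *\<^sub>R frechet_derivative f (at (g x)) b)"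
    for x v
  show ?case
  proof (rule C_on_SucI[OF S, of _ d])
    show "((\<lambda>x. f (g x)) has_derivative d x) (at x)" if x: "x \<in> S" for x
    proof -
      have df: "(f has_derivative frechet_derivative f (at (g x))) (at (g x))"
        using C_on_SucD(1)[OF Suc.prems(1)] gT x by blast
      then have lin: "linear (frechet_derivative f (at (g x)))"
        by (rule has_derivative_linear)
      have "(\<Sum>b\<in>Basis. (w \<bullet> b) *\<^sub>R frechet_derivative f (at (g x)) b) = frechet_derivative f (at (g x)) w" for w
        using linear_sum[OF lin, of "\<lambda>b. (w \<bullet> b) *\<^sub>R b" Basis] linear_scale[OF lin]
        by (simp add: euclidean_representation)
      moreover have "((\<lambda>x. f (g x)) has_derivative
          (\<lambda>v. frechet_derivative f (at (g x)) (frechet_derivative g (at x) v))) (at x)"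
        using has_derivative_compose[OF C_on_SucD(1)[OF Suc.prems(2) x] df] .
      ultimately show ?thesis by (simp add: d_def[abs_def])
    qed
    show "C_on k S (\<lambda>x. d x v)" for v
      unfolding d_def
    proof (intro C_on_sum[OF S] C_on_bilinear[OF S bounded_bilinear_scaleR])
      show "C_on k S (\<lambda>x. frechet_derivative g (at x) v \<bullet> b)" for b
        using C_on_bounded_linear[OF S bounded_linear_inner_left] C_on_SucD(2)[OF Suc.prems(2)] by blast
      show "C_on k S (\<lambda>x. frechet_derivative f (at (g x)) b)" for b
        using Suc.IH[OF C_on_SucD(2)[OF Suc.prems(1)]] C_on_Suc_D[OF Suc.prems(2)] by blast
    qed
  qed
qed

lemma C_on_inverse: "C_on k (- {0}) (inverse :: real \<Rightarrow> real)"
proof (induction k)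
  case 0
  show ?case by (simp add: continuous_on_inverse)
next
  case (Suc k)
  have S: "open (- {0::real})" by (simp add: open_Compl)
  show ?case
  proof (rule C_on_SucI[OF S])
    show "(inverse has_derivative (\<lambda>v. - (inverse x * v * inverse x))) (at x)" if "x \<in> - {0}" for x :: real
      using has_derivative_inverse'[of x] that by simp
    have "C_on k (- {0}) (\<lambda>x::real. - (inverse x * inverse x * v))" for v
      by (intro C_on_bounded_linear[OF S, where L = "\<lambda>y. - y"] C_on_bilinear[OF S bounded_bilinear_mult]
          C_on_const Suc S bounded_linear_minus bounded_linear_ident)
    then show "C_on k (- {0}) (\<lambda>x::real. - (inverse x * v * inverse x))" for v
      by (simp add: mult_ac)
  qed
qed

named_theorems smooth_intros

lemma smooth_on_cong:
  "open S \<Longrightarrow> (\<And>x. x \<in> S \<Longrightarrow> f x = g x) \<Longrightarrow> smooth_on S f \<Longrightarrow> smooth_on S g"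
  unfolding smooth_on_def using C_on_cong by blast

lemma smooth_on_differentiable:
  "smooth_on S f \<Longrightarrow> x \<in> S \<Longrightarrow> f differentiable (at x)"
  unfolding smooth_on_def using C_on.simps(2) by blast

lemma smooth_on_has_derivative:
  "smooth_on S f \<Longrightarrow> x \<in> S \<Longrightarrow> (f has_derivative frechet_derivative f (at x)) (at x)"
  using smooth_on_differentiable frechet_derivative_works by blast

lemma smooth_on_frechet_derivative:
  "smooth_on S f \<Longrightarrow> smooth_on S (\<lambda>x. frechet_derivative f (at x) v)"
  unfolding smooth_on_def using C_on.simps(2) by blast

lemma smooth_on_continuous_on: "smooth_on S f \<Longrightarrow> continuous_on S f"
  unfolding smooth_on_def by (metis C_on.simps(1))

lemma smooth_on_const [smooth_intros]: "open S \<Longrightarrow> smooth_on S (\<lambda>x. c)"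
  by (simp add: smooth_on_def C_on_const)

lemma smooth_on_bounded_linear:
  "bounded_linear L \<Longrightarrow> open S \<Longrightarrow> smooth_on S f \<Longrightarrow> smooth_on S (\<lambda>x. L (f x))"
  by (simp add: smooth_on_def C_on_bounded_linear)

lemma smooth_on_linear: "bounded_linear L \<Longrightarrow> open S \<Longrightarrow> smooth_on S L"
  using smooth_on_bounded_linear[of L S "\<lambda>x. x"] by (simp add: smooth_on_def C_on_ident)

lemma smooth_on_bilinear:
  "bounded_bilinear B \<Longrightarrow> open S \<Longrightarrow> smooth_on S f \<Longrightarrow> smooth_on S g \<Longrightarrow> smooth_on S (\<lambda>x. B (f x) (g x))"
  by (simp add: smooth_on_def C_on_bilinear)

lemmas smooth_on_mult [smooth_intros] = smooth_on_bilinear[OF bounded_bilinear_mult]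
  and smooth_on_scaleR [smooth_intros] = smooth_on_bilinear[OF bounded_bilinear_scaleR]
  and smooth_on_uminus [smooth_intros] = smooth_on_bounded_linear[OF bounded_linear_minus[OF bounded_linear_ident]]
  and smooth_on_inner_left = smooth_on_bounded_linear[OF bounded_linear_inner_left]
  and smooth_on_vec_nth [smooth_intros] = smooth_on_bounded_linear[OF bounded_linear_vec_nth]

lemma smooth_on_add [smooth_intros]:
  "open S \<Longrightarrow> smooth_on S f \<Longrightarrow> smooth_on S g \<Longrightarrow> smooth_on S (\<lambda>x. f x + g x)"
  by (simp add: smooth_on_def C_on_add)

lemma smooth_on_diff [smooth_intros]:
  "open S \<Longrightarrow> smooth_on S f \<Longrightarrow> smooth_on S g \<Longrightarrow> smooth_on S (\<lambda>x. f x - g x)"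
  using smooth_on_add[OF _ _ smooth_on_uminus, of S f g] by simp

lemma smooth_on_sum [smooth_intros]:
  "open S \<Longrightarrow> (\<And>i. i \<in> I \<Longrightarrow> smooth_on S (f i)) \<Longrightarrow> smooth_on S (\<lambda>x. \<Sum>i\<in>I. f i x)"
  by (simp add: smooth_on_def C_on_sum)

lemma smooth_on_prod [smooth_intros]:
  fixes f :: "'i \<Rightarrow> 'a::real_normed_vector \<Rightarrow> real"
  assumes "open S" "\<And>i. i \<in> I \<Longrightarrow> smooth_on S (f i)"
  shows "smooth_on S (\<lambda>x. \<Prod>i\<in>I. f i x)"
proof (cases "finite I")
  case True
  then show ?thesis using assms(2)
    by (induction I) (auto simp: smooth_on_const[OF assms(1)] intro: smooth_on_mult[OF assms(1)])
next
  case False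
  then show ?thesis by (simp add: smooth_on_const[OF assms(1)])
qed

lemma smooth_on_power [smooth_intros]:
  fixes f :: "'a::real_normed_vector \<Rightarrow> real"
  shows "open S \<Longrightarrow> smooth_on S f \<Longrightarrow> smooth_on S (\<lambda>x. f x ^ n)"
  by (induction n) (auto intro: smooth_on_mult smooth_on_const)

lemma smooth_on_compose:
  fixes f :: "'b::euclidean_space \<Rightarrow> 'c::real_normed_vector"
  assumes "open S" "smooth_on T f" "smooth_on S g" "\<And>x. x \<in> S \<Longrightarrow> g x \<in> T"
  shows "smooth_on S (\<lambda>x. f (g x))"
  using assms C_on_compose unfolding smooth_on_def by blast

lemma smooth_on_divide [smooth_intros]:
  fixes f g :: "'a::real_normed_vector \<Rightarrow> real"
  assumes S: "open S" and "smooth_on S f" "smooth_on S g" "\<And>x. x \<in> S \<Longrightarrow> g x \<noteq> 0"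
  shows "smooth_on S (\<lambda>x. f x / g x)"
proof -
  have "smooth_on (- {0}) (inverse :: real \<Rightarrow> real)"
    by (simp add: smooth_on_def C_on_inverse)
  then have "smooth_on S (\<lambda>x. inverse (g x))"
    using smooth_on_compose[OF S _ assms(3), of "- {0}" inverse] assms(4) by simp
  then show ?thesis
    unfolding divide_inverse using assms(2) by (intro smooth_on_mult S)
qed

lemma smooth_on_componentwise:
  fixes f :: "'a::real_normed_vector \<Rightarrow> real^'n"
  assumes S: "open S" and "\<And>i. smooth_on S (\<lambda>x. f x $ i)"
  shows "smooth_on S f"
proof -
  have "f = (\<lambda>x. \<Sum>i\<in>UNIV. f x $ i *\<^sub>R axis i 1)"
    using basis_expansion[of "f x" for x] by (auto simp: scalar_mult_eq_scaleR)
  moreover have "smooth_on S (\<lambda>x. \<Sum>i\<in>UNIV. f x $ i *\<^sub>R (axis i 1 :: real^'n))"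
    by (intro smooth_intros assms)
  ultimately show ?thesis by simp
qed

lemma smooth_on_Pair [smooth_intros]:
  assumes "open S" "smooth_on S f" "smooth_on S g"
  shows "smooth_on S (\<lambda>x. (f x, g x))"
proof -
  have "smooth_on S (\<lambda>x. (f x, 0) + (0, g x))"
    using assms smooth_on_bounded_linear[OF bounded_linear_Pair[OF bounded_linear_ident bounded_linear_zero]]
      smooth_on_bounded_linear[OF bounded_linear_Pair[OF bounded_linear_zero bounded_linear_ident]]
    by (intro smooth_on_add) blast+
  then show ?thesis by simp
qed

lemma smooth_on_deriv:
  fixes f :: "real \<Rightarrow> real"
  assumes "open S" "smooth_on S f"
  shows "smooth_on S (deriv f)"
proof (rule smooth_on_cong[OF assms(1) _ smooth_on_frechet_derivative[OF assms(2), of 1]])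
  fix x assume "x \<in> S"
  then have der: "(f has_derivative frechet_derivative f (at x)) (at x)"
    by (rule smooth_on_has_derivative[OF assms(2)])
  have "frechet_derivative f (at x) v = frechet_derivative f (at x) 1 * v" for v
    using linear_scale[OF has_derivative_linear[OF der], of v 1] by simp
  then have "frechet_derivative f (at x) = (*) (frechet_derivative f (at x) 1)"
    by (rule ext)
  then have "(f has_field_derivative frechet_derivative f (at x) 1) (at x)"
    using der by (simp add: has_field_derivative_def)
  then show "frechet_derivative f (at x) 1 = deriv f x"
    by (rule DERIV_imp_deriv[symmetric])
qed

abbreviation ddir :: "('a::real_normed_vector \<Rightarrow> 'b::real_normed_vector) \<Rightarrow> 'a \<Rightarrow> 'a \<Rightarrow> 'b" where
  "ddir f x v \<equiv> frechet_derivative f (at x) v"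

lemma ddir_eq: "(f has_derivative f') (at x) \<Longrightarrow> ddir f x v = f' v"
  using frechet_derivative_at by metis

text \<open>The mean value theorem is applied in the direction \<open>u\<close> to the difference of \<open>f\<close> along two
  parallel segments, and then in the direction \<open>v\<close> to the derivative of \<open>f\<close> along \<open>u\<close>. Reading the
  second difference with \<open>u\<close> and \<open>v\<close> exchanged is what makes mixed derivatives commute.\<close>

lemma second_difference_mean_value:
  fixes f :: "'a::real_normed_vector \<Rightarrow> real"
  assumes f: "smooth_on S f" and t: "0 < t"
    and S: "\<And>a b. 0 \<le> a \<Longrightarrow> a \<le> t \<Longrightarrow> 0 \<le> b \<Longrightarrow> b \<le> t \<Longrightarrow> x + a *\<^sub>R u + b *\<^sub>R v \<in> S"
  shows "\<exists>a b. 0 < a \<and> a < t \<and> 0 < b \<and> b < t \<and>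
    f (x + t *\<^sub>R u + t *\<^sub>R v) - f (x + t *\<^sub>R u) - f (x + t *\<^sub>R v) + f x =
      t * t * ddir (\<lambda>y. ddir f y u) (x + a *\<^sub>R u + b *\<^sub>R v) v"
proof -
  have line: "((\<lambda>s. h (y + s *\<^sub>R w)) has_real_derivative ddir h (y + s *\<^sub>R w) w) (at s)"
    if h: "smooth_on S h" and s: "y + s *\<^sub>R w \<in> S" for h :: "'a \<Rightarrow> real" and y w s
  proof -
    have d: "(h has_derivative ddir h (y + s *\<^sub>R w)) (at (y + s *\<^sub>R w))"
      using smooth_on_has_derivative[OF h s] .
    have "((\<lambda>s. h (y + s *\<^sub>R w)) has_derivative (\<lambda>r. ddir h (y + s *\<^sub>R w) (r *\<^sub>R w))) (at s)"
      by (rule has_derivative_compose[where f = "\<lambda>s. y + s *\<^sub>R w" and g = h, OF _ d]) (auto intro!: derivative_eq_intros)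
    moreover have "ddir h (y + s *\<^sub>R w) (r *\<^sub>R w) = ddir h (y + s *\<^sub>R w) w * r" for r
      using linear_scale[OF has_derivative_linear[OF d]] by simp
    ultimately show ?thesis by (simp add: has_field_derivative_def)
  qed
  define \<phi> where "\<phi> s = f ((x + t *\<^sub>R v) + s *\<^sub>R u) - f (x + s *\<^sub>R u)" for s
  have in_S: "(x + t *\<^sub>R v) + s *\<^sub>R u \<in> S" "x + s *\<^sub>R u \<in> S" if "0 \<le> s" "s \<le> t" for s
    using S[of s t] S[of s 0] that t by (simp_all add: algebra_simps)
  have "\<exists>a. 0 < a \<and> a < t \<and> \<phi> t - \<phi> 0 = (t - 0) * (ddir f ((x + t *\<^sub>R v) + a *\<^sub>R u) u - ddir f (x + a *\<^sub>R u) u)"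
    unfolding \<phi>_def
    by (rule MVT2[OF t]) (intro DERIV_diff line f in_S; assumption)
  then obtain a where a: "0 < a" "a < t"
    and \<phi>: "\<phi> t - \<phi> 0 = t * (ddir f ((x + t *\<^sub>R v) + a *\<^sub>R u) u - ddir f (x + a *\<^sub>R u) u)"
    by auto
  have "\<exists>b. 0 < b \<and> b < t \<and> ddir f ((x + a *\<^sub>R u) + t *\<^sub>R v) u - ddir f ((x + a *\<^sub>R u) + 0 *\<^sub>R v) u =
      (t - 0) * ddir (\<lambda>y. ddir f y u) ((x + a *\<^sub>R u) + b *\<^sub>R v) v"
    by (rule MVT2[OF t], rule line[OF smooth_on_frechet_derivative[OF f]]) (use S a in auto)
  then obtain b where b: "0 < b" "b < t" and *: "ddir f ((x + a *\<^sub>R u) + t *\<^sub>R v) u - ddir f (x + a *\<^sub>R u) u =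
      t * ddir (\<lambda>y. ddir f y u) ((x + a *\<^sub>R u) + b *\<^sub>R v) v"
    by auto
  have "f (x + t *\<^sub>R u + t *\<^sub>R v) - f (x + t *\<^sub>R u) - f (x + t *\<^sub>R v) + f x = \<phi> t - \<phi> 0"
    by (simp add: \<phi>_def add_ac)
  also have "\<dots> = t * t * ddir (\<lambda>y. ddir f y u) (x + a *\<^sub>R u + b *\<^sub>R v) v"
    unfolding \<phi> using * by (simp add: add_ac)
  finally show ?thesis using a b by blast
qed

lemma ddir_symmetric_real:
  fixes f :: "'a::real_normed_vector \<Rightarrow> real"
  assumes S: "open S" and f: "smooth_on S f" and x: "x \<in> S"
  shows "ddir (\<lambda>y. ddir f y u) x v = ddir (\<lambda>y. ddir f y v) x u"
proof -
  define D where "D u v y = ddir (\<lambda>y. ddir f y u) y v" for u v y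
  have cont: "continuous_on S (D u v)" for u v
    unfolding D_def
    by (intro smooth_on_continuous_on smooth_on_frechet_derivative f)
  have "\<bar>D u v x - D v u x\<bar> \<le> e" if e: "e > 0" for e
  proof -
    have near: "\<exists>d>0. \<forall>y. dist y x < d \<longrightarrow> y \<in> S \<and> \<bar>D u v y - D u v x\<bar> < e / 2" for u v
    proof -
      have "isCont (D u v) x"
        using cont S x by (simp add: continuous_on_eq_continuous_at)
      then obtain d1 where "d1 > 0" "\<forall>y. dist y x < d1 \<longrightarrow> dist (D u v y) (D u v x) < e / 2"
        using e by (metis continuous_at_eps_delta half_gt_zero)
      moreover obtain d2 where "d2 > 0" "\<forall>y. dist y x < d2 \<longrightarrow> y \<in> S"
        using S x open_dist by metis
      ultimately show ?thesis
        by (intro exI[of _ "min d1 d2"]) (auto simp: dist_real_def)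
    qed
    obtain d1 where d1: "d1 > 0" "\<And>y. dist y x < d1 \<Longrightarrow> y \<in> S \<and> \<bar>D u v y - D u v x\<bar> < e / 2"
      using near by blast
    obtain d2 where d2: "d2 > 0" "\<And>y. dist y x < d2 \<Longrightarrow> \<bar>D v u y - D v u x\<bar> < e / 2"
      using near by blast
    \<comment> \<open>the parallelogram with sides \<open>t u\<close> and \<open>t v\<close> stays in both neighbourhoods of \<open>x\<close>\<close>
    define t where "t = min d1 d2 / (norm u + norm v + 1)"
    have n: "norm u + norm v + 1 > 0" by (simp add: add_nonneg_pos)
    have t: "t > 0" using d1 d2 n by (simp add: t_def)
    have small: "dist (x + a *\<^sub>R u + b *\<^sub>R v) x < min d1 d2"
      if "0 \<le> a" "a \<le> t" "0 \<le> b" "b \<le> t" for a b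
    proof -
      have "dist (x + a *\<^sub>R u + b *\<^sub>R v) x = norm (a *\<^sub>R u + b *\<^sub>R v)"
        by (simp add: dist_norm add.assoc)
      also have "\<dots> \<le> a * norm u + b * norm v"
        using norm_triangle_ineq[of "a *\<^sub>R u" "b *\<^sub>R v"] that by simp
      also have "\<dots> \<le> t * norm u + t * norm v"
        using that by (intro add_mono mult_right_mono) auto
      also have "\<dots> < t * (norm u + norm v + 1)"
        using t by (simp add: algebra_simps)
      also have "\<dots> = min d1 d2" using n by (simp add: t_def)
      finally show ?thesis .
    qed
    have in_S: "x + a *\<^sub>R u + b *\<^sub>R v \<in> S" if "0 \<le> a" "a \<le> t" "0 \<le> b" "b \<le> t" for a b
      using d1(2) small[OF that] by auto
    then have in_S': "x + b *\<^sub>R v + a *\<^sub>R u \<in> S" if "0 \<le> b" "b \<le> t" "0 \<le> a" "a \<le> t" for a b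
      using that by (metis add.commute add.left_commute)
    obtain a b where ab: "0 < a" "a < t" "0 < b" "b < t"
      and 1: "f (x + t *\<^sub>R u + t *\<^sub>R v) - f (x + t *\<^sub>R u) - f (x + t *\<^sub>R v) + f x = t * t * D u v (x + a *\<^sub>R u + b *\<^sub>R v)"
      using second_difference_mean_value[OF f t in_S] unfolding D_def by blast
    obtain b' a' where ab': "0 < a'" "a' < t" "0 < b'" "b' < t"
      and 2: "f (x + t *\<^sub>R v + t *\<^sub>R u) - f (x + t *\<^sub>R v) - f (x + t *\<^sub>R u) + f x = t * t * D v u (x + b' *\<^sub>R v + a' *\<^sub>R u)"
      using second_difference_mean_value[OF f t in_S'] unfolding D_def by blast
    have "f (x + t *\<^sub>R u + t *\<^sub>R v) = f (x + t *\<^sub>R v + t *\<^sub>R u)" by (simp add: add_ac)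
    then have "t * t * D u v (x + a *\<^sub>R u + b *\<^sub>R v) = t * t * D v u (x + b' *\<^sub>R v + a' *\<^sub>R u)"
      using 1 2 by linarith
    then have "D u v (x + a *\<^sub>R u + b *\<^sub>R v) = D v u (x + a' *\<^sub>R u + b' *\<^sub>R v)"
      using t by (simp add: add_ac)
    moreover have "\<bar>D u v (x + a *\<^sub>R u + b *\<^sub>R v) - D u v x\<bar> < e / 2"
      using d1(2) small[of a b] ab by auto
    moreover have "\<bar>D v u (x + a' *\<^sub>R u + b' *\<^sub>R v) - D v u x\<bar> < e / 2"
      using d2(2) small[of a' b'] ab' by auto
    ultimately show ?thesis by linarith
  qed
  then have "D u v x - D v u x = 0"
    by (metis abs_le_zero_iff field_le_epsilon add_0)
  then show ?thesis by (simp add: D_def)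
qed

lemma ddir_symmetric:
  fixes f :: "'a::real_normed_vector \<Rightarrow> 'b::euclidean_space"
  assumes S: "open S" and f: "smooth_on S f" and x: "x \<in> S"
  shows "ddir (\<lambda>y. ddir f y u) x v = ddir (\<lambda>y. ddir f y v) x u"
proof (rule euclidean_eqI)
  fix b :: 'b
  have inner: "ddir (\<lambda>y. h y \<bullet> b) y w = ddir h y w \<bullet> b" if "smooth_on S h" "y \<in> S" for h y w
    using ddir_eq[OF has_derivative_inner_left[OF smooth_on_has_derivative[OF that]]] .
  have second: "ddir (\<lambda>y. ddir (\<lambda>y. f y \<bullet> b) y u) x v = ddir (\<lambda>y. ddir f y u) x v \<bullet> b" for u v
  proof -
    have s: "smooth_on S (\<lambda>y. ddir f y u)" by (rule smooth_on_frechet_derivative[OF f])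
    have "((\<lambda>y. ddir (\<lambda>y. f y \<bullet> b) y u) has_derivative (\<lambda>v. ddir (\<lambda>y. ddir f y u) x v \<bullet> b)) (at x)"
      by (rule has_derivative_transform_within_open[OF has_derivative_inner_left[OF smooth_on_has_derivative[OF s x]] S x])
        (simp add: inner[OF f])
    then show ?thesis by (rule ddir_eq)
  qed
  show "ddir (\<lambda>y. ddir f y u) x v \<bullet> b = ddir (\<lambda>y. ddir f y v) x u \<bullet> b"
    using ddir_symmetric_real[OF S smooth_on_inner_left[OF S f] x, of b u v] by (simp add: second)
qed

lemma ddir_cong:
  assumes "open S" "x \<in> S" "\<And>y. y \<in> S \<Longrightarrow> f y = g y"
  shows "ddir f x v = ddir g x v"
proof -
  have "(f has_derivative D) (at x) \<longleftrightarrow> (g has_derivative D) (at x)" for D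
    by (intro iffI; erule has_derivative_transform_within_open[OF _ assms(1,2)]) (simp_all add: assms(3))
  then show ?thesis by (simp add: frechet_derivative_def)
qed

subsection \<open>Families of linear maps\<close>

text \<open>Tensor fields are evaluated on fields that depend on the point as well. The derivative of such an
  expression splits into the derivative of the tensor with frozen argument and the value of the
  tensor on the derivative of the argument.\<close>

lemma has_derivative_linear_family:
  fixes L :: "'a::real_normed_vector \<Rightarrow> 'b::euclidean_space \<Rightarrow> 'c::real_normed_vector"
  assumes S: "open S" and z: "z \<in> S" and lin: "\<And>x. x \<in> S \<Longrightarrow> linear (L x)"
    and L: "\<And>v. (\<lambda>x. L x v) differentiable (at z)" and Y: "(Y has_derivative Y') (at z)"
  shows "((\<lambda>x. L x (Y x)) has_derivative (\<lambda>h. ddir (\<lambda>x. L x (Y z)) z h + L z (Y' h))) (at z)"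
proof -
  have expand: "L x v = (\<Sum>b\<in>Basis. (v \<bullet> b) *\<^sub>R L x b)" if "x \<in> S" for x v
    using linear_sum[OF lin[OF that], of "\<lambda>b. (v \<bullet> b) *\<^sub>R b" Basis] linear_scale[OF lin[OF that]]
    by (simp add: euclidean_representation)
  have dL: "((\<lambda>x. L x v) has_derivative ddir (\<lambda>x. L x v) z) (at z)" for v
    using L frechet_derivative_works by blast
  have "((\<lambda>x. \<Sum>b\<in>Basis. (v \<bullet> b) *\<^sub>R L x b) has_derivative
      (\<lambda>h. \<Sum>b\<in>Basis. (v \<bullet> b) *\<^sub>R ddir (\<lambda>x. L x b) z h)) (at z)" for v
    by (intro has_derivative_sum has_derivative_scaleR_right dL)
  then have "((\<lambda>x. L x v) has_derivative
      (\<lambda>h. \<Sum>b\<in>Basis. (v \<bullet> b) *\<^sub>R ddir (\<lambda>x. L x b) z h)) (at z)" for v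
    by (rule has_derivative_transform_within_open[OF _ S z]) (simp add: expand[symmetric])
  then have expand': "ddir (\<lambda>x. L x v) z h = (\<Sum>b\<in>Basis. (v \<bullet> b) *\<^sub>R ddir (\<lambda>x. L x b) z h)" for v h
    by (rule ddir_eq)
  have "((\<lambda>x. \<Sum>b\<in>Basis. (Y x \<bullet> b) *\<^sub>R L x b) has_derivative
      (\<lambda>h. \<Sum>b\<in>Basis. (Y z \<bullet> b) *\<^sub>R ddir (\<lambda>x. L x b) z h + (Y' h \<bullet> b) *\<^sub>R L z b)) (at z)"
    by (intro has_derivative_sum has_derivative_scaleR dL has_derivative_inner_left Y)
  then have "((\<lambda>x. L x (Y x)) has_derivative
      (\<lambda>h. \<Sum>b\<in>Basis. (Y z \<bullet> b) *\<^sub>R ddir (\<lambda>x. L x b) z h + (Y' h \<bullet> b) *\<^sub>R L z b)) (at z)"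
    by (rule has_derivative_transform_within_open[OF _ S z]) (simp add: expand[symmetric])
  then show ?thesis
    by (simp add: sum.distrib expand'[of "Y z"] expand[OF z, of "Y' _"])
qed

lemma linear_ddir_family:
  fixes L :: "'a::real_normed_vector \<Rightarrow> 'b::real_vector \<Rightarrow> 'c::real_normed_vector"
  assumes S: "open S" and z: "z \<in> S" and lin: "\<And>x. x \<in> S \<Longrightarrow> linear (L x)"
    and L: "\<And>v. (\<lambda>x. L x v) differentiable (at z)"
  shows "linear (\<lambda>v. ddir (\<lambda>x. L x v) z h)"
proof
  have dL: "((\<lambda>x. L x v) has_derivative ddir (\<lambda>x. L x v) z) (at z)" for v
    using L frechet_derivative_works by blast
  fix u v :: 'b and r :: real
  have "((\<lambda>x. L x (u + v)) has_derivative (\<lambda>h. ddir (\<lambda>x. L x u) z h + ddir (\<lambda>x. L x v) z h)) (at z)"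
    by (rule has_derivative_transform_within_open[OF has_derivative_add[OF dL dL] S z])
      (simp add: linear_add[OF lin])
  then show "ddir (\<lambda>x. L x (u + v)) z h = ddir (\<lambda>x. L x u) z h + ddir (\<lambda>x. L x v) z h"
    by (rule ddir_eq)
  have "((\<lambda>x. L x (r *\<^sub>R u)) has_derivative (\<lambda>h. r *\<^sub>R ddir (\<lambda>x. L x u) z h)) (at z)"
    by (rule has_derivative_transform_within_open[OF has_derivative_scaleR_right[OF dL] S z])
      (simp add: linear_scale[OF lin])
  then show "ddir (\<lambda>x. L x (r *\<^sub>R u)) z h = r *\<^sub>R ddir (\<lambda>x. L x u) z h"
    by (rule ddir_eq)
qed

lemma has_derivative_bilinear_family:
  fixes B :: "'a::real_normed_vector \<Rightarrow> 'b::euclidean_space \<Rightarrow> 'd::euclidean_space \<Rightarrow> 'c::real_normed_vector"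
  assumes S: "open S" and z: "z \<in> S" and bil: "\<And>x. x \<in> S \<Longrightarrow> bilinear (B x)"
    and B: "\<And>u v x. x \<in> S \<Longrightarrow> (\<lambda>x. B x u v) differentiable (at x)"
    and Y: "(Y has_derivative Y') (at z)" and Z: "(Z has_derivative Z') (at z)"
  shows "((\<lambda>x. B x (Y x) (Z x)) has_derivative
      (\<lambda>h. ddir (\<lambda>x. B x (Y z) (Z z)) z h + B z (Y' h) (Z z) + B z (Y z) (Z' h))) (at z)"
proof -
  have 1: "((\<lambda>x. B x u (Z x)) has_derivative (\<lambda>h. ddir (\<lambda>x. B x u (Z z)) z h + B z u (Z' h))) (at z)" for u
    by (rule has_derivative_linear_family[OF S z]) (use bil B z Z in \<open>auto simp: bilinear_def\<close>)
  have "((\<lambda>x. B x (Y x) (Z x)) has_derivative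
      (\<lambda>h. ddir (\<lambda>x. B x (Y z) (Z x)) z h + B z (Y' h) (Z z))) (at z)"
    by (rule has_derivative_linear_family[OF S z, of "\<lambda>x v. B x v (Z x)"])
      (use bil Y differentiableI[OF 1] in \<open>auto simp: bilinear_def\<close>)
  then show ?thesis
    by (simp add: ddir_eq[OF 1] add_ac)
qed

section \<open>The Levi-Civita connection of a chart without indices\<close>

text \<open>The index lowering map, its inverse, and the vector \<open>\<Gamma>(u,v)\<close> with components
  \<open>\<Gamma>\<^sup>k\<^sub>i\<^sub>h u\<^sup>i v\<^sup>h\<close>.\<close>

definition flat :: "('i, real^'n::finite) bil_field \<Rightarrow> 'i \<Rightarrow> real^'n \<Rightarrow> real^'n \<Rightarrow> real^'n" where
  "flat g \<alpha> q u = (\<chi> j. g \<alpha> q u (axis j 1))"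

definition sharp :: "('i, real^'n::finite) bil_field \<Rightarrow> 'i \<Rightarrow> real^'n \<Rightarrow> real^'n \<Rightarrow> real^'n" where
  "sharp g \<alpha> q w = (\<chi> i. \<Sum>j\<in>UNIV. g_up g \<alpha> q i j * w $ j)"

definition Gamma_vec :: "('i, real^'n::finite) bil_field \<Rightarrow> 'i \<Rightarrow> real^'n \<Rightarrow> real^'n \<Rightarrow> real^'n \<Rightarrow> real^'n" where
  "Gamma_vec g \<alpha> q u v = (\<chi> k. \<Sum>i\<in>UNIV. \<Sum>h\<in>UNIV. christoffel g \<alpha> q k i h * u $ i * v $ h)"

lemma sharp_eq_matrix: "sharp g \<alpha> q w = matrix_inv (\<chi> k l. g_low g \<alpha> q k l) *v w"
  by (simp add: sharp_def g_up_def matrix_vector_mult_def)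

lemma linear_sharp: "linear (sharp g \<alpha> q)"
  unfolding sharp_eq_matrix by (rule matrix_vector_mul_linear)

lemma bilinear_Gamma_vec: "bilinear (Gamma_vec g \<alpha> q)"
  unfolding bilinear_def
  by (auto intro!: linearI simp: Gamma_vec_def vec_eq_iff algebra_simps sum.distrib sum_distrib_left)

lemma Gamma_vec_linear: "linear (Gamma_vec g \<alpha> q u)" "linear (\<lambda>u. Gamma_vec g \<alpha> q u v)"
  using bilinear_Gamma_vec[of g \<alpha> q] by (simp_all add: bilinear_def)

lemma linear_expansion:
  fixes f :: "real^'n \<Rightarrow> 'a::real_vector"
  assumes "linear f"
  shows "f v = (\<Sum>i\<in>UNIV. v $ i *\<^sub>R f (axis i 1))"
proof -
  have "f v = f (\<Sum>i\<in>UNIV. v $ i *\<^sub>R axis i 1)"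
    using basis_expansion[of v] by (simp add: scalar_mult_eq_scaleR)
  then show ?thesis using assms by (simp add: linear_sum linear_scale)
qed

lemma bilinear_expansion:
  fixes f :: "real^'n \<Rightarrow> real^'n \<Rightarrow> 'a::real_vector"
  assumes "bilinear f"
  shows "f u v = (\<Sum>i\<in>UNIV. \<Sum>j\<in>UNIV. (u $ i * v $ j) *\<^sub>R f (axis i 1) (axis j 1))"
proof -
  have l: "linear (\<lambda>u. f u v)" "linear (f u)" for u v using assms by (auto simp: bilinear_def)
  have "f u v = (\<Sum>i\<in>UNIV. u $ i *\<^sub>R f (axis i 1) v)" by (rule linear_expansion[OF l(1)])
  also have "\<dots> = (\<Sum>i\<in>UNIV. u $ i *\<^sub>R (\<Sum>j\<in>UNIV. v $ j *\<^sub>R f (axis i 1) (axis j 1)))"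
    using linear_expansion[OF l(2)] by metis
  finally show ?thesis by (simp add: scaleR_right.sum)
qed

lemma matrix_inv_right:
  fixes A :: "'a::semiring_1^'n^'m"
  assumes "invertible A"
  shows "A ** matrix_inv A = mat 1"
  using someI_ex[of "\<lambda>B. A ** B = mat 1 \<and> B ** A = mat 1"] assms
  unfolding matrix_inv_def invertible_def by blast

lemma inner_axis_1: "(v :: real^'n) \<bullet> axis i 1 = v $ i" "axis i 1 \<bullet> v = v $ i"
  by (simp_all add: inner_axis inner_commute)

text \<open>The part of the data of a Riemannian manifold that is visible in a single chart with range
  \<open>U\<close>.\<close>

locale metric_chart =
  fixes g :: "('i, real^'n::finite) bil_field" and \<alpha> :: 'i and U :: "(real^'n) set"
  assumes open_U: "open U"
    and smooth_g: "\<And>u v. smooth_on U (\<lambda>q. g \<alpha> q u v)"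
    and bilinear_g: "\<And>q. q \<in> U \<Longrightarrow> bilinear (g \<alpha> q)"
    and g_sym: "\<And>q u v. q \<in> U \<Longrightarrow> g \<alpha> q u v = g \<alpha> q v u"
    and g_pos: "\<And>q u. q \<in> U \<Longrightarrow> u \<noteq> 0 \<Longrightarrow> 0 < g \<alpha> q u u"
begin

lemma g_linear: "q \<in> U \<Longrightarrow> linear (g \<alpha> q u)" "q \<in> U \<Longrightarrow> linear (\<lambda>u. g \<alpha> q u v)"
  using bilinear_g by (auto simp: bilinear_def)

lemma g_add: "q \<in> U \<Longrightarrow> g \<alpha> q (u + u') v = g \<alpha> q u v + g \<alpha> q u' v"
  "q \<in> U \<Longrightarrow> g \<alpha> q u (v + v') = g \<alpha> q u v + g \<alpha> q u v'"
  using linear_add[OF g_linear(1)] linear_add[OF g_linear(2)] by simp_all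

lemma g_diff: "q \<in> U \<Longrightarrow> g \<alpha> q (u - u') v = g \<alpha> q u v - g \<alpha> q u' v"
  "q \<in> U \<Longrightarrow> g \<alpha> q u (v - v') = g \<alpha> q u v - g \<alpha> q u v'"
  using linear_diff[OF g_linear(1)] linear_diff[OF g_linear(2)] by simp_all

lemma g_scale: "q \<in> U \<Longrightarrow> g \<alpha> q (r *\<^sub>R u) v = r * g \<alpha> q u v"
  "q \<in> U \<Longrightarrow> g \<alpha> q u (r *\<^sub>R v) = r * g \<alpha> q u v"
  using linear_scale[OF g_linear(1)] linear_scale[OF g_linear(2)] by simp_all

lemma g_zero: "q \<in> U \<Longrightarrow> g \<alpha> q 0 v = 0" "q \<in> U \<Longrightarrow> g \<alpha> q u 0 = 0"
  using linear_0[OF g_linear(1)] linear_0[OF g_linear(2)] by simp_all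

lemma flat_inner: "q \<in> U \<Longrightarrow> flat g \<alpha> q u \<bullet> v = g \<alpha> q u v"
  using linear_expansion[OF g_linear(1), of q u v] by (simp add: flat_def inner_vec_def mult.commute)

lemma linear_flat: "q \<in> U \<Longrightarrow> linear (flat g \<alpha> q)"
  by (rule linearI) (simp_all add: flat_def vec_eq_iff g_add g_scale)

lemma g_ext: "q \<in> U \<Longrightarrow> (\<And>e. g \<alpha> q u e = g \<alpha> q v e) \<Longrightarrow> u = v"
  using g_pos[of q "u - v"] by (force simp: g_diff)

lemma flat_eq_matrix: "q \<in> U \<Longrightarrow> (\<chi> k l. g_low g \<alpha> q k l) *v u = flat g \<alpha> q u"
  by (simp add: vec_eq_iff matrix_vector_mult_def flat_def g_low_def linear_expansion[OF g_linear(2), of q u] mult.commute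
      g_sym[of q "axis i 1" "axis j 1" for i j])

lemma invertible_metric_matrix:
  assumes q: "q \<in> U"
  shows "invertible (\<chi> k l. g_low g \<alpha> q k l)"
proof -
  have "u = 0" if "(\<chi> k l. g_low g \<alpha> q k l) *v u = 0" for u
  proof -
    have "flat g \<alpha> q u \<bullet> u = 0" using that q by (simp add: flat_eq_matrix)
    then show ?thesis using g_pos[OF q, of u] by (auto simp: flat_inner[OF q])
  qed
  then have "\<exists>B. B ** (\<chi> k l. g_low g \<alpha> q k l) = mat 1"
    using matrix_left_invertible_ker by blast
  then show ?thesis using invertible_left_inverse by blast
qed

lemma flat_sharp: "q \<in> U \<Longrightarrow> flat g \<alpha> q (sharp g \<alpha> q w) = w"
  using matrix_inv_right[OF invertible_metric_matrix]
  by (simp add: sharp_eq_matrix flat_eq_matrix[symmetric] matrix_vector_mul_assoc)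

lemma g_sharp: "q \<in> U \<Longrightarrow> g \<alpha> q (sharp g \<alpha> q w) v = w \<bullet> v" "q \<in> U \<Longrightarrow> g \<alpha> q v (sharp g \<alpha> q w) = w \<bullet> v"
  using flat_inner[of q "sharp g \<alpha> q w" v] g_sym[of q] by (simp_all add: flat_sharp)

lemma sharp_flat: "q \<in> U \<Longrightarrow> sharp g \<alpha> q (flat g \<alpha> q u) = u"
  by (rule g_ext[of q]) (simp_all add: g_sharp flat_inner)

lemma sharp_inner_sym: "q \<in> U \<Longrightarrow> w \<bullet> sharp g \<alpha> q w' = w' \<bullet> sharp g \<alpha> q w"
  using g_sharp(1)[of q w "sharp g \<alpha> q w'"] g_sharp(2)[of q "sharp g \<alpha> q w" w'] by simp

lemma sharp_inner_pos:
  assumes q: "q \<in> U" and "w \<noteq> 0"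
  shows "0 < w \<bullet> sharp g \<alpha> q w"
proof -
  have "sharp g \<alpha> q w \<noteq> 0"
    using flat_sharp[OF q, of w] linear_0[OF linear_flat[OF q]] assms(2) by auto
  then show ?thesis using g_pos[OF q] g_sharp[OF q] by metis
qed

text \<open>Cramer's rule writes the inverse metric as a quotient of polynomials in the components of
  the metric.\<close>

lemma smooth_g_up: "smooth_on U (\<lambda>q. g_up g \<alpha> q i j)"
proof -
  define M where "M q = (\<chi> k l. g_low g \<alpha> q k l)" for q
  have det_smooth: "smooth_on U (\<lambda>q. det (A q))" if "\<And>k l. smooth_on U (\<lambda>q. A q $ k $ l)" for A :: "_ \<Rightarrow> real^'n^'n"
    unfolding det_def by (intro smooth_intros open_U that)
  have M: "smooth_on U (\<lambda>q. M q $ k $ l)" for k l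
    by (simp add: M_def g_low_def smooth_g)
  have det: "det (M q) \<noteq> 0" if "q \<in> U" for q
    using invertible_metric_matrix[OF that] by (simp add: M_def invertible_det_nz)
  have "det (\<chi> k l. if l = i then axis j 1 $ k else M q $ k $ l) / det (M q) = g_up g \<alpha> q i j"
    if q: "q \<in> U" for q
  proof -
    have "M q *v (matrix_inv (M q) *v axis j 1) = axis j 1"
      using matrix_inv_right[OF invertible_metric_matrix[OF q]]
      by (simp add: M_def matrix_vector_mul_assoc)
    then have "matrix_inv (M q) *v axis j 1 = (\<chi> i. det (\<chi> k l. if l = i then axis j 1 $ k else M q $ k $ l) / det (M q))"
      by (simp add: cramer[OF det[OF q]])
    then have "(matrix_inv (M q) *v axis j 1) $ i = det (\<chi> k l. if l = i then axis j 1 $ k else M q $ k $ l) / det (M q)"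
      by simp
    then show ?thesis
      by (simp add: g_up_def M_def matrix_vector_mult_def axis_def if_distrib cong: if_cong)
  qed
  moreover have "smooth_on U (\<lambda>q. det (\<chi> k l. if l = i then axis j 1 $ k else M q $ k $ l) / det (M q))"
  proof (rule smooth_on_divide[OF open_U det_smooth det_smooth[OF M] det]; assumption?)
    show "smooth_on U (\<lambda>q. (\<chi> k l. if l = i then axis j 1 $ k else M q $ k $ l) $ k $ l)" for k l
      by (cases "l = i") (simp_all add: M smooth_on_const[OF open_U])
  qed
  ultimately show ?thesis by (rule smooth_on_cong[OF open_U])
qed

abbreviation dg where "dg q x u v \<equiv> ddir (\<lambda>q. g \<alpha> q u v) q x"

lemma has_derivative_g: "q \<in> U \<Longrightarrow> ((\<lambda>q. g \<alpha> q u v) has_derivative (\<lambda>x. dg q x u v)) (at q)"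
  using smooth_on_has_derivative[OF smooth_g] by simp

lemma dg_sym: "q \<in> U \<Longrightarrow> dg q x u v = dg q x v u"
  by (rule ddir_cong[OF open_U]) (auto intro: g_sym)

lemma dg_linear:
  assumes "q \<in> U"
  shows "linear (\<lambda>x. dg q x u v)" "linear (\<lambda>u. dg q x u v)" "linear (\<lambda>v. dg q x u v)"
  using has_derivative_linear[OF has_derivative_g[OF assms]]
    linear_ddir_family[OF open_U assms, of "\<lambda>q u. g \<alpha> q u v" x]
    linear_ddir_family[OF open_U assms, of "\<lambda>q v. g \<alpha> q u v" x]
    smooth_on_differentiable[OF smooth_g assms] g_linear
  by blast+

lemma bilinear_koszul:
  assumes q: "q \<in> U"
  shows "bilinear (\<lambda>u v. dg q u v e + dg q v u e - dg q e u v)" "linear (\<lambda>e. dg q u v e + dg q v u e - dg q e u v)"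
  unfolding bilinear_def
  by (intro conjI allI linear_compose_add linear_compose_sub dg_linear q)+

lemma Gamma_vec_eq_koszul:
  assumes q: "q \<in> U"
  shows "Gamma_vec g \<alpha> q u v = (1/2) *\<^sub>R sharp g \<alpha> q (\<chi> l. dg q u v (axis l 1) + dg q v u (axis l 1) - dg q (axis l 1) u v)"
proof -
  define K where "K u v l = dg q u v (axis l 1) + dg q v u (axis l 1) - dg q (axis l 1) u v" for u v l
  have K: "K u v l = (\<Sum>i\<in>UNIV. \<Sum>h\<in>UNIV. u $ i * v $ h * K (axis i 1) (axis h 1) l)" for u v l
    using bilinear_expansion[OF bilinear_koszul(1)[OF q, of "axis l 1"], where u = u and v = v] by (simp add: K_def)
  have chr: "christoffel g \<alpha> q k i h = (1/2) * (\<Sum>l\<in>UNIV. g_up g \<alpha> q k l * K (axis i 1) (axis h 1) l)" for k i h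
    unfolding christoffel_def partial_deriv_def g_low_def K_def by (simp add: dg_sym[OF q])
  have "Gamma_vec g \<alpha> q u v $ k = (1/2) * (\<Sum>i\<in>UNIV. \<Sum>h\<in>UNIV. \<Sum>l\<in>UNIV. g_up g \<alpha> q k l * (u $ i * v $ h * K (axis i 1) (axis h 1) l))" for k
    by (simp add: Gamma_vec_def chr sum_distrib_left sum_distrib_right mult_ac)
  also have "\<dots> k = (1/2) * (\<Sum>i\<in>UNIV. \<Sum>l\<in>UNIV. \<Sum>h\<in>UNIV. g_up g \<alpha> q k l * (u $ i * v $ h * K (axis i 1) (axis h 1) l))" for k
    by (intro arg_cong[of _ _ "(*) (1/2)"] sum.cong refl sum.swap)
  also have "\<dots> k = (1/2) * (\<Sum>l\<in>UNIV. \<Sum>i\<in>UNIV. \<Sum>h\<in>UNIV. g_up g \<alpha> q k l * (u $ i * v $ h * K (axis i 1) (axis h 1) l))" for k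
    by (intro arg_cong[of _ _ "(*) (1/2)"] sum.swap)
  also have "\<dots> k = (1/2) * (\<Sum>l\<in>UNIV. g_up g \<alpha> q k l * K u v l)" for k
    by (simp add: K[of u v] sum_distrib_left)
  finally show ?thesis by (simp add: vec_eq_iff sharp_def K_def)
qed

text \<open>Together with \<open>g_ext\<close> this characterises the connection without reference to the inverse
  metric: symmetry, compatibility with the metric and the transformation law follow from it.\<close>

lemma koszul:
  assumes q: "q \<in> U"
  shows "2 * g \<alpha> q (Gamma_vec g \<alpha> q u v) e = dg q u v e + dg q v u e - dg q e u v"
  using linear_expansion[OF bilinear_koszul(2)[OF q, where u = u and v = v], where v = e]
  by (simp add: Gamma_vec_eq_koszul[OF q] g_scale[OF q] g_sharp[OF q] inner_vec_def mult.commute)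

lemma Gamma_vec_sym: "q \<in> U \<Longrightarrow> Gamma_vec g \<alpha> q u v = Gamma_vec g \<alpha> q v u"
proof (rule g_ext)
  fix e assume q: "q \<in> U"
  show "g \<alpha> q (Gamma_vec g \<alpha> q u v) e = g \<alpha> q (Gamma_vec g \<alpha> q v u) e"
    using koszul[OF q, of u v e] koszul[OF q, of v u e] dg_sym[OF q, where x = e and u = u and v = v] by linarith
qed

lemma metric_compatible:
  "q \<in> U \<Longrightarrow> dg q x u v = g \<alpha> q (Gamma_vec g \<alpha> q x u) v + g \<alpha> q u (Gamma_vec g \<alpha> q x v)"
  using koszul[of q x u v] koszul[of q x v u] g_sym[of q u "Gamma_vec g \<alpha> q x v"]
    dg_sym[of q, where x = x and u = u and v = v] by linarith

lemma smooth_christoffel: "smooth_on U (\<lambda>q. christoffel g \<alpha> q k i h)"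
  unfolding christoffel_def partial_deriv_def g_low_def
  by (intro smooth_intros smooth_g_up smooth_on_frechet_derivative smooth_g open_U)

lemma smooth_Gamma_vec: "smooth_on U (\<lambda>q. Gamma_vec g \<alpha> q u v)"
  unfolding Gamma_vec_def
  by (intro smooth_on_componentwise open_U) (simp, intro smooth_intros smooth_christoffel open_U)

abbreviation dGamma_vec where "dGamma_vec q x u v \<equiv> ddir (\<lambda>q. Gamma_vec g \<alpha> q u v) q x"

lemma has_derivative_Gamma_vec: "q \<in> U \<Longrightarrow> ((\<lambda>q. Gamma_vec g \<alpha> q u v) has_derivative (\<lambda>x. dGamma_vec q x u v)) (at q)"
  using smooth_on_has_derivative[OF smooth_Gamma_vec] by simp

lemma dGamma_vec_linear:
  assumes "q \<in> U"
  shows "linear (\<lambda>x. dGamma_vec q x u v)" "linear (\<lambda>u. dGamma_vec q x u v)" "linear (\<lambda>v. dGamma_vec q x u v)"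
proof -
  show "linear (\<lambda>x. dGamma_vec q x u v)"
    by (rule has_derivative_linear[OF has_derivative_Gamma_vec[OF assms]])
  show "linear (\<lambda>u. dGamma_vec q x u v)"
    by (rule linear_ddir_family[OF open_U assms Gamma_vec_linear(2) smooth_on_differentiable[OF smooth_Gamma_vec assms]])
  show "linear (\<lambda>v. dGamma_vec q x u v)"
    by (rule linear_ddir_family[OF open_U assms Gamma_vec_linear(1) smooth_on_differentiable[OF smooth_Gamma_vec assms]])
qed

lemma dGamma_vec_sym: "q \<in> U \<Longrightarrow> dGamma_vec q x u v = dGamma_vec q x v u"
  by (rule ddir_cong[OF open_U]) (auto intro: Gamma_vec_sym)

section \<open>Curvature\<close>

text \<open>Both sides are linear in \<open>u\<close>, \<open>v\<close> and \<open>w\<close>, and on coordinate vectors the right-hand side is the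
  defining expression of the components of the curvature tensor.\<close>

lemma curvature_eq:
  assumes q: "q \<in> U"
  shows "curvature g \<alpha> q u v w = dGamma_vec q u v w - dGamma_vec q v u w
    + Gamma_vec g \<alpha> q u (Gamma_vec g \<alpha> q v w) - Gamma_vec g \<alpha> q v (Gamma_vec g \<alpha> q u w)"
proof -
  define R where "R w u v = dGamma_vec q u v w - dGamma_vec q v u w
    + Gamma_vec g \<alpha> q u (Gamma_vec g \<alpha> q v w) - Gamma_vec g \<alpha> q v (Gamma_vec g \<alpha> q u w)" for u v w
  have lin: "linear (\<lambda>w. R w u v)" for u v
    unfolding R_def
    by (intro linear_compose_add linear_compose_sub dGamma_vec_linear q linear_compose[unfolded o_def, OF Gamma_vec_linear(1)] Gamma_vec_linear)
  have bil: "bilinear (R w)" for w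
    unfolding R_def bilinear_def
    by (intro conjI allI linear_compose_add linear_compose_sub dGamma_vec_linear q linear_compose[unfolded o_def, OF _ Gamma_vec_linear(1)]
      Gamma_vec_linear)
  have Gamma_vec_axis: "Gamma_vec g \<alpha> q (axis i 1) (axis j 1) $ k = christoffel g \<alpha> q k i j" for q i j k
    by (simp add: Gamma_vec_def axis_def mult_delta_left mult_delta_right)
  have dGamma_vec_axis: "dGamma_vec q x (axis i 1) (axis j 1) $ k = ddir (\<lambda>q. christoffel g \<alpha> q k i j) q x" for i j k x
  proof -
    have "((\<lambda>q. Gamma_vec g \<alpha> q (axis i 1) (axis j 1) $ k) has_derivative (\<lambda>x. dGamma_vec q x (axis i 1) (axis j 1) $ k)) (at q)"
      using bounded_linear.has_derivative[OF bounded_linear_vec_nth has_derivative_Gamma_vec[OF q]] .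
    from ddir_eq[OF this, of x] show ?thesis by (simp add: Gamma_vec_axis)
  qed
  have GG: "Gamma_vec g \<alpha> q (axis i 1) (Gamma_vec g \<alpha> q (axis j 1) (axis k 1)) $ h =
      (\<Sum>l\<in>UNIV. christoffel g \<alpha> q h i l * christoffel g \<alpha> q l j k)" for i j k h
    using arg_cong[OF linear_expansion[OF Gamma_vec_linear(1)[of g \<alpha> q "axis i 1"], where v = "Gamma_vec g \<alpha> q (axis j 1) (axis k 1)"], of "\<lambda>x. x $ h"]
    by (simp add: Gamma_vec_axis mult.commute)
  have "riemann g \<alpha> q h k i j = R (axis k 1) (axis i 1) (axis j 1) $ h" for h k i j
    by (simp add: riemann_def R_def GG dGamma_vec_axis partial_deriv_def sum_subtractf)
  moreover have "R w u v = (\<Sum>k\<in>UNIV. \<Sum>i\<in>UNIV. \<Sum>j\<in>UNIV. (w $ k * (u $ i * v $ j)) *\<^sub>R R (axis k 1) (axis i 1) (axis j 1))"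
    unfolding linear_expansion[OF lin, of w u v]
    by (simp add: bilinear_expansion[OF bil, where u = u and v = v] scaleR_right.sum)
  ultimately show ?thesis
    by (simp add: vec_eq_iff curvature_def R_def[symmetric] mult_ac)
qed

lemma curvature_antisym: "q \<in> U \<Longrightarrow> curvature g \<alpha> q v u w = - curvature g \<alpha> q u v w"
  by (simp add: curvature_eq)

lemma curvature_linear:
  assumes q: "q \<in> U"
  shows "linear (\<lambda>u. curvature g \<alpha> q u v w)" "linear (\<lambda>w. curvature g \<alpha> q u v w)"
  unfolding curvature_eq[OF q]
  by (intro linear_compose_add linear_compose_sub dGamma_vec_linear q linear_compose[unfolded o_def, OF _ Gamma_vec_linear(1)]
      Gamma_vec_linear)+

lemma bianchi: "q \<in> U \<Longrightarrow> curvature g \<alpha> q u v w + curvature g \<alpha> q v w u + curvature g \<alpha> q w u v = 0"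
  by (simp add: curvature_eq dGamma_vec_sym[of q u v w] dGamma_vec_sym[of q v w u] dGamma_vec_sym[of q w u v]
      Gamma_vec_sym[of q u v] Gamma_vec_sym[of q v w] Gamma_vec_sym[of q w u])

text \<open>For a constant coordinate vector \<open>w\<close> the derivatives of the function \<open>g(w,w)\<close> in the directions
  \<open>u\<close> and \<open>v\<close> commute; expressed by means of the connection, the difference of the two second
  derivatives is \<open>2 g(R(u,v)w,w)\<close>.\<close>

lemma curvature_skew:
  assumes q: "q \<in> U"
  shows "g \<alpha> q (curvature g \<alpha> q u v w) w = 0"
proof -
  have second: "ddir (\<lambda>q. dg q v w w) q u =
      2 * (g \<alpha> q (Gamma_vec g \<alpha> q u (Gamma_vec g \<alpha> q v w)) w + g \<alpha> q (Gamma_vec g \<alpha> q v w) (Gamma_vec g \<alpha> q u w) + g \<alpha> q (dGamma_vec q u v w) w)" for u v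
  proof -
    have "((\<lambda>q. g \<alpha> q (Gamma_vec g \<alpha> q v w) w) has_derivative
        (\<lambda>h. dg q h (Gamma_vec g \<alpha> q v w) w + g \<alpha> q (dGamma_vec q h v w) w + g \<alpha> q (Gamma_vec g \<alpha> q v w) 0)) (at q)"
      by (rule has_derivative_bilinear_family[OF open_U q bilinear_g _ has_derivative_Gamma_vec[OF q] has_derivative_const])
        (auto intro: smooth_on_differentiable[OF smooth_g])
    from has_derivative_mult_right[OF this, of 2]
    have "((\<lambda>q. dg q v w w) has_derivative
        (\<lambda>h. 2 * (dg q h (Gamma_vec g \<alpha> q v w) w + g \<alpha> q (dGamma_vec q h v w) w + g \<alpha> q (Gamma_vec g \<alpha> q v w) 0))) (at q)"
      by (rule has_derivative_transform_within_open[OF _ open_U q])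
        (simp add: metric_compatible g_sym[of _ w])
    then show ?thesis
      by (subst ddir_eq, assumption) (simp add: g_zero[OF q] metric_compatible[OF q])
  qed
  have "ddir (\<lambda>q. dg q v w w) q u = ddir (\<lambda>q. dg q u w w) q v"
    by (rule ddir_symmetric[OF open_U smooth_g q])
  then show ?thesis
    using g_sym[OF q, of "Gamma_vec g \<alpha> q v w" "Gamma_vec g \<alpha> q u w"]
    by (simp add: second curvature_eq[OF q] g_add[OF q] g_diff[OF q])
qed

end

text \<open>An algebraic curvature tensor all of whose sectional curvatures vanish is zero: polarising
  \<open>F(u,v,v,u) = 0\<close> makes \<open>F\<close> totally antisymmetric, and then the Bianchi identity reads \<open>3F = 0\<close>.\<close>

lemma curvature_like_tensor_zero:
  fixes F :: "'a::real_vector \<Rightarrow> 'a \<Rightarrow> 'a \<Rightarrow> 'a \<Rightarrow> real"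
  assumes anti12: "\<And>a b c d. F b a c d = - F a b c d" and anti34: "\<And>a b c d. F a b d c = - F a b c d"
    and bianchi: "\<And>a b c d. F a b c d + F b c a d + F c a b d = 0"
    and add1: "\<And>a a' b c d. F (a + a') b c d = F a b c d + F a' b c d"
    and add4: "\<And>a b c d d'. F a b c (d + d') = F a b c d + F a b c d'"
    and sec: "\<And>a b. F a b b a = 0"
  shows "F a b c d = 0"
proof -
  have pair: "F a b c d = F c d a b" for a b c d
    using bianchi[of a b c d] bianchi[of b c d a] bianchi[of c d a b] bianchi[of d a b c]
      anti34[of a b c d] anti34[of b c a d] anti34[of c d a b] anti34[of b d a c]
      anti34[of a c b d] anti34[of d a b c] anti12[of b d c a] anti12[of a c b d]
    by linarith
  have add2: "F a (b + b') c d = F a b c d + F a b' c d" for a b b' c d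
    using anti12[of "b + b'" a c d] anti12[of b a c d] anti12[of b' a c d] add1[of b b' a c d] by simp
  have add3: "F a b (c + c') d = F a b c d + F a b c' d" for a b c c' d
    using anti34[of a b d "c + c'"] anti34[of a b d c] anti34[of a b d c'] add4[of a b d c c'] by simp
  have diag14: "F a b c a = 0" for a b c
  proof -
    have "F a b c a + F a c b a = 0"
      using sec[of a "b + c"] sec[of a b] sec[of a c] by (simp add: add2 add3)
    moreover have "F a c b a = F a b c a"
      using pair[of a c b a] anti12[of b a a c] anti34[of a b c a] by simp
    ultimately show ?thesis by simp
  qed
  have anti14: "F d b c a = - F a b c d" for a b c d
    using diag14[of "a + d" b c] diag14[of a b c] diag14[of d b c] by (simp add: add1 add4)
  have anti13: "F c b a d = - F a b c d" for a b c d
    using anti34[of a b d c] anti14[of c b d a] anti34[of c b d a] by simp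
  have anti23: "F a c b d = - F a b c d" for a b c d
    using anti12[of b a c d] anti13[of c a b d] anti12[of c a b d] by simp
  have "F b c a d = F a b c d" "F c a b d = F a b c d"
    using anti13[of b c a d] anti23[of a c b d] anti12[of c a b d] by simp_all
  then show ?thesis using bianchi[of a b c d] by simp
qed

text \<open>The difference of the two sides is a curvature-like tensor. Its sectional values vanish by
  assumption on linearly independent vectors, and by antisymmetry on dependent ones.\<close>

lemma (in metric_chart) constant_curvature_tensor:
  assumes q: "q \<in> U"
    and sec: "\<And>u v. u \<noteq> v \<Longrightarrow> independent {u, v} \<Longrightarrow> sectional_curvature g \<alpha> q u v = c"
  shows "curvature g \<alpha> q u v w = c *\<^sub>R (g \<alpha> q v w *\<^sub>R u - g \<alpha> q u w *\<^sub>R v)"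
proof (rule g_ext[OF q])
  fix e
  define F where "F u v w x = g \<alpha> q (curvature g \<alpha> q u v w) x - c * (g \<alpha> q v w * g \<alpha> q u x - g \<alpha> q u w * g \<alpha> q v x)"
    for u v w x
  have cadd: "curvature g \<alpha> q (a + a') b d = curvature g \<alpha> q a b d + curvature g \<alpha> q a' b d"
    "curvature g \<alpha> q b d (a + a') = curvature g \<alpha> q b d a + curvature g \<alpha> q b d a'"
    for a a' b d
    using linear_add[OF curvature_linear(1)[OF q]] linear_add[OF curvature_linear(2)[OF q]] by simp_all
  have cscale: "curvature g \<alpha> q (r *\<^sub>R a) b d = r *\<^sub>R curvature g \<alpha> q a b d" for r a b d
    using linear_scale[OF curvature_linear(1)[OF q]] by simp
  have skew: "g \<alpha> q (curvature g \<alpha> q u v w) x = - g \<alpha> q (curvature g \<alpha> q u v x) w" for u v w x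
    using curvature_skew[OF q, of u v "w + x"]
    by (simp add: cadd g_add[OF q] curvature_skew[OF q])
  have cself: "curvature g \<alpha> q a a b = 0" for a b
    by (simp add: curvature_eq[OF q])
  have F12: "F b a c d = - F a b c d" for a b c d
  proof -
    have "g \<alpha> q (curvature g \<alpha> q b a c) d = - g \<alpha> q (curvature g \<alpha> q a b c) d"
      unfolding curvature_antisym[OF q, where u = a and v = b and w = c]
      using linear_neg[OF g_linear(2)[OF q]] by simp
    then show ?thesis by (simp add: F_def algebra_simps)
  qed
  have Fsec: "F u v v u = 0" for u v
  proof (cases "u \<noteq> v \<and> independent {u, v}")
    case True
    \<comment> \<open>the squared area of the parallelogram is nonzero: project \<open>u\<close> off \<open>v\<close>\<close>
    define A where "A = g \<alpha> q u u * g \<alpha> q v v - (g \<alpha> q u v)\<^sup>2"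
    have "u \<notin> span {v}" and v: "v \<noteq> 0"
      using True dependent_zero[of "{v}"] by (auto simp: independent_insert)
    then have uv: "u \<noteq> r *\<^sub>R v" for r
      by (auto simp: span_singleton)
    have "0 < g \<alpha> q (u - (g \<alpha> q u v / g \<alpha> q v v) *\<^sub>R v) (u - (g \<alpha> q u v / g \<alpha> q v v) *\<^sub>R v)"
      using uv by (intro g_pos[OF q]) auto
    also have "\<dots> = A / g \<alpha> q v v"
      using g_pos[OF q v] by (simp add: g_diff[OF q] g_scale[OF q] A_def g_sym[OF q, of v u] field_simps power2_eq_square)
    finally have "A \<noteq> 0" by auto
    moreover have "g \<alpha> q (curvature g \<alpha> q u v v) u / A = c"
      using sec[of u v] True by (simp add: sectional_curvature_def A_def)
    ultimately have "g \<alpha> q (curvature g \<alpha> q u v v) u = c * A" by (simp add: field_simps)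
    then show ?thesis by (simp add: F_def A_def g_sym[OF q, of v u] power2_eq_square algebra_simps)
  next
    case False
    then consider "u = 0" | r where "v = r *\<^sub>R u"
    proof -
      have "u = v \<or> v = 0 \<or> u \<in> span {v}"
        using False by (auto simp: independent_insert dependent_single split: if_splits)
      then consider "u = v" | "v = 0" | r where "u = r *\<^sub>R v"
        by (auto simp: span_singleton)
      then show thesis
      proof cases
        case 1
        then show thesis using that(2)[of 1] by simp
      next
        case 2
        then show thesis using that(2)[of 0] by simp
      next
        case 3
        then show thesis using that(1) that(2)[of "inverse r"] by (cases "r = 0") simp_all
      qed
    qed
    then show ?thesis
    proof cases
      case 1
      then show ?thesis using g_zero[OF q] linear_0[OF curvature_linear(1)[OF q]] by (simp add: F_def)
    next
      case 2
      have "curvature g \<alpha> q u (r *\<^sub>R u) w = 0" for w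
        using curvature_antisym[OF q, where u = "r *\<^sub>R u" and v = u and w = w] by (simp add: cscale cself)
      then show ?thesis
        using g_zero[OF q] by (simp add: F_def 2 g_scale[OF q])
    qed
  qed
  have Fbianchi: "F a b c d + F b c a d + F c a b d = 0" for a b c d
    using arg_cong[OF bianchi[OF q, of a b c], of "\<lambda>x. g \<alpha> q x d"]
    by (simp add: F_def g_add[OF q] g_zero[OF q] g_sym[OF q, of b a] g_sym[OF q, of c a] g_sym[OF q, of c b] algebra_simps)
  have F34: "F a b d c = - F a b c d" for a b c d
    unfolding F_def skew[of a b d c] by (simp add: algebra_simps)
  have Fadd: "F (a + a') b c d = F a b c d + F a' b c d" "F a b c (d + d') = F a b c d + F a b c d'" for a a' b c d d'
    by (simp_all add: F_def cadd g_add[OF q] algebra_simps)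
  have "F u v w e = 0"
    by (rule curvature_like_tensor_zero[of F, OF F12 F34 Fbianchi Fadd Fsec])
  then show "g \<alpha> q (curvature g \<alpha> q u v w) e = g \<alpha> q (c *\<^sub>R (g \<alpha> q v w *\<^sub>R u - g \<alpha> q u w *\<^sub>R v)) e"
    by (simp add: F_def g_scale[OF q] g_diff[OF q])
qed

section \<open>Natural structures in one chart of the cotangent bundle\<close>

text \<open>A point \<open>z\<close> of the chart of the cotangent bundle is a pair \<open>(q,p)\<close>. The covector
  \<open>Gamma_cov g \<alpha> z u\<close> is \<open>\<langle>p, \<Gamma>(u,-)\<rangle>\<close>, with components \<open>\<Gamma>\<^sup>0\<^sub>i\<^sub>h u\<^sup>i\<close>; so \<open>hor\<close> is the horizontal lift
  and \<open>vert\<close> the vertical part, with components \<open>Dp\<^sub>i\<close>.\<close>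

definition Gamma_cov :: "('i, real^'n::finite) bil_field \<Rightarrow> 'i \<Rightarrow> (real^'n) \<times> (real^'n) \<Rightarrow> real^'n \<Rightarrow> real^'n" where
  "Gamma_cov g \<alpha> z u = (\<chi> h. snd z \<bullet> Gamma_vec g \<alpha> (fst z) u (axis h 1))"

definition hor :: "('i, real^'n::finite) bil_field \<Rightarrow> 'i \<Rightarrow> (real^'n) \<times> (real^'n) \<Rightarrow> real^'n \<Rightarrow> (real^'n) \<times> (real^'n)" where
  "hor g \<alpha> z u = (u, Gamma_cov g \<alpha> z u)"

definition vert :: "('i, real^'n::finite) bil_field \<Rightarrow> 'i \<Rightarrow> (real^'n) \<times> (real^'n) \<Rightarrow> (real^'n) \<times> (real^'n) \<Rightarrow> real^'n" where
  "vert g \<alpha> z v = snd v - Gamma_cov g \<alpha> z (fst v)"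

text \<open>The maps with matrices \<open>nat_low\<close> and \<open>nat_up\<close>.\<close>

definition K_low :: "('i, real^'n::finite) bil_field \<Rightarrow> (real \<Rightarrow> real) \<Rightarrow> (real \<Rightarrow> real) \<Rightarrow>
    'i \<Rightarrow> (real^'n) \<times> (real^'n) \<Rightarrow> real^'n \<Rightarrow> real^'n" where
  "K_low g f\<^sub>1 f\<^sub>2 \<alpha> z u = f\<^sub>1 (energy g \<alpha> z) *\<^sub>R flat g \<alpha> (fst z) u
     + (f\<^sub>2 (energy g \<alpha> z) * (snd z \<bullet> u)) *\<^sub>R snd z"

definition K_up :: "('i, real^'n::finite) bil_field \<Rightarrow> (real \<Rightarrow> real) \<Rightarrow> (real \<Rightarrow> real) \<Rightarrow>
    'i \<Rightarrow> (real^'n) \<times> (real^'n) \<Rightarrow> real^'n \<Rightarrow> real^'n" where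
  "K_up g f\<^sub>1 f\<^sub>2 \<alpha> z w = f\<^sub>1 (energy g \<alpha> z) *\<^sub>R sharp g \<alpha> (fst z) w
     + (f\<^sub>2 (energy g \<alpha> z) * (sharp g \<alpha> (fst z) (snd z) \<bullet> w)) *\<^sub>R sharp g \<alpha> (fst z) (snd z)"

lemma Gamma_cov_inner: "Gamma_cov g \<alpha> z u \<bullet> e = snd z \<bullet> Gamma_vec g \<alpha> (fst z) u e" for e :: "real^'n::finite"
proof -
  have "linear (\<lambda>e. Gamma_vec g \<alpha> (fst z) u e)" by (rule Gamma_vec_linear)
  then have "linear (\<lambda>e. snd z \<bullet> Gamma_vec g \<alpha> (fst z) u e)"
    by (auto intro!: linearI simp: linear_add linear_scale inner_add_right)
  from linear_expansion[OF this, of e] show ?thesis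
    by (simp add: Gamma_cov_def inner_vec_def[of "Gamma_cov g \<alpha> z u"] inner_vec_def[of "\<chi> h. _ h"] mult.commute)
qed

lemma energy_eq: "energy g \<alpha> z = (1/2) * (snd z \<bullet> sharp g \<alpha> (fst z) (snd z))"
  by (simp add: energy_def sharp_def case_prod_beta inner_vec_def sum_distrib_left mult_ac)

lemma delta_q_eq_hor: "delta_q g \<alpha> z i = hor g \<alpha> z (axis i 1)"
  by (simp add: delta_q_def hor_def Gamma_cov_def Gamma0_def case_prod_beta inner_vec_def vec_eq_iff Gamma_vec_def axis_def
      mult_delta_left mult_delta_right)

lemma linear_Gamma_cov: "linear (Gamma_cov g \<alpha> z)"
  by (auto intro!: linearI simp: Gamma_cov_def Gamma_vec_def vec_eq_iff algebra_simps sum.distrib sum_distrib_left inner_vec_def)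

lemma linear_hor: "linear (hor g \<alpha> z)"
  by (rule linearI) (simp_all add: hor_def linear_add[OF linear_Gamma_cov] linear_scale[OF linear_Gamma_cov])

lemma linear_vert: "linear (vert g \<alpha> z)"
  by (rule linearI) (simp_all add: vert_def linear_add[OF linear_Gamma_cov] linear_scale[OF linear_Gamma_cov] algebra_simps)

lemma vert_hor [simp]: "vert g \<alpha> z (hor g \<alpha> z u) = 0"
  by (simp add: vert_def hor_def)

lemma vert_snd [simp]: "vert g \<alpha> z (0, w) = w"
  by (simp add: vert_def linear_0[OF linear_Gamma_cov])

lemma fst_hor [simp]: "fst (hor g \<alpha> z u) = u"
  by (simp add: hor_def)

lemma hor_vert_decomposition: "v = hor g \<alpha> z (fst v) + (0, vert g \<alpha> z v)"
  by (simp add: hor_def vert_def prod_eq_iff)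

lemma linear_K_up: "linear (K_up g f\<^sub>1 f\<^sub>2 \<alpha> z)"
  by (rule linearI)
    (simp_all add: K_up_def linear_add[OF linear_sharp] linear_scale[OF linear_sharp] algebra_simps inner_add_right)

context metric_chart
begin

definition punctured where "punctured = U \<times> (- {0 :: real^'n})"

lemma open_punctured: "open punctured"
  unfolding punctured_def by (intro open_Times open_U) (simp add: open_Compl)

lemma punctured_D: "z \<in> punctured \<Longrightarrow> fst z \<in> U" "z \<in> punctured \<Longrightarrow> snd z \<noteq> 0"
  by (auto simp: punctured_def)

lemma energy_pos: "z \<in> punctured \<Longrightarrow> 0 < energy g \<alpha> z"
  using sharp_inner_pos[of "fst z" "snd z"] by (simp add: energy_eq punctured_D)

lemma linear_K_low: "fst z \<in> U \<Longrightarrow> linear (K_low g f\<^sub>1 f\<^sub>2 \<alpha> z)"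
  by (auto intro!: linearI simp: K_low_def linear_add[OF linear_flat] linear_scale[OF linear_flat] algebra_simps inner_add_right)

lemma g_up_sym: "q \<in> U \<Longrightarrow> g_up g \<alpha> q i j = g_up g \<alpha> q j i"
  using sharp_inner_sym[of q "axis i 1" "axis j 1"]
  by (simp add: inner_axis_1) (simp add: sharp_def axis_def mult_delta_left mult_delta_right)

lemma g0_up_eq: "fst z \<in> U \<Longrightarrow> g0_up g \<alpha> z i = sharp g \<alpha> (fst z) (snd z) $ i"
  by (simp add: g0_up_def case_prod_beta sharp_def g_up_sym[of "fst z" i] mult.commute)

text \<open>The sum in the coframe \<open>Dp\<^sub>i\<close> runs over the second index of \<open>\<Gamma>\<^sup>0\<^sub>i\<^sub>j\<close>, that in \<open>Gamma_cov\<close> over the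
  first; the two agree by the symmetry of the connection.\<close>

lemma Dp_eq:
  assumes "fst z \<in> U"
  shows "Dp g \<alpha> z i v = vert g \<alpha> z v $ i"
proof -
  have "Gamma_cov g \<alpha> z (fst v) $ i = Gamma_cov g \<alpha> z (fst v) \<bullet> axis i 1" by (simp add: inner_axis_1)
  also have "\<dots> = Gamma_cov g \<alpha> z (axis i 1) \<bullet> fst v"
    by (simp add: Gamma_cov_inner Gamma_vec_sym[OF assms, of "fst v"])
  also have "\<dots> = (\<Sum>j\<in>UNIV. Gamma0 g \<alpha> z i j * fst v $ j)"
    using arg_cong[OF delta_q_eq_hor[of g \<alpha> z i], of snd] by (simp add: hor_def delta_q_def inner_vec_def vec_eq_iff)
  finally show ?thesis by (simp add: Dp_def vert_def dq_def)
qed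

lemma K_low_component: "fst z \<in> U \<Longrightarrow> K_low g f\<^sub>1 f\<^sub>2 \<alpha> z (axis i 1) $ j = nat_low g f\<^sub>1 f\<^sub>2 \<alpha> z i j"
  by (simp add: K_low_def nat_low_def flat_def g_low_def inner_axis_1)

lemma K_up_component: "fst z \<in> U \<Longrightarrow> K_up g f\<^sub>1 f\<^sub>2 \<alpha> z (axis i 1) $ j = nat_up g f\<^sub>1 f\<^sub>2 \<alpha> z i j"
  by (simp add: K_up_def nat_up_def g0_up_eq inner_axis_1 g_up_sym[of "fst z" i])
    (simp add: sharp_def axis_def mult_delta_left mult_delta_right)

lemma natural_J_eq:
  assumes z: "fst z \<in> U"
  shows "natural_J g a\<^sub>1 b\<^sub>1 a\<^sub>2 b\<^sub>2 \<alpha> z v =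
    (0, K_low g a\<^sub>1 b\<^sub>1 \<alpha> z (fst v)) - hor g \<alpha> z (K_up g a\<^sub>2 b\<^sub>2 \<alpha> z (vert g \<alpha> z v))"
proof -
  let ?L = "\<lambda>u. (0, K_low g a\<^sub>1 b\<^sub>1 \<alpha> z u) :: (real^'n) \<times> (real^'n)"
  let ?H = "\<lambda>w. hor g \<alpha> z (K_up g a\<^sub>2 b\<^sub>2 \<alpha> z w)"
  have L: "linear ?L"
    using linear_K_low[OF z] by (auto intro!: linearI simp: linear_add linear_scale)
  have H: "linear ?H"
    using linear_compose[OF linear_K_up linear_hor] by (simp add: o_def)
  have 1: "(\<Sum>j\<in>UNIV. nat_low g a\<^sub>1 b\<^sub>1 \<alpha> z i j *\<^sub>R partial_p j) = ?L (axis i 1)" for i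
    by (simp add: prod_eq_iff fst_sum snd_sum vec_eq_iff K_low_component[OF z])
      (simp add: partial_p_def axis_def mult_delta_left mult_delta_right)
  have 2: "(\<Sum>j\<in>UNIV. nat_up g a\<^sub>2 b\<^sub>2 \<alpha> z i j *\<^sub>R delta_q g \<alpha> z j) = ?H (axis i 1)" for i
    using linear_expansion[OF linear_hor, of g \<alpha> z "K_up g a\<^sub>2 b\<^sub>2 \<alpha> z (axis i 1)"]
    by (simp add: delta_q_eq_hor K_up_component[OF z])
  show ?thesis
    unfolding natural_J_def 1 2 dq_def Dp_eq[OF z] linear_expansion[OF L, of "fst v"] linear_expansion[OF H, of "vert g \<alpha> z v"]
    by (simp add: sum_negf)
qed

lemma fst_natural_J: "fst z \<in> U \<Longrightarrow> fst (natural_J g a\<^sub>1 b\<^sub>1 a\<^sub>2 b\<^sub>2 \<alpha> z v) = - K_up g a\<^sub>2 b\<^sub>2 \<alpha> z (vert g \<alpha> z v)"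
  by (simp add: natural_J_eq)

lemma vert_natural_J: "fst z \<in> U \<Longrightarrow> vert g \<alpha> z (natural_J g a\<^sub>1 b\<^sub>1 a\<^sub>2 b\<^sub>2 \<alpha> z v) = K_low g a\<^sub>1 b\<^sub>1 \<alpha> z (fst v)"
  by (simp add: natural_J_eq linear_diff[OF linear_vert])

lemma natural_G_eq:
  assumes z: "fst z \<in> U"
  shows "natural_G g c\<^sub>1 d\<^sub>1 c\<^sub>2 d\<^sub>2 \<alpha> z v w =
    K_low g c\<^sub>1 d\<^sub>1 \<alpha> z (fst v) \<bullet> fst w + K_up g c\<^sub>2 d\<^sub>2 \<alpha> z (vert g \<alpha> z v) \<bullet> vert g \<alpha> z w"
proof -
  have 1: "(\<Sum>i\<in>UNIV. \<Sum>j\<in>UNIV. nat_low g c\<^sub>1 d\<^sub>1 \<alpha> z i j * u $ i * u' $ j) = K_low g c\<^sub>1 d\<^sub>1 \<alpha> z u \<bullet> u'" for u u'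
    by (subst linear_expansion[OF linear_K_low[OF z], of c\<^sub>1 d\<^sub>1 u])
      (simp only: inner_sum_left inner_scaleR_left, simp add: inner_vec_def sum_distrib_left K_low_component[OF z] mult_ac)
  have 2: "(\<Sum>i\<in>UNIV. \<Sum>j\<in>UNIV. nat_up g c\<^sub>2 d\<^sub>2 \<alpha> z i j * u $ i * u' $ j) = K_up g c\<^sub>2 d\<^sub>2 \<alpha> z u \<bullet> u'" for u u'
    by (subst linear_expansion[OF linear_K_up, of g c\<^sub>2 d\<^sub>2 \<alpha> z u])
      (simp only: inner_sum_left inner_scaleR_left, simp add: inner_vec_def sum_distrib_left K_up_component[OF z] mult_ac)
  show ?thesis unfolding natural_G_def dq_def Dp_eq[OF z] 1 2 ..
qed

subsection \<open>Complex structure, isometry and positivity at a point\<close>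

lemma K_low_inner: "fst z \<in> U \<Longrightarrow> K_low g f\<^sub>1 f\<^sub>2 \<alpha> z u \<bullet> v =
    f\<^sub>1 (energy g \<alpha> z) * g \<alpha> (fst z) u v + f\<^sub>2 (energy g \<alpha> z) * (snd z \<bullet> u) * (snd z \<bullet> v)"
  by (simp add: K_low_def inner_add_left flat_inner)

lemma K_up_inner: "K_up g f\<^sub>1 f\<^sub>2 \<alpha> z w \<bullet> w' = f\<^sub>1 (energy g \<alpha> z) * (sharp g \<alpha> (fst z) w \<bullet> w')
    + f\<^sub>2 (energy g \<alpha> z) * (sharp g \<alpha> (fst z) (snd z) \<bullet> w) * (sharp g \<alpha> (fst z) (snd z) \<bullet> w')"
  by (simp add: K_up_def inner_add_left)

lemma inner_sharp_self: "snd z \<bullet> sharp g \<alpha> (fst z) (snd z) = 2 * energy g \<alpha> z"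
  by (simp add: energy_eq)

lemma inner_K_up:
  assumes "fst z \<in> U"
  shows "snd z \<bullet> K_up g f\<^sub>1 f\<^sub>2 \<alpha> z w =
    (f\<^sub>1 (energy g \<alpha> z) + 2 * energy g \<alpha> z * f\<^sub>2 (energy g \<alpha> z)) * (sharp g \<alpha> (fst z) (snd z) \<bullet> w)"
  using sharp_inner_sym[OF assms, of "snd z" w]
  by (simp add: K_up_def inner_add_right inner_sharp_self inner_commute[of _ w] algebra_simps)

lemma sharp_inner_K_low:
  assumes "fst z \<in> U"
  shows "sharp g \<alpha> (fst z) (snd z) \<bullet> K_low g f\<^sub>1 f\<^sub>2 \<alpha> z u =
    (f\<^sub>1 (energy g \<alpha> z) + 2 * energy g \<alpha> z * f\<^sub>2 (energy g \<alpha> z)) * (snd z \<bullet> u)"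
  using inner_sharp_self[of z]
  by (simp add: inner_commute[of _ "K_low g f\<^sub>1 f\<^sub>2 \<alpha> z u"] K_low_inner[OF assms] g_sharp[OF assms] algebra_simps)

text \<open>The composition of the two maps has the factor \<open>f\<^sub>1 h\<^sub>1\<close> off \<open>p\<close> and the factor
  \<open>(f\<^sub>1 + 2 t f\<^sub>2) (h\<^sub>1 + 2 t h\<^sub>2)\<close> along \<open>p\<close>. The coefficient of its rank one part is the difference
  of these two factors divided by \<open>2 t\<close>.\<close>

lemma K_low_K_up:
  assumes z: "z \<in> punctured" and t: "t = energy g \<alpha> z"
    and 1: "f\<^sub>1 t * h\<^sub>1 t = 1" and 2: "(f\<^sub>1 t + 2 * t * f\<^sub>2 t) * (h\<^sub>1 t + 2 * t * h\<^sub>2 t) = 1"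
  shows "K_low g f\<^sub>1 f\<^sub>2 \<alpha> z (K_up g h\<^sub>1 h\<^sub>2 \<alpha> z w) = w" "K_up g h\<^sub>1 h\<^sub>2 \<alpha> z (K_low g f\<^sub>1 f\<^sub>2 \<alpha> z u) = u"
proof -
  have q: "fst z \<in> U" using punctured_D(1)[OF z] .
  let ?s = "sharp g \<alpha> (fst z) (snd z)"
  have "t \<noteq> 0" using energy_pos[OF z] t by simp
  moreover have "2 * t * (f\<^sub>1 t * h\<^sub>2 t + f\<^sub>2 t * (h\<^sub>1 t + 2 * t * h\<^sub>2 t)) = 0"
    using 1 2 by (simp add: algebra_simps)
  ultimately have 3: "f\<^sub>1 t * h\<^sub>2 t + f\<^sub>2 t * (h\<^sub>1 t + 2 * t * h\<^sub>2 t) = 0" by simp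
  then have 4: "h\<^sub>1 t * f\<^sub>2 t + h\<^sub>2 t * (f\<^sub>1 t + 2 * t * f\<^sub>2 t) = 0" by (simp add: algebra_simps)
  have "K_low g f\<^sub>1 f\<^sub>2 \<alpha> z (K_up g h\<^sub>1 h\<^sub>2 \<alpha> z w) = (f\<^sub>1 t * h\<^sub>1 t) *\<^sub>R w
      + ((f\<^sub>1 t * h\<^sub>2 t + f\<^sub>2 t * (h\<^sub>1 t + 2 * t * h\<^sub>2 t)) * (?s \<bullet> w)) *\<^sub>R snd z"
    unfolding K_low_def[of g f\<^sub>1] inner_K_up[OF q]
    by (simp add: K_up_def t[symmetric] linear_add[OF linear_flat[OF q]] linear_scale[OF linear_flat[OF q]]
        flat_sharp[OF q] algebra_simps)
  then show "K_low g f\<^sub>1 f\<^sub>2 \<alpha> z (K_up g h\<^sub>1 h\<^sub>2 \<alpha> z w) = w" using 1 3 by simp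
  have "K_up g h\<^sub>1 h\<^sub>2 \<alpha> z (K_low g f\<^sub>1 f\<^sub>2 \<alpha> z u) = (h\<^sub>1 t * f\<^sub>1 t) *\<^sub>R u
      + ((h\<^sub>1 t * f\<^sub>2 t + h\<^sub>2 t * (f\<^sub>1 t + 2 * t * f\<^sub>2 t)) * (snd z \<bullet> u)) *\<^sub>R ?s"
    unfolding K_up_def[of g h\<^sub>1] sharp_inner_K_low[OF q]
    by (simp add: K_low_def t[symmetric] linear_add[OF linear_sharp] linear_scale[OF linear_sharp]
        sharp_flat[OF q] algebra_simps)
  then show "K_up g h\<^sub>1 h\<^sub>2 \<alpha> z (K_low g f\<^sub>1 f\<^sub>2 \<alpha> z u) = u" using 1 4 by (simp add: mult.commute)
qed

lemma natural_J_squared: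
  assumes z: "z \<in> punctured" and t: "t = energy g \<alpha> z"
    and 1: "a\<^sub>1 t * a\<^sub>2 t = 1" and 2: "(a\<^sub>1 t + 2 * t * b\<^sub>1 t) * (a\<^sub>2 t + 2 * t * b\<^sub>2 t) = 1"
  shows "natural_J g a\<^sub>1 b\<^sub>1 a\<^sub>2 b\<^sub>2 \<alpha> z (natural_J g a\<^sub>1 b\<^sub>1 a\<^sub>2 b\<^sub>2 \<alpha> z v) = - v"
proof -
  have q: "fst z \<in> U" using punctured_D(1)[OF z] .
  have "natural_J g a\<^sub>1 b\<^sub>1 a\<^sub>2 b\<^sub>2 \<alpha> z (natural_J g a\<^sub>1 b\<^sub>1 a\<^sub>2 b\<^sub>2 \<alpha> z v) =
      - (hor g \<alpha> z (fst v) + (0, vert g \<alpha> z v))"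
    using K_low_K_up[where f\<^sub>1 = a\<^sub>1 and f\<^sub>2 = b\<^sub>1 and h\<^sub>1 = a\<^sub>2 and h\<^sub>2 = b\<^sub>2, OF z t 1 2]
    by (simp add: natural_J_eq[OF q, of a\<^sub>1 b\<^sub>1 a\<^sub>2 b\<^sub>2 "natural_J g a\<^sub>1 b\<^sub>1 a\<^sub>2 b\<^sub>2 \<alpha> z v"] fst_natural_J[OF q]
        vert_natural_J[OF q] linear_neg[OF linear_K_low[OF q]])
  then show ?thesis using hor_vert_decomposition by metis
qed

text \<open>\<open>J\<close> exchanges the horizontal and the vertical part, so the claim says that the horizontal
  form of \<open>G\<close>, pulled back by \<open>K_up\<close>, is the vertical one. This holds as soon as the two forms have matching
  factors off \<open>p\<close> and along \<open>p\<close>.\<close>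

lemma natural_G_J:
  assumes z: "z \<in> punctured" and t: "t = energy g \<alpha> z"
    and 1: "a\<^sub>1 t * a\<^sub>2 t = 1" and 2: "(a\<^sub>1 t + 2 * t * b\<^sub>1 t) * (a\<^sub>2 t + 2 * t * b\<^sub>2 t) = 1"
    and 3: "c\<^sub>1 t * (a\<^sub>2 t)\<^sup>2 = c\<^sub>2 t"
    and 4: "(c\<^sub>1 t + 2 * t * d\<^sub>1 t) * (a\<^sub>2 t + 2 * t * b\<^sub>2 t)\<^sup>2 = c\<^sub>2 t + 2 * t * d\<^sub>2 t"
  shows "natural_G g c\<^sub>1 d\<^sub>1 c\<^sub>2 d\<^sub>2 \<alpha> z (natural_J g a\<^sub>1 b\<^sub>1 a\<^sub>2 b\<^sub>2 \<alpha> z v) (natural_J g a\<^sub>1 b\<^sub>1 a\<^sub>2 b\<^sub>2 \<alpha> z w)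
    = natural_G g c\<^sub>1 d\<^sub>1 c\<^sub>2 d\<^sub>2 \<alpha> z v w"
proof -
  have q: "fst z \<in> U" using punctured_D(1)[OF z] .
  have t0: "t \<noteq> 0" using energy_pos[OF z] t by simp
  let ?s = "sharp g \<alpha> (fst z) (snd z)"
  have low_up: "K_low g c\<^sub>1 d\<^sub>1 \<alpha> z (K_up g a\<^sub>2 b\<^sub>2 \<alpha> z x) \<bullet> K_up g a\<^sub>2 b\<^sub>2 \<alpha> z y = K_up g c\<^sub>2 d\<^sub>2 \<alpha> z x \<bullet> y" for x y
  proof -
    have gK: "g \<alpha> (fst z) (K_up g a\<^sub>2 b\<^sub>2 \<alpha> z x) (K_up g a\<^sub>2 b\<^sub>2 \<alpha> z y) =
        (a\<^sub>2 t)\<^sup>2 * (sharp g \<alpha> (fst z) x \<bullet> y) + (2 * a\<^sub>2 t * b\<^sub>2 t + 2 * t * (b\<^sub>2 t)\<^sup>2) * (?s \<bullet> x) * (?s \<bullet> y)"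
      using sharp_inner_sym[OF q, of x y] sharp_inner_sym[OF q, of x "snd z"] sharp_inner_sym[OF q, of y "snd z"]
        inner_sharp_self[of z]
      by (simp add: K_up_def t[symmetric] g_add[OF q] g_scale[OF q] g_sharp[OF q] inner_commute[of _ x]
          inner_commute[of _ y] power2_eq_square algebra_simps)
    \<comment> \<open>the coefficient of the rank one part is again a difference of factors divided by \<open>2 t\<close>\<close>
    have "2 * t * (c\<^sub>1 t * (2 * a\<^sub>2 t * b\<^sub>2 t + 2 * t * (b\<^sub>2 t)\<^sup>2) + d\<^sub>1 t * (a\<^sub>2 t + 2 * t * b\<^sub>2 t)\<^sup>2) = 2 * t * d\<^sub>2 t"
      using 3 4 by (simp add: power2_eq_square algebra_simps)
    then have d: "c\<^sub>1 t * (2 * a\<^sub>2 t * b\<^sub>2 t + 2 * t * (b\<^sub>2 t)\<^sup>2) + d\<^sub>1 t * (a\<^sub>2 t + 2 * t * b\<^sub>2 t)\<^sup>2 = d\<^sub>2 t"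
      using t0 by simp
    have "K_low g c\<^sub>1 d\<^sub>1 \<alpha> z (K_up g a\<^sub>2 b\<^sub>2 \<alpha> z x) \<bullet> K_up g a\<^sub>2 b\<^sub>2 \<alpha> z y =
        (c\<^sub>1 t * (a\<^sub>2 t)\<^sup>2) * (sharp g \<alpha> (fst z) x \<bullet> y) +
        (c\<^sub>1 t * (2 * a\<^sub>2 t * b\<^sub>2 t + 2 * t * (b\<^sub>2 t)\<^sup>2) + d\<^sub>1 t * (a\<^sub>2 t + 2 * t * b\<^sub>2 t)\<^sup>2) * (?s \<bullet> x) * (?s \<bullet> y)"
      unfolding K_low_inner[OF q] gK inner_K_up[OF q] t[symmetric] by (simp add: power2_eq_square algebra_simps)
    then show ?thesis unfolding d 3 by (simp add: K_up_inner t[symmetric])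
  qed
  have up_low: "K_up g c\<^sub>2 d\<^sub>2 \<alpha> z (K_low g a\<^sub>1 b\<^sub>1 \<alpha> z x) \<bullet> K_low g a\<^sub>1 b\<^sub>1 \<alpha> z y = K_low g c\<^sub>1 d\<^sub>1 \<alpha> z x \<bullet> y" for x y
    unfolding low_up[symmetric] K_low_K_up[where f\<^sub>1 = a\<^sub>1 and f\<^sub>2 = b\<^sub>1 and h\<^sub>1 = a\<^sub>2 and h\<^sub>2 = b\<^sub>2, OF z t 1 2] ..
  show ?thesis
    unfolding natural_G_eq[OF q] fst_natural_J[OF q] vert_natural_J[OF q] up_low
    by (simp add: linear_neg[OF linear_K_low[OF q]] low_up)
qed

lemma cauchy_schwarz:
  assumes q: "q \<in> U"
  shows "(g \<alpha> q u v)\<^sup>2 \<le> g \<alpha> q u u * g \<alpha> q v v"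
proof (cases "v = 0")
  case False
  then have v: "0 < g \<alpha> q v v" by (rule g_pos[OF q])
  let ?w = "u - (g \<alpha> q u v / g \<alpha> q v v) *\<^sub>R v"
  have "0 \<le> g \<alpha> q ?w ?w" using g_pos[OF q, of ?w] g_zero[OF q] by (cases "?w = 0") auto
  also have "\<dots> = g \<alpha> q u u - (g \<alpha> q u v)\<^sup>2 / g \<alpha> q v v"
    using v by (simp add: g_diff[OF q] g_scale[OF q] g_sym[OF q, of v u] field_simps power2_eq_square)
  finally show ?thesis using v by (simp add: field_simps)
qed (simp add: g_zero[OF q])

text \<open>The quadratic form \<open>c\<^sub>1 |u|\<^sup>2 + d\<^sub>1 \<langle>s,u\<rangle>\<^sup>2\<close> is at least
  \<open>min {c\<^sub>1, c\<^sub>1 + |s|\<^sup>2 d\<^sub>1} |u|\<^sup>2\<close>.\<close>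

lemma rank_one_perturbation_pos:
  assumes q: "q \<in> U" and "0 < c\<^sub>1" "0 < c\<^sub>1 + g \<alpha> q s s * d\<^sub>1" "u \<noteq> 0"
  shows "0 < c\<^sub>1 * g \<alpha> q u u + d\<^sub>1 * (g \<alpha> q s u)\<^sup>2"
proof (cases "0 \<le> d\<^sub>1")
  case True
  then show ?thesis using g_pos[OF q assms(4)] assms(2) by (simp add: add_pos_nonneg)
next
  case False
  then have "d\<^sub>1 * (g \<alpha> q s s * g \<alpha> q u u) \<le> d\<^sub>1 * (g \<alpha> q s u)\<^sup>2"
    using cauchy_schwarz[OF q, of s u] by (intro mult_left_mono_neg) auto
  moreover have "0 < (c\<^sub>1 + g \<alpha> q s s * d\<^sub>1) * g \<alpha> q u u"
    using assms(3) g_pos[OF q assms(4)] by simp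
  ultimately show ?thesis by (simp add: algebra_simps)
qed

lemma natural_G_pos:
  assumes z: "z \<in> punctured" and t: "t = energy g \<alpha> z"
    and "0 < c\<^sub>1 t" "0 < c\<^sub>1 t + 2 * t * d\<^sub>1 t" "0 < c\<^sub>2 t" "0 < c\<^sub>2 t + 2 * t * d\<^sub>2 t" and v: "v \<noteq> 0"
  shows "0 < natural_G g c\<^sub>1 d\<^sub>1 c\<^sub>2 d\<^sub>2 \<alpha> z v v"
proof -
  have q: "fst z \<in> U" using punctured_D(1)[OF z] .
  let ?s = "sharp g \<alpha> (fst z) (snd z)"
  have ss: "g \<alpha> (fst z) ?s ?s = 2 * t"
    using inner_sharp_self[of z] by (simp add: g_sharp[OF q] t)
  have low: "0 < K_low g c\<^sub>1 d\<^sub>1 \<alpha> z u \<bullet> u" if "u \<noteq> 0" for u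
    using rank_one_perturbation_pos[OF q assms(3) _ that, of ?s "d\<^sub>1 t", unfolded ss] assms(4)
    by (simp add: K_low_inner[OF q] ss t[symmetric] g_sharp[OF q] power2_eq_square mult_ac)
  have up: "0 < K_up g c\<^sub>2 d\<^sub>2 \<alpha> z w \<bullet> w" if "w \<noteq> 0" for w
  proof -
    have "sharp g \<alpha> (fst z) w \<noteq> 0"
      using flat_sharp[OF q, of w] that linear_0[OF linear_flat[OF q]] by auto
    from rank_one_perturbation_pos[OF q assms(5) _ this, of ?s "d\<^sub>2 t", unfolded ss] show ?thesis
      using assms(6) sharp_inner_sym[OF q, of "snd z" w] inner_commute[of "sharp g \<alpha> (fst z) w" w]
        inner_commute[of ?s w]
      by (simp add: K_up_inner t[symmetric] g_sharp[OF q] power2_eq_square mult_ac)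
  qed
  have "fst v \<noteq> 0 \<or> vert g \<alpha> z v \<noteq> 0"
    using v hor_vert_decomposition[of v g \<alpha> z] linear_0[OF linear_hor, of g \<alpha> z] by (auto simp: zero_prod_def)
  moreover have "0 \<le> K_low g c\<^sub>1 d\<^sub>1 \<alpha> z u \<bullet> u" for u using low[of u] by (cases "u = 0") auto
  moreover have "0 \<le> K_up g c\<^sub>2 d\<^sub>2 \<alpha> z u \<bullet> u" for u using up[of u] by (cases "u = 0") auto
  ultimately show ?thesis
    unfolding natural_G_eq[OF q] using low up by (meson add_nonneg_pos add_pos_nonneg)
qed

lemma natural_G_sym:
  assumes q: "fst z \<in> U"
  shows "natural_G g c\<^sub>1 d\<^sub>1 c\<^sub>2 d\<^sub>2 \<alpha> z v w = natural_G g c\<^sub>1 d\<^sub>1 c\<^sub>2 d\<^sub>2 \<alpha> z w v"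
proof -
  have "K_low g c\<^sub>1 d\<^sub>1 \<alpha> z u \<bullet> u' = K_low g c\<^sub>1 d\<^sub>1 \<alpha> z u' \<bullet> u" for u u'
    using g_sym[OF q, of u u'] by (simp add: K_low_inner[OF q] mult_ac)
  moreover have "K_up g c\<^sub>2 d\<^sub>2 \<alpha> z u \<bullet> u' = K_up g c\<^sub>2 d\<^sub>2 \<alpha> z u' \<bullet> u" for u u'
    using sharp_inner_sym[OF q, of u u'] inner_commute[of "sharp g \<alpha> (fst z) u" u']
      inner_commute[of "sharp g \<alpha> (fst z) u'" u]
    by (simp add: K_up_inner mult_ac)
  ultimately show ?thesis by (simp add: natural_G_eq[OF q])
qed

lemma linear_natural_J:
  assumes q: "fst z \<in> U"
  shows "linear (natural_J g a\<^sub>1 b\<^sub>1 a\<^sub>2 b\<^sub>2 \<alpha> z)"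
  by (rule linearI)
    (simp_all add: natural_J_eq[OF q] linear_add[OF linear_vert] linear_scale[OF linear_vert]
      linear_add[OF linear_K_up] linear_scale[OF linear_K_up] linear_add[OF linear_hor] linear_scale[OF linear_hor]
      linear_add[OF linear_K_low[OF q]] linear_scale[OF linear_K_low[OF q]] scaleR_diff_right)

lemma bilinear_natural_G:
  assumes q: "fst z \<in> U"
  shows "bilinear (natural_G g c\<^sub>1 d\<^sub>1 c\<^sub>2 d\<^sub>2 \<alpha> z)"
  unfolding bilinear_def
  by (intro conjI allI linearI)
    (simp_all add: natural_G_eq[OF q] linear_add[OF linear_vert] linear_scale[OF linear_vert]
      linear_add[OF linear_K_up] linear_scale[OF linear_K_up] linear_add[OF linear_K_low[OF q]]
      linear_scale[OF linear_K_low[OF q]] algebra_simps inner_add_left inner_add_right)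

end

section \<open>The Nijenhuis tensor\<close>

text \<open>What remains of the Nijenhuis tensor of \<open>X\<close> and \<open>Y\<close> when the derivatives of \<open>X\<close> and \<open>Y\<close> have
  cancelled; \<open>x\<close> and \<open>y\<close> are the values of the fields at \<open>z\<close>.\<close>

definition nijenhuis_form :: "('e::euclidean_space \<Rightarrow> 'e \<Rightarrow> 'e) \<Rightarrow> 'e \<Rightarrow> 'e \<Rightarrow> 'e \<Rightarrow> 'e" where
  "nijenhuis_form J z x y = ddir (\<lambda>\<zeta>. J \<zeta> y) z (J z x) - ddir (\<lambda>\<zeta>. J \<zeta> x) z (J z y)
     + J z (ddir (\<lambda>\<zeta>. J \<zeta> x) z y) - J z (ddir (\<lambda>\<zeta>. J \<zeta> y) z x)"

locale smooth_complex_family =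
  fixes J :: "'e::euclidean_space \<Rightarrow> 'e \<Rightarrow> 'e" and S :: "'e set"
  assumes open_S: "open S"
    and smooth_J: "\<And>v. smooth_on S (\<lambda>z. J z v)"
    and linear_J: "\<And>z. z \<in> S \<Longrightarrow> linear (J z)"
    and J_J: "\<And>z v. z \<in> S \<Longrightarrow> J z (J z v) = - v"
begin

lemma has_derivative_J: "z \<in> S \<Longrightarrow> (Y has_derivative Y') (at z) \<Longrightarrow>
    ((\<lambda>z. J z (Y z)) has_derivative (\<lambda>h. ddir (\<lambda>x. J x (Y z)) z h + J z (Y' h))) (at z)"
  by (rule has_derivative_linear_family[OF open_S _ linear_J])
    (auto intro: smooth_on_differentiable[OF smooth_J])

lemma ddir_J_linear:
  assumes "z \<in> S"
  shows "linear (\<lambda>h. ddir (\<lambda>z. J z v) z h)" "linear (\<lambda>v. ddir (\<lambda>z. J z v) z h)"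
  using has_derivative_linear[OF smooth_on_has_derivative[OF smooth_J assms]]
    linear_ddir_family[OF open_S assms linear_J smooth_on_differentiable[OF smooth_J assms]]
  by blast+

text \<open>The derivative of the constant family \<open>J\<^sup>2 = -1\<close>.\<close>

lemma ddir_J_J:
  assumes z: "z \<in> S"
  shows "ddir (\<lambda>x. J x (J z v)) z h = - J z (ddir (\<lambda>z. J z v) z h)"
proof -
  have "((\<lambda>z. J z (J z v)) has_derivative (\<lambda>h. ddir (\<lambda>z'. J z' (J z v)) z h + J z (ddir (\<lambda>z. J z v) z h))) (at z)"
    by (rule has_derivative_J[OF z smooth_on_has_derivative[OF smooth_J z]])
  moreover have "((\<lambda>z. J z (J z v)) has_derivative (\<lambda>h. 0)) (at z)"
    by (rule has_derivative_transform_within_open[OF has_derivative_const[of "- v"] open_S z]) (simp add: J_J)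
  ultimately have "(\<lambda>h. ddir (\<lambda>z'. J z' (J z v)) z h + J z (ddir (\<lambda>z. J z v) z h)) = (\<lambda>h. 0)"
    by (rule has_derivative_unique)
  then show ?thesis by (metis eq_neg_iff_add_eq_0)
qed

text \<open>By the product rule \<open>D(JX) = (DJ)X + J(DX)\<close>, and the terms with \<open>DX\<close> and \<open>DY\<close> cancel because of
  \<open>J\<^sup>2 = -1\<close>.\<close>

lemma nijenhuis_eq_form:
  assumes z: "z \<in> S" and X: "X \<alpha> differentiable (at z)" and Y: "Y \<alpha> differentiable (at z)" and I: "I \<alpha> = J"
  shows "nijenhuis I X Y \<alpha> z = nijenhuis_form J z (X \<alpha> z) (Y \<alpha> z)"
proof -
  have dX: "(X \<alpha> has_derivative ddir (X \<alpha>) z) (at z)" and dY: "(Y \<alpha> has_derivative ddir (Y \<alpha>) z) (at z)"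
    using X Y frechet_derivative_works by blast+
  have dJ: "ddir (act I X \<alpha>) z h = ddir (\<lambda>z'. J z' (X \<alpha> z)) z h + J z (ddir (X \<alpha>) z h)"
    "ddir (act I Y \<alpha>) z h = ddir (\<lambda>z'. J z' (Y \<alpha> z)) z h + J z (ddir (Y \<alpha>) z h)" for h
    unfolding act_def I using ddir_eq[OF has_derivative_J[OF z dX]] ddir_eq[OF has_derivative_J[OF z dY]] by auto
  note lin = linear_add[OF linear_J[OF z]] linear_diff[OF linear_J[OF z]] linear_neg[OF linear_J[OF z]]
  have act: "act I V \<alpha> z = J z (V \<alpha> z)" for V
    by (simp add: act_def I)
  show ?thesis
    by (simp add: nijenhuis_def act lie_bracket_def dJ nijenhuis_form_def lin J_J[OF z])
qed

lemma nijenhuis_form_linear: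
  assumes z: "z \<in> S"
  shows "linear (\<lambda>x. nijenhuis_form J z x y)" "linear (\<lambda>y. nijenhuis_form J z x y)"
  unfolding nijenhuis_form_def
  by (intro linear_compose_add linear_compose_sub ddir_J_linear[OF z] linear_compose[unfolded o_def, OF linear_J[OF z]]
      linear_compose[unfolded o_def, OF _ linear_J[OF z]])+

lemma nijenhuis_form_swap: "nijenhuis_form J z y x = - nijenhuis_form J z x y"
  by (simp add: nijenhuis_form_def)

lemma nijenhuis_form_J:
  assumes z: "z \<in> S"
  shows "nijenhuis_form J z (J z x) y = - J z (nijenhuis_form J z x y)"
  using linear_add[OF linear_J[OF z]] linear_diff[OF linear_J[OF z]] linear_neg[OF linear_J[OF z]]
    linear_neg[OF ddir_J_linear(1)[OF z]]
  by (simp add: nijenhuis_form_def ddir_J_J[OF z] J_J[OF z])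

text \<open>Since \<open>N(Jx,y) = - J N(x,y)\<close>, and likewise in the second argument, \<open>N\<close> vanishes if it does on a
  set of vectors which together with its image under \<open>J\<close> generates the tangent space.\<close>

lemma nijenhuis_form_zero_if_zero_on_J_generators:
  assumes z: "z \<in> S" and span: "\<And>v. \<exists>x\<in>H. \<exists>y\<in>H. v = x + J z y"
    and H: "\<And>x y. x \<in> H \<Longrightarrow> y \<in> H \<Longrightarrow> nijenhuis_form J z x y = 0"
  shows "nijenhuis_form J z v w = 0"
proof -
  note add = linear_add[OF nijenhuis_form_linear(1)[OF z]] linear_add[OF nijenhuis_form_linear(2)[OF z]]
  have J0: "J z 0 = 0" by (rule linear_0[OF linear_J[OF z]])
  have right: "nijenhuis_form J z v y = 0" if "y \<in> H" for v y
    using span[of v] that by (auto simp: add nijenhuis_form_J[OF z] H J0)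
  have "nijenhuis_form J z v (J z y) = 0" if "y \<in> H" for y v
    using nijenhuis_form_J[OF z, of y v] nijenhuis_form_swap[of z v "J z y"] nijenhuis_form_swap[of z y v] right[OF that, of v] by (simp add: J0)
  then show ?thesis using span[of w] right by (auto simp: add)
qed

end

section \<open>Derivatives of the natural tensors\<close>

text \<open>The derivatives of \<open>Gamma_cov\<close> and \<open>K_low\<close> are computed after pairing with a constant vector
  \<open>e\<close>.\<close>

lemma ddir_inner:
  assumes "F differentiable (at z)" and "((\<lambda>z. F z \<bullet> e) has_derivative D) (at z)"
  shows "ddir F z h \<bullet> e = D h"
proof -
  have "((\<lambda>z. F z \<bullet> e) has_derivative (\<lambda>h. ddir F z h \<bullet> e)) (at z)"
    using assms(1) has_derivative_inner_left frechet_derivative_works by blast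
  then have "(\<lambda>h. ddir F z h \<bullet> e) = D" using assms(2) by (rule has_derivative_unique)
  then show ?thesis by metis
qed

lemma ddir_Pair_const:
  assumes "F differentiable (at z)"
  shows "ddir (\<lambda>z. (c, F z)) z h = (0, ddir F z h)"
  by (rule ddir_eq) (intro has_derivative_Pair has_derivative_const, use assms frechet_derivative_works in blast)

context metric_chart
begin

lemma smooth_fst_compose:
  fixes f :: "real^'n \<Rightarrow> 'c::real_normed_vector"
  assumes "smooth_on U f" shows "smooth_on punctured (\<lambda>z. f (fst z))"
  by (rule smooth_on_compose[OF open_punctured assms smooth_on_linear[OF bounded_linear_fst open_punctured]]) (simp add: punctured_D)

lemma smooth_snd: "smooth_on punctured (\<lambda>z. snd z)"
  by (rule smooth_on_linear[OF bounded_linear_snd open_punctured])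

lemma smooth_energy: "smooth_on punctured (\<lambda>z. energy g \<alpha> z)"
  unfolding energy_def case_prod_beta
  by (intro smooth_intros open_punctured smooth_snd smooth_fst_compose[OF smooth_g_up])

lemma smooth_energy_compose:
  fixes f :: "real \<Rightarrow> real"
  assumes "smooth_on {0<..} f"
  shows "smooth_on punctured (\<lambda>z. f (energy g \<alpha> z))"
  by (rule smooth_on_compose[OF open_punctured assms smooth_energy]) (simp add: energy_pos)

lemma smooth_Gamma0: "smooth_on punctured (\<lambda>z. Gamma0 g \<alpha> z i h)"
  unfolding Gamma0_def case_prod_beta
  by (intro smooth_intros open_punctured smooth_snd smooth_fst_compose[OF smooth_christoffel])

lemma smooth_delta_q: "smooth_on punctured (\<lambda>z. delta_q g \<alpha> z i)"
  unfolding delta_q_def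
  by (intro smooth_on_Pair smooth_on_const smooth_on_componentwise open_punctured) (simp add: smooth_Gamma0)

lemma smooth_nat_low:
  assumes "smooth_on {0<..} f\<^sub>1" "smooth_on {0<..} f\<^sub>2"
  shows "smooth_on punctured (\<lambda>z. nat_low g f\<^sub>1 f\<^sub>2 \<alpha> z i j)"
  unfolding nat_low_def g_low_def
  by (intro smooth_intros open_punctured smooth_snd smooth_fst_compose[OF smooth_g] smooth_energy_compose assms)

lemma smooth_nat_up:
  assumes "smooth_on {0<..} f\<^sub>1" "smooth_on {0<..} f\<^sub>2"
  shows "smooth_on punctured (\<lambda>z. nat_up g f\<^sub>1 f\<^sub>2 \<alpha> z i j)"
  unfolding nat_up_def g0_up_def case_prod_beta
  by (intro smooth_intros open_punctured smooth_snd smooth_fst_compose[OF smooth_g_up] smooth_energy_compose assms)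

lemma smooth_Dp: "smooth_on punctured (\<lambda>z. Dp g \<alpha> z i v)"
  unfolding Dp_def by (intro smooth_intros open_punctured smooth_Gamma0)

lemma smooth_natural_J:
  assumes "smooth_on {0<..} a\<^sub>1" "smooth_on {0<..} b\<^sub>1" "smooth_on {0<..} a\<^sub>2" "smooth_on {0<..} b\<^sub>2"
  shows "smooth_on punctured (\<lambda>z. natural_J g a\<^sub>1 b\<^sub>1 a\<^sub>2 b\<^sub>2 \<alpha> z v)"
  unfolding natural_J_def
  by (intro smooth_on_add smooth_on_sum smooth_on_scaleR smooth_on_uminus smooth_on_const open_punctured smooth_Dp smooth_delta_q
      smooth_nat_low smooth_nat_up assms)

lemma smooth_natural_G:
  assumes "smooth_on {0<..} c\<^sub>1" "smooth_on {0<..} d\<^sub>1" "smooth_on {0<..} c\<^sub>2" "smooth_on {0<..} d\<^sub>2"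
  shows "smooth_on punctured (\<lambda>z. natural_G g c\<^sub>1 d\<^sub>1 c\<^sub>2 d\<^sub>2 \<alpha> z v w)"
  unfolding natural_G_def
  by (intro smooth_on_add smooth_on_sum smooth_on_mult smooth_on_const open_punctured smooth_Dp
      smooth_nat_low smooth_nat_up assms)

lemma smooth_Gamma_cov: "smooth_on punctured (\<lambda>z. Gamma_cov g \<alpha> z u)"
  unfolding Gamma_cov_def
  by (intro smooth_on_componentwise open_punctured)
    (simp, intro smooth_on_bilinear[OF bounded_bilinear_inner] open_punctured smooth_snd smooth_fst_compose[OF smooth_Gamma_vec])

lemma smooth_K_low:
  assumes "smooth_on {0<..} f\<^sub>1" "smooth_on {0<..} f\<^sub>2"
  shows "smooth_on punctured (\<lambda>z. K_low g f\<^sub>1 f\<^sub>2 \<alpha> z u)"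
proof -
  have "smooth_on U (\<lambda>q. flat g \<alpha> q u)"
    unfolding flat_def by (intro smooth_on_componentwise open_U) (simp add: smooth_g)
  then show ?thesis
    unfolding K_low_def
    by (intro smooth_on_add smooth_on_scaleR smooth_on_mult smooth_energy_compose assms open_punctured smooth_fst_compose
      smooth_snd smooth_on_inner_left)
qed

lemma has_derivative_fst_compose:
  assumes "(f has_derivative f') (at (fst z))"
  shows "((\<lambda>z. f (fst z)) has_derivative (\<lambda>h. f' (fst h))) (at z)"
  by (rule has_derivative_compose[where f = fst and g = f, OF _ assms]) (rule has_derivative_fst[OF has_derivative_ident])

lemma ddir_Gamma_cov:
  assumes z: "z \<in> punctured"
  shows "ddir (\<lambda>z. Gamma_cov g \<alpha> z u) z h \<bullet> e = snd h \<bullet> Gamma_vec g \<alpha> (fst z) u e + snd z \<bullet> dGamma_vec (fst z) (fst h) u e"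
proof (rule ddir_inner[OF smooth_on_differentiable[OF smooth_Gamma_cov z]])
  have "((\<lambda>z. snd z \<bullet> Gamma_vec g \<alpha> (fst z) u e) has_derivative
      (\<lambda>h. snd z \<bullet> dGamma_vec (fst z) (fst h) u e + snd h \<bullet> Gamma_vec g \<alpha> (fst z) u e)) (at z)"
    by (intro has_derivative_inner has_derivative_fst_compose has_derivative_Gamma_vec punctured_D z) (auto intro: derivative_intros)
  then show "((\<lambda>z. Gamma_cov g \<alpha> z u \<bullet> e) has_derivative
      (\<lambda>h. snd h \<bullet> Gamma_vec g \<alpha> (fst z) u e + snd z \<bullet> dGamma_vec (fst z) (fst h) u e)) (at z)"
    by (simp add: Gamma_cov_inner add.commute)
qed

text \<open>Since \<open>t = \<langle>p,s\<rangle> - g(s,s)/2\<close> for \<open>s = sharp p\<close> is stationary in \<open>s\<close>, the derivative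
  of \<open>s\<close> does not enter the derivative of the energy.\<close>

lemma ddir_energy:
  assumes z: "z \<in> punctured" and s: "s = sharp g \<alpha> (fst z) (snd z)"
  shows "ddir (energy g \<alpha>) z h = s \<bullet> snd h - dg (fst z) (fst h) s s / 2"
proof -
  have q: "fst z \<in> U" using punctured_D(1)[OF z] .
  define \<sigma> where "\<sigma> z = sharp g \<alpha> (fst z) (snd z)" for z
  have "smooth_on punctured \<sigma>"
    unfolding \<sigma>_def sharp_def
    by (intro smooth_on_componentwise open_punctured)
      (simp, intro smooth_intros open_punctured smooth_snd smooth_fst_compose[OF smooth_g_up])
  then obtain \<sigma>' where \<sigma>': "(\<sigma> has_derivative \<sigma>') (at z)"
    using smooth_on_has_derivative z by blast
  have snd': "(snd has_derivative snd) (at z)" by (auto intro: derivative_intros)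
  have gss: "((\<lambda>z. g \<alpha> (fst z) (\<sigma> z) (\<sigma> z)) has_derivative
      (\<lambda>h. dg (fst z) (fst h) s s + g \<alpha> (fst z) (\<sigma>' h) s + g \<alpha> (fst z) s (\<sigma>' h))) (at z)"
  proof -
    have d: "((\<lambda>z. g \<alpha> (fst z) u v) has_derivative (\<lambda>h. dg (fst z) (fst h) u v)) (at z)" if "z \<in> punctured" for z u v
      by (rule has_derivative_fst_compose[OF has_derivative_g[OF punctured_D(1)[OF that]]])
    have "((\<lambda>z. g \<alpha> (fst z) (\<sigma> z) (\<sigma> z)) has_derivative
      (\<lambda>h. ddir (\<lambda>z'. g \<alpha> (fst z') (\<sigma> z) (\<sigma> z)) z h + g \<alpha> (fst z) (\<sigma>' h) (\<sigma> z) + g \<alpha> (fst z) (\<sigma> z) (\<sigma>' h))) (at z)"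
      by (rule has_derivative_bilinear_family[OF open_punctured z _ _ \<sigma>' \<sigma>'])
        (auto intro: bilinear_g punctured_D differentiableI[OF d])
    then show ?thesis unfolding ddir_eq[OF d[OF z]] by (simp add: \<sigma>_def s)
  qed
  have "((\<lambda>z. \<sigma> z \<bullet> snd z - (1/2) * g \<alpha> (fst z) (\<sigma> z) (\<sigma> z)) has_derivative
      (\<lambda>h. (\<sigma> z \<bullet> snd h + \<sigma>' h \<bullet> snd z) - (1/2) * (dg (fst z) (fst h) s s + g \<alpha> (fst z) (\<sigma>' h) s + g \<alpha> (fst z) s (\<sigma>' h)))) (at z)"
    by (intro has_derivative_diff has_derivative_inner \<sigma>' snd' has_derivative_mult_right gss)
  moreover have "\<sigma> z \<bullet> snd z - (1/2) * g \<alpha> (fst z) (\<sigma> z) (\<sigma> z) = energy g \<alpha> z" if "z \<in> punctured" for z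
    by (simp add: energy_eq \<sigma>_def g_sharp[OF punctured_D(1)[OF that]] inner_commute[of _ "snd z"])
  ultimately have "(energy g \<alpha> has_derivative
      (\<lambda>h. (\<sigma> z \<bullet> snd h + \<sigma>' h \<bullet> snd z) - (1/2) * (dg (fst z) (fst h) s s + g \<alpha> (fst z) (\<sigma>' h) s + g \<alpha> (fst z) s (\<sigma>' h)))) (at z)"
    using has_derivative_transform_within_open[OF _ open_punctured z] by blast
  then have "ddir (energy g \<alpha>) z h =
      (\<sigma> z \<bullet> snd h + \<sigma>' h \<bullet> snd z) - (1/2) * (dg (fst z) (fst h) s s + g \<alpha> (fst z) (\<sigma>' h) s + g \<alpha> (fst z) s (\<sigma>' h))"
    by (rule ddir_eq)
  then show ?thesis
    by (simp add: s \<sigma>_def g_sharp[OF q] inner_commute[of "\<sigma>' h"] field_simps)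
qed

lemma ddir_K_low:
  assumes z: "z \<in> punctured" and s: "s = sharp g \<alpha> (fst z) (snd z)" and t: "t = energy g \<alpha> z"
    and f: "smooth_on {0<..} f\<^sub>1" "smooth_on {0<..} f\<^sub>2"
  shows "ddir (\<lambda>z. K_low g f\<^sub>1 f\<^sub>2 \<alpha> z u) z h \<bullet> e =
    deriv f\<^sub>1 t * ddir (energy g \<alpha>) z h * g \<alpha> (fst z) u e + f\<^sub>1 t * dg (fst z) (fst h) u e
    + deriv f\<^sub>2 t * ddir (energy g \<alpha>) z h * (snd z \<bullet> u) * (snd z \<bullet> e)
    + f\<^sub>2 t * ((snd h \<bullet> u) * (snd z \<bullet> e) + (snd z \<bullet> u) * (snd h \<bullet> e))"
proof (rule ddir_inner[OF smooth_on_differentiable[OF smooth_K_low[OF f] z]])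
  have t0: "0 < t" using energy_pos[OF z] t by simp
  have E: "(energy g \<alpha> has_derivative ddir (energy g \<alpha>) z) (at z)"
    using smooth_on_has_derivative[OF smooth_energy z] .
  have fE: "((\<lambda>z. \<phi> (energy g \<alpha> z)) has_derivative (\<lambda>h. deriv \<phi> t * ddir (energy g \<alpha>) z h)) (at z)"
    if "smooth_on {0<..} \<phi>" for \<phi> :: "real \<Rightarrow> real"
  proof -
    have "\<phi> differentiable (at t)" using smooth_on_differentiable[OF that] t0 by simp
    then have "(\<phi> has_real_derivative deriv \<phi> t) (at t)"
      using DERIV_deriv_iff_real_differentiable by blast
    then have "(\<phi> has_derivative (*) (deriv \<phi> t)) (at (energy g \<alpha> z))"
      unfolding t by (simp add: has_field_derivative_def)
    from has_derivative_compose[where f = "energy g \<alpha>" and g = \<phi>, OF E this] show ?thesis .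
  qed
  have p: "((\<lambda>z. snd z \<bullet> v) has_derivative (\<lambda>h. snd h \<bullet> v)) (at z)" for v
    by (intro has_derivative_inner_left) (auto intro: derivative_intros)
  have "((\<lambda>z. f\<^sub>1 (energy g \<alpha> z) * g \<alpha> (fst z) u e + f\<^sub>2 (energy g \<alpha> z) * (snd z \<bullet> u) * (snd z \<bullet> e)) has_derivative
    (\<lambda>h. (f\<^sub>1 (energy g \<alpha> z) * dg (fst z) (fst h) u e + deriv f\<^sub>1 t * ddir (energy g \<alpha>) z h * g \<alpha> (fst z) u e)
      + (f\<^sub>2 (energy g \<alpha> z) * (snd z \<bullet> u) * (snd h \<bullet> e) +
        (f\<^sub>2 (energy g \<alpha> z) * (snd h \<bullet> u) + deriv f\<^sub>2 t * ddir (energy g \<alpha>) z h * (snd z \<bullet> u)) * (snd z \<bullet> e)))) (at z)"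
    by (intro has_derivative_add has_derivative_mult fE f p has_derivative_fst_compose has_derivative_g punctured_D z)
  then have "((\<lambda>z. K_low g f\<^sub>1 f\<^sub>2 \<alpha> z u \<bullet> e) has_derivative
    (\<lambda>h. (f\<^sub>1 (energy g \<alpha> z) * dg (fst z) (fst h) u e + deriv f\<^sub>1 t * ddir (energy g \<alpha>) z h * g \<alpha> (fst z) u e)
      + (f\<^sub>2 (energy g \<alpha> z) * (snd z \<bullet> u) * (snd h \<bullet> e) +
        (f\<^sub>2 (energy g \<alpha> z) * (snd h \<bullet> u) + deriv f\<^sub>2 t * ddir (energy g \<alpha>) z h * (snd z \<bullet> u)) * (snd z \<bullet> e)))) (at z)"
    by (rule has_derivative_transform_within_open[OF _ open_punctured z]) (simp add: K_low_inner punctured_D)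
  then show "((\<lambda>z. K_low g f\<^sub>1 f\<^sub>2 \<alpha> z u \<bullet> e) has_derivative
    (\<lambda>h. deriv f\<^sub>1 t * ddir (energy g \<alpha>) z h * g \<alpha> (fst z) u e + f\<^sub>1 t * dg (fst z) (fst h) u e
    + deriv f\<^sub>2 t * ddir (energy g \<alpha>) z h * (snd z \<bullet> u) * (snd z \<bullet> e)
    + f\<^sub>2 t * ((snd h \<bullet> u) * (snd z \<bullet> e) + (snd z \<bullet> u) * (snd h \<bullet> e)))) (at z)"
    by (rule has_derivative_eq_rhs) (simp add: t algebra_simps)
qed

end

section \<open>Integrability\<close>

context metric_chart
begin

text \<open>Parallel transport preserves the length of a covector.\<close>

lemma ddir_energy_hor:
  assumes z: "z \<in> punctured"
  shows "ddir (energy g \<alpha>) z (hor g \<alpha> z u) = 0"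
proof -
  have q: "fst z \<in> U" using punctured_D(1)[OF z] .
  let ?s = "sharp g \<alpha> (fst z) (snd z)"
  have "?s \<bullet> Gamma_cov g \<alpha> z u = g \<alpha> (fst z) (Gamma_vec g \<alpha> (fst z) u ?s) ?s"
    by (simp add: inner_commute[of ?s] Gamma_cov_inner g_sharp[OF q])
  then show ?thesis
    using g_sym[OF q, of ?s "Gamma_vec g \<alpha> (fst z) u ?s"]
    by (simp add: ddir_energy[OF z refl] metric_compatible[OF q]) (simp add: hor_def)
qed

text \<open>The next three lemmas are the vertical parts of the brackets \<open>[u\<^sup>h, v\<^sup>h]\<close>, \<open>[u\<^sup>h, K v]\<close> and
  \<open>[K u, K v]\<close>. All three brackets are vertical, because the horizontal parts of the fields are
  constant in the chart. The first one is the curvature.\<close>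

lemma bracket_hor_hor:
  assumes z: "z \<in> punctured"
  shows "(ddir (\<lambda>z. Gamma_cov g \<alpha> z v) z (hor g \<alpha> z u) - ddir (\<lambda>z. Gamma_cov g \<alpha> z u) z (hor g \<alpha> z v)) \<bullet> e
    = snd z \<bullet> curvature g \<alpha> (fst z) u v e"
  by (simp add: inner_diff_left ddir_Gamma_cov[OF z] curvature_eq[OF punctured_D(1)[OF z]] inner_diff_right inner_add_right)
    (simp add: hor_def Gamma_cov_inner)

text \<open>The horizontal derivatives of \<open>g\<close>, \<open>p\<close> and \<open>t\<close> vanish, so that the covariant derivative
  of \<open>f\<^sub>1 g + f\<^sub>2 p \<otimes> p\<close> does, and only the connection term is left.\<close>

lemma bracket_hor_vert:
  assumes z: "z \<in> punctured" and f: "smooth_on {0<..} f\<^sub>1" "smooth_on {0<..} f\<^sub>2"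
  shows "ddir (\<lambda>z. K_low g f\<^sub>1 f\<^sub>2 \<alpha> z v) z (hor g \<alpha> z u) - ddir (\<lambda>z. Gamma_cov g \<alpha> z u) z (0, K_low g f\<^sub>1 f\<^sub>2 \<alpha> z v)
    = K_low g f\<^sub>1 f\<^sub>2 \<alpha> z (Gamma_vec g \<alpha> (fst z) u v)" (is "?L = ?R")
proof -
  have q: "fst z \<in> U" using punctured_D(1)[OF z] .
  have "?L \<bullet> e = ?R \<bullet> e" for e
    using linear_0[OF dGamma_vec_linear(1)[OF q], of u e]
    by (simp add: inner_diff_left ddir_Gamma_cov[OF z] ddir_K_low[OF z refl refl f] ddir_energy_hor[OF z]
        K_low_inner[OF q] metric_compatible[OF q])
      (simp add: hor_def Gamma_cov_inner algebra_simps)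
  then show ?thesis using vector_eq_rdot by blast
qed

text \<open>Only derivatives in the fibre occur. Terms symmetric in \<open>u\<close> and \<open>v\<close>, in particular the one with
  the derivative of \<open>f\<^sub>2\<close>, cancel.\<close>

lemma bracket_vert_vert:
  assumes z: "z \<in> punctured" and f: "smooth_on {0<..} f\<^sub>1" "smooth_on {0<..} f\<^sub>2" and t: "t = energy g \<alpha> z"
  shows "ddir (\<lambda>z. K_low g f\<^sub>1 f\<^sub>2 \<alpha> z v) z (0, K_low g f\<^sub>1 f\<^sub>2 \<alpha> z u)
      - ddir (\<lambda>z. K_low g f\<^sub>1 f\<^sub>2 \<alpha> z u) z (0, K_low g f\<^sub>1 f\<^sub>2 \<alpha> z v)
    = (f\<^sub>1 t * deriv f\<^sub>1 t + f\<^sub>2 t * (2 * t * deriv f\<^sub>1 t - f\<^sub>1 t)) *\<^sub>R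
       ((snd z \<bullet> u) *\<^sub>R flat g \<alpha> (fst z) v - (snd z \<bullet> v) *\<^sub>R flat g \<alpha> (fst z) u)" (is "?L = ?R")
proof -
  have q: "fst z \<in> U" using punctured_D(1)[OF z] .
  have dE: "ddir (energy g \<alpha>) z (0, K_low g f\<^sub>1 f\<^sub>2 \<alpha> z u) = (f\<^sub>1 t + 2 * t * f\<^sub>2 t) * (snd z \<bullet> u)" for u
    using linear_0[OF dg_linear(1)[OF q]]
    by (simp add: ddir_energy[OF z refl] sharp_inner_K_low[OF q] t)
  have "?L \<bullet> e = ?R \<bullet> e" for e
    using linear_0[OF dg_linear(1)[OF q], of u e] linear_0[OF dg_linear(1)[OF q], of v e] g_sym[OF q, of u v]
    by (simp add: inner_diff_left ddir_K_low[OF z refl t f] dE K_low_inner[OF q] t[symmetric] flat_inner[OF q])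
      (simp add: algebra_simps)
  then show ?thesis using vector_eq_rdot by blast
qed

end

text \<open>The two equations between the coefficients express that \<open>J\<close> is an almost complex structure.\<close>

locale natural_complex_chart = metric_chart g \<alpha> U
  for g :: "('i, real^'n::finite) bil_field" and \<alpha> :: 'i and U :: "(real^'n) set" +
  fixes a\<^sub>1 b\<^sub>1 a\<^sub>2 b\<^sub>2 :: "real \<Rightarrow> real"
  assumes smooth_coeffs: "smooth_on {0<..} a\<^sub>1" "smooth_on {0<..} b\<^sub>1" "smooth_on {0<..} a\<^sub>2" "smooth_on {0<..} b\<^sub>2"
    and inverse_coeffs: "\<And>t. 0 < t \<Longrightarrow> a\<^sub>1 t * a\<^sub>2 t = 1"
      "\<And>t. 0 < t \<Longrightarrow> (a\<^sub>1 t + 2 * t * b\<^sub>1 t) * (a\<^sub>2 t + 2 * t * b\<^sub>2 t) = 1"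
begin

abbreviation "\<J> \<equiv> natural_J g a\<^sub>1 b\<^sub>1 a\<^sub>2 b\<^sub>2 \<alpha>"
abbreviation "\<K> \<equiv> K_low g a\<^sub>1 b\<^sub>1 \<alpha>"

sublocale J: smooth_complex_family \<J> punctured
proof (rule smooth_complex_family.intro)
  show "open punctured" by (rule open_punctured)
  show "smooth_on punctured (\<lambda>z. \<J> z v)" for v by (rule smooth_natural_J[OF smooth_coeffs])
  show "linear (\<J> z)" if "z \<in> punctured" for z by (rule linear_natural_J[OF punctured_D(1)[OF that]])
  show "\<J> z (\<J> z v) = - v" if "z \<in> punctured" for z v
    using natural_J_squared[OF that refl] inverse_coeffs energy_pos[OF that] by blast
qed

lemma J_hor: "z \<in> punctured \<Longrightarrow> \<J> z (hor g \<alpha> z u) = (0, \<K> z u)"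
  by (simp add: natural_J_eq punctured_D linear_0[OF linear_K_up] linear_0[OF linear_hor])

text \<open>The differential equation for \<open>a\<^sub>1\<close> equates the vertical parts of \<open>[K u, K v]\<close> and
  \<open>[u\<^sup>h, v\<^sup>h]\<close>; the two mixed brackets cancel by the symmetry of \<open>bracket_hor_vert\<close>.\<close>

lemma nijenhuis_form_hor_hor:
  assumes z: "z \<in> punctured" and t: "t = energy g \<alpha> z"
    and ode: "a\<^sub>1 t * deriv a\<^sub>1 t + b\<^sub>1 t * (2 * t * deriv a\<^sub>1 t - a\<^sub>1 t) = c"
    and curv: "\<And>u v w. curvature g \<alpha> (fst z) u v w = c *\<^sub>R (g \<alpha> (fst z) v w *\<^sub>R u - g \<alpha> (fst z) u w *\<^sub>R v)"
  shows "nijenhuis_form \<J> z (hor g \<alpha> z u) (hor g \<alpha> z v) = 0"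
proof -
  have q: "fst z \<in> U" using punctured_D(1)[OF z] .
  let ?I = "natural_J g a\<^sub>1 b\<^sub>1 a\<^sub>2 b\<^sub>2"
  define X where "X u = (\<lambda>\<beta>::'i. \<lambda>z. hor g \<alpha> z u)" for u
  have dGamma_cov: "(\<lambda>z. Gamma_cov g \<alpha> z u) differentiable (at z)" for u
    using smooth_on_differentiable[OF smooth_Gamma_cov z] .
  have dK: "(\<lambda>z. \<K> z u) differentiable (at z)" for u
    using smooth_on_differentiable[OF smooth_K_low[OF smooth_coeffs(1,2)] z] .
  have X: "ddir (X u \<alpha>) z h = (0, ddir (\<lambda>z. Gamma_cov g \<alpha> z u) z h)" for u h
    unfolding X_def hor_def by (rule ddir_Pair_const[OF dGamma_cov])
  have "smooth_on punctured (X u \<alpha>)" for u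
    unfolding X_def hor_def by (intro smooth_on_Pair smooth_on_const open_punctured smooth_Gamma_cov)
  then have X_diff: "X u \<alpha> differentiable (at z)" for u
    using smooth_on_differentiable z by blast
  have JX: "ddir (act ?I (X u) \<alpha>) z h = (0, ddir (\<lambda>z. \<K> z u) z h)" for u h
  proof -
    have "ddir (act ?I (X u) \<alpha>) z h = ddir (\<lambda>z. (0, \<K> z u)) z h"
      by (rule ddir_cong[OF open_punctured z]) (simp add: act_def X_def J_hor)
    then show ?thesis by (simp add: ddir_Pair_const[OF dK])
  qed
  have JXz: "act ?I (X u) \<alpha> z = (0, \<K> z u)" for u
    by (simp add: act_def X_def J_hor z)
  have act: "act ?I V \<alpha> z = \<J> z (V \<alpha> z)" for V by (simp add: act_def)
  have J0: "\<J> z 0 = 0" by (rule linear_0[OF J.linear_J[OF z]])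
  have vv: "lie_bracket (act ?I (X u)) (act ?I (X v)) \<alpha> z = lie_bracket (X u) (X v) \<alpha> z"
  proof -
    have "(ddir (\<lambda>z. Gamma_cov g \<alpha> z v) z (hor g \<alpha> z u) - ddir (\<lambda>z. Gamma_cov g \<alpha> z u) z (hor g \<alpha> z v)) \<bullet> e =
        (c *\<^sub>R ((snd z \<bullet> u) *\<^sub>R flat g \<alpha> (fst z) v - (snd z \<bullet> v) *\<^sub>R flat g \<alpha> (fst z) u)) \<bullet> e" for e
      unfolding bracket_hor_hor[OF z] curv
      by (simp add: inner_diff_left inner_diff_right flat_inner[OF q] algebra_simps)
    then have "ddir (\<lambda>z. Gamma_cov g \<alpha> z v) z (hor g \<alpha> z u) - ddir (\<lambda>z. Gamma_cov g \<alpha> z u) z (hor g \<alpha> z v) =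
        c *\<^sub>R ((snd z \<bullet> u) *\<^sub>R flat g \<alpha> (fst z) v - (snd z \<bullet> v) *\<^sub>R flat g \<alpha> (fst z) u)"
      using vector_eq_rdot by blast
    also have "\<dots> = ddir (\<lambda>z. \<K> z v) z (0, \<K> z u) - ddir (\<lambda>z. \<K> z u) z (0, \<K> z v)"
      unfolding bracket_vert_vert[OF z smooth_coeffs(1,2) t] ode ..
    finally show ?thesis
      by (simp add: lie_bracket_def JX JXz X) (simp add: X_def)
  qed
  have hv: "lie_bracket (act ?I (X u)) (X v) \<alpha> z + lie_bracket (X u) (act ?I (X v)) \<alpha> z = 0"
    using bracket_hor_vert[OF z smooth_coeffs(1,2), of v u] bracket_hor_vert[OF z smooth_coeffs(1,2), of u v]
      Gamma_vec_sym[OF q, of u v]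
    by (simp add: lie_bracket_def JX JXz X) (simp add: X_def algebra_simps zero_prod_def)
  have "nijenhuis ?I (X u) (X v) \<alpha> z =
      - \<J> z (lie_bracket (act ?I (X u)) (X v) \<alpha> z + lie_bracket (X u) (act ?I (X v)) \<alpha> z)"
    by (simp add: nijenhuis_def act vv linear_add[OF J.linear_J[OF z]])
  also have "\<dots> = 0" unfolding hv J0 by simp
  finally show ?thesis
    using J.nijenhuis_eq_form[where I = ?I and X = "X u" and Y = "X v" and \<alpha> = \<alpha>, OF z X_diff X_diff refl]
    by (simp add: X_def)
qed

text \<open>Every vertical vector is the image under \<open>J\<close> of a horizontal one.\<close>

lemma nijenhuis_form_zero:
  assumes z: "z \<in> punctured" and t: "t = energy g \<alpha> z"
    and ode: "a\<^sub>1 t * deriv a\<^sub>1 t + b\<^sub>1 t * (2 * t * deriv a\<^sub>1 t - a\<^sub>1 t) = c"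
    and curv: "\<And>u v w. curvature g \<alpha> (fst z) u v w = c *\<^sub>R (g \<alpha> (fst z) v w *\<^sub>R u - g \<alpha> (fst z) u w *\<^sub>R v)"
  shows "nijenhuis_form \<J> z v w = 0"
proof (rule J.nijenhuis_form_zero_if_zero_on_J_generators[OF z, where H = "range (hor g \<alpha> z)"])
  fix v :: "(real^'n) \<times> (real^'n)"
  let ?u = "K_up g a\<^sub>2 b\<^sub>2 \<alpha> z (vert g \<alpha> z v)"
  have "\<J> z (hor g \<alpha> z ?u) = (0, vert g \<alpha> z v)"
    using K_low_K_up(1)[where f\<^sub>1 = a\<^sub>1 and f\<^sub>2 = b\<^sub>1 and h\<^sub>1 = a\<^sub>2 and h\<^sub>2 = b\<^sub>2, OF z refl]
      inverse_coeffs energy_pos[OF z] by (simp add: J_hor[OF z])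
  then have "v = hor g \<alpha> z (fst v) + \<J> z (hor g \<alpha> z ?u)"
    using hor_vert_decomposition by metis
  then show "\<exists>x\<in>range (hor g \<alpha> z). \<exists>y\<in>range (hor g \<alpha> z). v = x + \<J> z y" by blast
qed (use nijenhuis_form_hor_hor[OF assms] in auto)

end

section \<open>Change of charts\<close>

text \<open>A change of charts \<open>\<phi>\<close> with domain \<open>D\<close> between the charts \<open>\<alpha>\<close> and \<open>\<beta>\<close>. The metric being the
  same in both charts, \<open>\<phi>\<close> is an isometry.\<close>

locale chart_change = A: metric_chart g \<alpha> U + B: metric_chart g \<beta> V
  for g :: "('i, real^'n::finite) bil_field" and \<alpha> :: 'i and U :: "(real^'n) set"
    and \<beta> :: 'i and V :: "(real^'n) set" +
  fixes \<phi> :: "real^'n \<Rightarrow> real^'n" and D :: "(real^'n) set"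
  assumes open_D: "open D" and D_U: "D \<subseteq> U" and \<phi>_V: "\<And>q. q \<in> D \<Longrightarrow> \<phi> q \<in> V"
    and smooth_\<phi>: "smooth_on D \<phi>"
    and isometry: "\<And>q u v. q \<in> D \<Longrightarrow> g \<beta> (\<phi> q) (ddir \<phi> q u) (ddir \<phi> q v) = g \<alpha> q u v"
begin

abbreviation F where "F q u \<equiv> ddir \<phi> q u"
abbreviation F' where "F' q x u \<equiv> ddir (\<lambda>q. ddir \<phi> q u) q x"

lemma in_U: "q \<in> D \<Longrightarrow> q \<in> U"
  using D_U by blast

lemma has_derivative_\<phi>: "q \<in> D \<Longrightarrow> (\<phi> has_derivative F q) (at q)"
  using smooth_on_has_derivative[OF smooth_\<phi>] .

lemma has_derivative_F: "q \<in> D \<Longrightarrow> ((\<lambda>q. F q u) has_derivative (\<lambda>x. F' q x u)) (at q)"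
  using smooth_on_has_derivative[OF smooth_on_frechet_derivative[OF smooth_\<phi>]] .

lemma F'_sym: "q \<in> D \<Longrightarrow> F' q x u = F' q u x"
  using ddir_symmetric[OF open_D smooth_\<phi>] .

lemma linear_F: "q \<in> D \<Longrightarrow> linear (F q)"
  using has_derivative_linear[OF has_derivative_\<phi>] .

text \<open>A linear map that preserves a positive definite form is injective, hence bijective.\<close>

lemma surj_F:
  assumes q: "q \<in> D"
  shows "\<exists>u. F q u = v"
proof -
  have "inj (F q)"
    unfolding linear_injective_0[OF linear_F[OF q]]
  proof (intro allI impI)
    fix u assume "F q u = 0"
    then have "g \<alpha> q u u = 0"
      using isometry[OF q, of u u] B.g_zero[OF \<phi>_V[OF q]] by simp
    then show "u = 0" using A.g_pos[OF in_U[OF q], of u] by auto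
  qed
  then show ?thesis
    using linear_injective_imp_surjective[OF linear_F[OF q]] by (metis surjD)
qed

text \<open>Differentiate the isometry condition.\<close>

lemma dg_transform:
  assumes q: "q \<in> D"
  shows "A.dg q x u v = B.dg (\<phi> q) (F q x) (F q u) (F q v)
    + g \<beta> (\<phi> q) (F' q x u) (F q v) + g \<beta> (\<phi> q) (F q u) (F' q x v)"
proof -
  have d: "((\<lambda>q. g \<beta> (\<phi> q) u v) has_derivative (\<lambda>x. B.dg (\<phi> q) (F q x) u v)) (at q)" if "q \<in> D" for q u v
    by (rule has_derivative_compose[where f = \<phi> and g = "\<lambda>q. g \<beta> q u v",
          OF has_derivative_\<phi>[OF that] B.has_derivative_g[OF \<phi>_V[OF that]]])
  have "((\<lambda>r. g \<beta> (\<phi> r) (F r u) (F r v)) has_derivative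
      (\<lambda>x. ddir (\<lambda>r. g \<beta> (\<phi> r) (F q u) (F q v)) q x + g \<beta> (\<phi> q) (F' q x u) (F q v) + g \<beta> (\<phi> q) (F q u) (F' q x v))) (at q)"
    by (rule has_derivative_bilinear_family[OF open_D q _ _ has_derivative_F[OF q] has_derivative_F[OF q]])
      (auto intro: B.bilinear_g \<phi>_V differentiableI[OF d])
  then have "((\<lambda>r. g \<alpha> r u v) has_derivative
      (\<lambda>x. ddir (\<lambda>r. g \<beta> (\<phi> r) (F q u) (F q v)) q x + g \<beta> (\<phi> q) (F' q x u) (F q v) + g \<beta> (\<phi> q) (F q u) (F' q x v))) (at q)"
    by (rule has_derivative_transform_within_open[OF _ open_D q]) (rule isometry)
  then show ?thesis
    by (subst ddir_eq, assumption) (simp add: ddir_eq[OF d[OF q]])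
qed

text \<open>The transformation law of the Christoffel symbols. It follows from the Koszul formula
  because the second derivatives of the change of charts are symmetric.\<close>

lemma Gamma_vec_transform:
  assumes q: "q \<in> D"
  shows "F q (Gamma_vec g \<alpha> q u v) = F' q u v + Gamma_vec g \<beta> (\<phi> q) (F q u) (F q v)"
proof (rule B.g_ext[OF \<phi>_V[OF q]])
  fix e'
  obtain e where e: "e' = F q e" using surj_F[OF q] by metis
  have q': "\<phi> q \<in> V" using \<phi>_V[OF q] .
  have "2 * g \<alpha> q (Gamma_vec g \<alpha> q u v) e = 2 * g \<beta> (\<phi> q) (Gamma_vec g \<beta> (\<phi> q) (F q u) (F q v)) (F q e) + 2 * g \<beta> (\<phi> q) (F' q u v) (F q e)"
    unfolding A.koszul[OF in_U[OF q]] B.koszul[OF q'] dg_transform[OF q]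
    using F'_sym[OF q, of v u] F'_sym[OF q, of u e] F'_sym[OF q, of v e]
      B.g_sym[OF q', of "F q u" "F' q e v"]
      B.g_sym[OF q', of "F q v" "F' q u e"]
      B.g_sym[OF q', of "F q u" "F' q v e"]
    by (simp add: algebra_simps)
  then show "g \<beta> (\<phi> q) (F q (Gamma_vec g \<alpha> q u v)) e' = g \<beta> (\<phi> q) (F' q u v + Gamma_vec g \<beta> (\<phi> q) (F q u) (F q v)) e'"
    unfolding e isometry[OF q] by (simp add: B.g_add[OF q'])
qed

text \<open>\<open>w\<close> and \<open>w'\<close> are the components of one covector in the charts \<open>\<alpha>\<close> and \<open>\<beta>\<close>.\<close>

definition same_covector :: "real^'n \<Rightarrow> real^'n \<Rightarrow> real^'n \<Rightarrow> bool" where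
  "same_covector q w w' \<longleftrightarrow> (\<forall>u. w \<bullet> u = w' \<bullet> F q u)"

lemma same_covector_unique: "q \<in> D \<Longrightarrow> same_covector q w w' \<Longrightarrow> same_covector q w w'' \<Longrightarrow> w' = w''"
  unfolding same_covector_def using surj_F by (metis vector_eq_rdot)

lemma sharp_transform:
  assumes q: "q \<in> D" and w: "same_covector q w w'"
  shows "sharp g \<beta> (\<phi> q) w' = F q (sharp g \<alpha> q w)"
proof (rule B.g_ext[OF \<phi>_V[OF q]])
  fix e'
  obtain e where e: "e' = F q e" using surj_F[OF q] by metis
  show "g \<beta> (\<phi> q) (sharp g \<beta> (\<phi> q) w') e' = g \<beta> (\<phi> q) (F q (sharp g \<alpha> q w)) e'"
    unfolding e isometry[OF q] B.g_sharp[OF \<phi>_V[OF q]] A.g_sharp[OF in_U[OF q]] using w by (simp add: same_covector_def)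
qed

end

text \<open>The induced change of charts \<open>\<Phi>\<close> of the cotangent bundle is specified by the property that \<open>p\<close> and
  its image are the same covector; differentiating this property gives the differential of \<open>\<Phi>\<close>.\<close>

locale cotangent_chart_change = chart_change g \<alpha> U \<beta> V \<phi> D
  for g :: "('i, real^'n::finite) bil_field" and \<alpha> :: 'i and U :: "(real^'n) set"
    and \<beta> :: 'i and V :: "(real^'n) set" and \<phi> :: "real^'n \<Rightarrow> real^'n" and D :: "(real^'n) set" +
  fixes \<Phi> :: "(real^'n) \<times> (real^'n) \<Rightarrow> (real^'n) \<times> (real^'n)"
  assumes \<Phi>_differentiable: "\<And>z. z \<in> D \<times> (- {0}) \<Longrightarrow> \<Phi> differentiable (at z)"
    and fst_\<Phi>: "\<And>z. z \<in> D \<times> (- {0}) \<Longrightarrow> fst (\<Phi> z) = \<phi> (fst z)"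
    and same_covector_\<Phi>: "\<And>z. z \<in> D \<times> (- {0}) \<Longrightarrow> same_covector (fst z) (snd z) (snd (\<Phi> z))"
begin

lemma fst_D: "z \<in> D \<times> (- {0}) \<Longrightarrow> fst z \<in> D" "z \<in> D \<times> (- {0}) \<Longrightarrow> fst z \<in> U"
    "z \<in> D \<times> (- {0}) \<Longrightarrow> fst (\<Phi> z) \<in> V"
  using in_U \<phi>_V by (auto simp: fst_\<Phi>)

lemma open_D': "open (D \<times> (- {0 :: real^'n}))"
  by (intro open_Times open_D) (simp add: open_Compl)

lemma has_derivative_\<Phi>: "z \<in> D \<times> (- {0}) \<Longrightarrow> (\<Phi> has_derivative ddir \<Phi> z) (at z)"
  using \<Phi>_differentiable frechet_derivative_works by blast

lemma fst_ddir_\<Phi>: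
  assumes z: "z \<in> D \<times> (- {0})"
  shows "fst (ddir \<Phi> z h) = F (fst z) (fst h)"
proof -
  have "((\<lambda>z. fst (\<Phi> z)) has_derivative (\<lambda>h. fst (ddir \<Phi> z h))) (at z)"
    by (rule has_derivative_fst[OF has_derivative_\<Phi>[OF z]])
  moreover have "((\<lambda>z. fst (\<Phi> z)) has_derivative (\<lambda>h. F (fst z) (fst h))) (at z)"
    by (rule has_derivative_transform_within_open[OF
          has_derivative_compose[where f = fst and g = \<phi>, OF has_derivative_fst[OF has_derivative_ident]
            has_derivative_\<phi>[OF fst_D(1)[OF z]]] open_D' z]) (simp add: fst_\<Phi>)
  ultimately show ?thesis using has_derivative_unique by metis
qed

lemma snd_ddir_\<Phi>:
  assumes z: "z \<in> D \<times> (- {0})"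
  shows "snd h \<bullet> u = snd (ddir \<Phi> z h) \<bullet> F (fst z) u + snd (\<Phi> z) \<bullet> F' (fst z) (fst h) u"
proof -
  have "((\<lambda>z. F (fst z) u) has_derivative (\<lambda>h. F' (fst z) (fst h) u)) (at z)"
    by (rule has_derivative_compose[where f = fst and g = "\<lambda>q. F q u", OF has_derivative_fst[OF has_derivative_ident]
            has_derivative_F[OF fst_D(1)[OF z]]])
  from has_derivative_inner[OF has_derivative_snd[OF has_derivative_\<Phi>[OF z]] this]
  have "((\<lambda>z. snd z \<bullet> u) has_derivative
      (\<lambda>h. snd (\<Phi> z) \<bullet> F' (fst z) (fst h) u + snd (ddir \<Phi> z h) \<bullet> F (fst z) u)) (at z)"
    by (rule has_derivative_transform_within_open[OF _ open_D' z])
      (use same_covector_\<Phi> in \<open>simp add: same_covector_def\<close>)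
  moreover have "((\<lambda>z. snd z \<bullet> u) has_derivative (\<lambda>h. snd h \<bullet> u)) (at z)"
    by (intro has_derivative_inner_left has_derivative_snd has_derivative_ident)
  ultimately have "(\<lambda>h. snd (\<Phi> z) \<bullet> F' (fst z) (fst h) u + snd (ddir \<Phi> z h) \<bullet> F (fst z) u) = (\<lambda>h. snd h \<bullet> u)"
    by (rule has_derivative_unique)
  from fun_cong[OF this, of h] show ?thesis by simp
qed

text \<open>The second derivatives of \<open>\<phi>\<close> in the differential of \<open>\<Phi>\<close> and in the transformation law of the
  Christoffel symbols cancel.\<close>

lemma vert_transform:
  assumes z: "z \<in> D \<times> (- {0})"
  shows "same_covector (fst z) (vert g \<alpha> z h) (vert g \<beta> (\<Phi> z) (ddir \<Phi> z h))"
  unfolding same_covector_def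
proof
  fix u
  have "snd z \<bullet> Gamma_vec g \<alpha> (fst z) (fst h) u = snd (\<Phi> z) \<bullet> F (fst z) (Gamma_vec g \<alpha> (fst z) (fst h) u)"
    using same_covector_\<Phi>[OF z] by (simp add: same_covector_def)
  then show "vert g \<alpha> z h \<bullet> u = vert g \<beta> (\<Phi> z) (ddir \<Phi> z h) \<bullet> F (fst z) u"
    using snd_ddir_\<Phi>[OF z, of h u]
    by (simp add: vert_def inner_diff_left Gamma_cov_inner fst_ddir_\<Phi>[OF z] fst_\<Phi>[OF z] Gamma_vec_transform[OF fst_D(1)[OF z]]
        inner_add_right)
qed

lemma energy_transform:
  assumes z: "z \<in> D \<times> (- {0})"
  shows "energy g \<beta> (\<Phi> z) = energy g \<alpha> z"
  using same_covector_\<Phi>[OF z]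
  by (simp add: energy_eq fst_\<Phi>[OF z] sharp_transform[OF fst_D(1)[OF z] same_covector_\<Phi>[OF z]] same_covector_def)

lemma K_low_transform:
  assumes z: "z \<in> D \<times> (- {0})"
  shows "same_covector (fst z) (K_low g f\<^sub>1 f\<^sub>2 \<alpha> z u) (K_low g f\<^sub>1 f\<^sub>2 \<beta> (\<Phi> z) (F (fst z) u))"
  using same_covector_\<Phi>[OF z]
  by (simp add: same_covector_def A.K_low_inner[OF fst_D(2)[OF z]] B.K_low_inner[OF fst_D(3)[OF z]] energy_transform[OF z]
      fst_\<Phi>[OF z] isometry[OF fst_D(1)[OF z]])

lemma K_up_transform:
  assumes z: "z \<in> D \<times> (- {0})" and w: "same_covector (fst z) w w'"
  shows "K_up g f\<^sub>1 f\<^sub>2 \<beta> (\<Phi> z) w' = F (fst z) (K_up g f\<^sub>1 f\<^sub>2 \<alpha> z w)"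
proof -
  have q: "fst z \<in> D" using fst_D(1)[OF z] .
  have "F (fst z) (sharp g \<alpha> (fst z) (snd z)) \<bullet> w' = sharp g \<alpha> (fst z) (snd z) \<bullet> w"
    using w unfolding same_covector_def by (subst (1 2) inner_commute) simp
  then show ?thesis
    by (simp add: K_up_def energy_transform[OF z] fst_\<Phi>[OF z] sharp_transform[OF q w] sharp_transform[OF q same_covector_\<Phi>[OF z]]
        linear_add[OF linear_F[OF q]] linear_scale[OF linear_F[OF q]])
qed

lemma natural_G_transform:
  assumes z: "z \<in> D \<times> (- {0})"
  shows "natural_G g c\<^sub>1 d\<^sub>1 c\<^sub>2 d\<^sub>2 \<beta> (\<Phi> z) (ddir \<Phi> z v) (ddir \<Phi> z w) = natural_G g c\<^sub>1 d\<^sub>1 c\<^sub>2 d\<^sub>2 \<alpha> z v w"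
  using K_low_transform[OF z, of c\<^sub>1 d\<^sub>1 "fst v"] vert_transform[OF z, of w]
  by (simp add: A.natural_G_eq[OF fst_D(2)[OF z]] B.natural_G_eq[OF fst_D(3)[OF z]] fst_ddir_\<Phi>[OF z]
      K_up_transform[OF z vert_transform[OF z]] same_covector_def inner_commute[of "K_up _ _ _ _ _ _"] inner_commute[of "F _ _" "vert _ _ _ _"])

text \<open>A tangent vector is determined by its horizontal part and its vertical part, and each of them
  transforms in the same way on both sides.\<close>

lemma natural_J_transform:
  assumes z: "z \<in> D \<times> (- {0})"
  shows "natural_J g a\<^sub>1 b\<^sub>1 a\<^sub>2 b\<^sub>2 \<beta> (\<Phi> z) (ddir \<Phi> z v) = ddir \<Phi> z (natural_J g a\<^sub>1 b\<^sub>1 a\<^sub>2 b\<^sub>2 \<alpha> z v)"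
    (is "?l = ?r")
proof -
  have q: "fst z \<in> D" using fst_D(1)[OF z] .
  have "fst ?l = fst ?r"
    by (simp add: A.fst_natural_J[OF fst_D(2)[OF z]] B.fst_natural_J[OF fst_D(3)[OF z]] fst_ddir_\<Phi>[OF z]
        K_up_transform[OF z vert_transform[OF z]] linear_neg[OF linear_F[OF q]])
  moreover have "vert g \<beta> (\<Phi> z) ?l = vert g \<beta> (\<Phi> z) ?r"
  proof (rule same_covector_unique[OF q])
    show "same_covector (fst z) (vert g \<alpha> z (natural_J g a\<^sub>1 b\<^sub>1 a\<^sub>2 b\<^sub>2 \<alpha> z v)) (vert g \<beta> (\<Phi> z) ?r)"
      by (rule vert_transform[OF z])
    show "same_covector (fst z) (vert g \<alpha> z (natural_J g a\<^sub>1 b\<^sub>1 a\<^sub>2 b\<^sub>2 \<alpha> z v)) (vert g \<beta> (\<Phi> z) ?l)"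
      unfolding A.vert_natural_J[OF fst_D(2)[OF z]] B.vert_natural_J[OF fst_D(3)[OF z]] fst_ddir_\<Phi>[OF z]
      by (rule K_low_transform[OF z])
  qed
  ultimately show ?thesis using hor_vert_decomposition by metis
qed

end

section \<open>The atlas of the cotangent bundle\<close>

lemma metric_chart_of_atlas:
  fixes \<AA> :: "('i, 'm, real^'n::finite) atlas"
  assumes at: "smooth_atlas \<AA>" and g: "riemannian_metric \<AA> g" and \<alpha>: "\<alpha> \<in> index \<AA>"
  shows "metric_chart g \<alpha> (coord_range \<AA> \<alpha>)"
proof
  show "open (coord_range \<AA> \<alpha>)"
    using at \<alpha> unfolding smooth_atlas_def overlap_def coord_range_def by (metis Int_absorb)
qed (use g \<alpha> in \<open>auto simp: riemannian_metric_def\<close>)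

lemma transition_coord:
  assumes "smooth_atlas \<AA>" "\<alpha> \<in> index \<AA>" "x \<in> patch \<AA> \<alpha>"
  shows "transition \<AA> \<alpha> \<beta> (coord \<AA> \<alpha> x) = coord \<AA> \<beta> x"
  using assms by (simp add: transition_def smooth_atlas_def)

text \<open>A covector is determined by its components in one chart.\<close>

lemma inj_on_cotangent_coord:
  fixes \<AA> :: "('i, 'm, real^'n::finite) atlas"
  assumes at: "smooth_atlas \<AA>" and \<alpha>: "\<alpha> \<in> index \<AA>"
  shows "inj_on (coord (nonzero_cotangent_atlas \<AA>) \<alpha>) (patch (nonzero_cotangent_atlas \<AA>) \<alpha>)"
proof (rule inj_onI)
  fix y y'
  assume y: "y \<in> patch (nonzero_cotangent_atlas \<AA>) \<alpha>" "y' \<in> patch (nonzero_cotangent_atlas \<AA>) \<alpha>"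
    and eq: "coord (nonzero_cotangent_atlas \<AA>) \<alpha> y = coord (nonzero_cotangent_atlas \<AA>) \<alpha> y'"
  obtain x \<xi> x' \<xi>' where xy: "y = (x, \<xi>)" "y' = (x', \<xi>')" by (metis surj_pair)
  have x: "x \<in> patch \<AA> \<alpha>" "\<xi> \<in> cotangent_space \<AA> x" "x' \<in> patch \<AA> \<alpha>" "\<xi>' \<in> cotangent_space \<AA> x'"
    and eq: "coord \<AA> \<alpha> x = coord \<AA> \<alpha> x'" "\<xi> \<alpha> = \<xi>' \<alpha>"
    using y eq by (auto simp: xy nonzero_cotangent_atlas_def nonzero_cotangent_def)
  have x': "x = x'" using at \<alpha> x eq(1) by (auto simp: smooth_atlas_def inj_on_def)
  have "\<xi> \<beta> = \<xi>' \<beta>" for \<beta>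
  proof (cases "\<beta> \<in> index \<AA> \<and> x \<in> patch \<AA> \<beta>")
    case True
    then have "\<xi> \<beta> $ i = (\<Sum>j\<in>UNIV. \<xi> \<alpha> $ j * dtrans \<AA> \<beta> \<alpha> (coord \<AA> \<beta> x) (axis i 1) $ j)"
      "\<xi>' \<beta> $ i = (\<Sum>j\<in>UNIV. \<xi>' \<alpha> $ j * dtrans \<AA> \<beta> \<alpha> (coord \<AA> \<beta> x) (axis i 1) $ j)" for i
      using x \<alpha> unfolding cotangent_space_def x' by blast+
    then show ?thesis using eq(2) by (simp add: vec_eq_iff)
  next
    case False
    then have "\<xi> \<beta> = 0" "\<xi>' \<beta> = 0" using x unfolding cotangent_space_def x' by blast+
    then show ?thesis by simp
  qed
  then show "y = y'" using x' xy by auto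
qed

lemma overlap_cotangent:
  fixes \<AA> :: "('i, 'm, real^'n::finite) atlas"
  assumes at: "smooth_atlas \<AA>" and \<alpha>: "\<alpha> \<in> index \<AA>" and z: "z \<in> overlap (nonzero_cotangent_atlas \<AA>) \<alpha> \<beta>"
  obtains x \<xi> where "x \<in> patch \<AA> \<alpha>" "x \<in> patch \<AA> \<beta>" "\<xi> \<in> cotangent_space \<AA> x"
    "z = (coord \<AA> \<alpha> x, \<xi> \<alpha>)" "transition (nonzero_cotangent_atlas \<AA>) \<alpha> \<beta> z = (coord \<AA> \<beta> x, \<xi> \<beta>)"
proof -
  let ?N = "nonzero_cotangent_atlas \<AA>"
  obtain x \<xi> where x: "(x, \<xi>) \<in> patch ?N \<alpha>" "(x, \<xi>) \<in> patch ?N \<beta>" and z: "z = coord ?N \<alpha> (x, \<xi>)"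
    using z by (auto simp: overlap_def)
  have "transition ?N \<alpha> \<beta> z = coord ?N \<beta> (x, \<xi>)"
    unfolding z transition_def using inj_on_cotangent_coord[OF at \<alpha>] x(1) by simp
  then show ?thesis
    using that[of x \<xi>] x by (auto simp: z nonzero_cotangent_atlas_def nonzero_cotangent_def)
qed

lemma overlap_cotangent_eq:
  fixes \<AA> :: "('i, 'm, real^'n::finite) atlas"
  assumes at: "smooth_atlas \<AA>" and \<alpha>: "\<alpha> \<in> index \<AA>"
  shows "overlap (nonzero_cotangent_atlas \<AA>) \<alpha> \<beta> = overlap \<AA> \<alpha> \<beta> \<times> (- {0})"
proof (intro set_eqI iffI)
  let ?N = "nonzero_cotangent_atlas \<AA>"
  fix z :: "(real^'n) \<times> (real^'n)"
  {
    assume z: "z \<in> overlap ?N \<alpha> \<beta>"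
    then have "z \<in> coord_range ?N \<alpha>" by (auto simp: overlap_def coord_range_def)
    then have "snd z \<noteq> 0" unfolding coord_range_nonzero_cotangent_atlas[OF at \<alpha>] by auto
    then show "z \<in> overlap \<AA> \<alpha> \<beta> \<times> (- {0})"
      by - (rule overlap_cotangent[OF at \<alpha> z], auto simp: overlap_def)
  next
    assume z: "z \<in> overlap \<AA> \<alpha> \<beta> \<times> (- {0})"
    then have "fst z \<in> overlap \<AA> \<alpha> \<beta>" by auto
    then obtain x where x: "x \<in> patch \<AA> \<alpha>" "x \<in> patch \<AA> \<beta>" "fst z = coord \<AA> \<alpha> x"
      unfolding overlap_def by blast
    have "z \<in> coord_range ?N \<alpha>"
      unfolding coord_range_nonzero_cotangent_atlas[OF at \<alpha>] using z x by (auto simp: coord_range_def)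
    then obtain x' \<xi> where x': "(x', \<xi>) \<in> patch ?N \<alpha>" "z = coord ?N \<alpha> (x', \<xi>)"
      by (auto simp: coord_range_def)
    then have "x' \<in> patch \<AA> \<alpha>" "coord \<AA> \<alpha> x' = coord \<AA> \<alpha> x"
      using x by (auto simp: nonzero_cotangent_atlas_def)
    then have "x' = x" using at \<alpha> x by (auto simp: smooth_atlas_def inj_on_def)
    then have "(x', \<xi>) \<in> patch ?N \<beta>" using x' x by (auto simp: nonzero_cotangent_atlas_def)
    then show "z \<in> overlap ?N \<alpha> \<beta>" using x' by (auto simp: overlap_def)
  }
qed

text \<open>The differentiability of the induced change of charts has to be read off from a formula: its fibre
  part is the transposed differential of the inverse change of charts.\<close>

lemma cotangent_chart_change_of_atlas:
  fixes \<AA> :: "('i, 'm, real^'n::finite) atlas"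
  assumes at: "smooth_atlas \<AA>" and g: "riemannian_metric \<AA> g" and \<alpha>: "\<alpha> \<in> index \<AA>" and \<beta>: "\<beta> \<in> index \<AA>"
  shows "cotangent_chart_change g \<alpha> (coord_range \<AA> \<alpha>) \<beta> (coord_range \<AA> \<beta>) (transition \<AA> \<alpha> \<beta>) (overlap \<AA> \<alpha> \<beta>)
    (transition (nonzero_cotangent_atlas \<AA>) \<alpha> \<beta>)"
proof -
  let ?N = "nonzero_cotangent_atlas \<AA>" and ?\<phi> = "transition \<AA> \<alpha> \<beta>" and ?\<psi> = "transition \<AA> \<beta> \<alpha>"
  let ?D = "overlap \<AA> \<alpha> \<beta>" and ?\<Phi> = "transition (nonzero_cotangent_atlas \<AA>) \<alpha> \<beta>"
  interpret A: metric_chart g \<alpha> "coord_range \<AA> \<alpha>" by (rule metric_chart_of_atlas[OF at g \<alpha>])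
  interpret B: metric_chart g \<beta> "coord_range \<AA> \<beta>" by (rule metric_chart_of_atlas[OF at g \<beta>])
  have D: "open ?D" and \<phi>: "smooth_on ?D ?\<phi>" and \<psi>: "smooth_on (overlap \<AA> \<beta> \<alpha>) ?\<psi>"
    using at \<alpha> \<beta> by (auto simp: smooth_atlas_def)
  have \<phi>_in: "?\<phi> q \<in> overlap \<AA> \<beta> \<alpha>" if "q \<in> ?D" for q
    using that transition_coord[OF at \<alpha>] by (auto simp: overlap_def)
  interpret C: chart_change g \<alpha> "coord_range \<AA> \<alpha>" \<beta> "coord_range \<AA> \<beta>" ?\<phi> ?D
  proof
    show "?D \<subseteq> coord_range \<AA> \<alpha>" by (auto simp: overlap_def coord_range_def)
    show "?\<phi> q \<in> coord_range \<AA> \<beta>" if "q \<in> ?D" for q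
      using \<phi>_in[OF that] by (auto simp: overlap_def coord_range_def)
    show "g \<beta> (?\<phi> q) (ddir ?\<phi> q u) (ddir ?\<phi> q v) = g \<alpha> q u v" if "q \<in> ?D" for q u v
      using g \<alpha> \<beta> that unfolding riemannian_metric_def dtrans_def by blast
  qed (rule D \<phi>)+
  show ?thesis
  proof
    let ?D' = "?D \<times> (- {0 :: real^'n})"
    have D': "open ?D'" by (intro open_Times D) (simp add: open_Compl)
    have ov: "?D' = overlap ?N \<alpha> \<beta>" by (rule overlap_cotangent_eq[OF at \<alpha>, symmetric])
    have repr: "?\<Phi> z = (?\<phi> (fst z), \<chi> j. snd z \<bullet> ddir ?\<psi> (?\<phi> (fst z)) (axis j 1)) \<and> C.same_covector (fst z) (snd z) (snd (?\<Phi> z))"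
      if "z \<in> ?D'" for z
    proof -
      have "z \<in> overlap ?N \<alpha> \<beta>" using that by (simp add: ov)
      then obtain x \<xi> where x: "x \<in> patch \<AA> \<alpha>" "x \<in> patch \<AA> \<beta>" and \<xi>: "\<xi> \<in> cotangent_space \<AA> x"
        and z: "z = (coord \<AA> \<alpha> x, \<xi> \<alpha>)" "?\<Phi> z = (coord \<AA> \<beta> x, \<xi> \<beta>)"
        by (rule overlap_cotangent[OF at \<alpha>])
      have law0: "\<xi> \<beta> $ j = (\<Sum>k\<in>UNIV. \<xi> \<alpha> $ k * dtrans \<AA> \<beta> \<alpha> (coord \<AA> \<beta> x) (axis j 1) $ k)"
        "\<xi> \<alpha> $ j = (\<Sum>k\<in>UNIV. \<xi> \<beta> $ k * dtrans \<AA> \<alpha> \<beta> (coord \<AA> \<alpha> x) (axis j 1) $ k)" for j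
        using \<xi> \<alpha> \<beta> x unfolding cotangent_space_def by blast+
      have law: "\<xi> \<beta> $ j = \<xi> \<alpha> \<bullet> ddir ?\<psi> (coord \<AA> \<beta> x) (axis j 1)"
        "\<xi> \<alpha> $ j = \<xi> \<beta> \<bullet> ddir ?\<phi> (coord \<AA> \<alpha> x) (axis j 1)" for j
        by (subst law0, simp add: inner_vec_def dtrans_def)+
      have q: "coord \<AA> \<alpha> x \<in> ?D" using x by (auto simp: overlap_def)
      have pairing: "\<xi> \<alpha> \<bullet> u = \<xi> \<beta> \<bullet> ddir ?\<phi> (coord \<AA> \<alpha> x) u" for u
        by (subst linear_expansion[OF C.linear_F[OF q], of u])
          (simp add: inner_sum_right law(2)[symmetric] inner_vec_def[of "\<xi> \<alpha>"] mult.commute)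
      have "?\<Phi> z = (?\<phi> (fst z), \<chi> j. snd z \<bullet> ddir ?\<psi> (?\<phi> (fst z)) (axis j 1))"
        unfolding z(2) by (simp add: z(1) transition_coord[OF at \<alpha> x(1)] vec_eq_iff law(1))
      moreover have "C.same_covector (fst z) (snd z) (snd (?\<Phi> z))"
        unfolding z(2) C.same_covector_def by (simp add: z(1) pairing)
      ultimately show ?thesis ..
    qed
    show "fst (?\<Phi> z) = ?\<phi> (fst z)" if "z \<in> ?D'" for z
      using arg_cong[OF conjunct1[OF repr[OF that]], of fst] by simp
    show "C.same_covector (fst z) (snd z) (snd (?\<Phi> z))" if "z \<in> ?D'" for z
      using repr[OF that] by (rule conjunct2)
    have \<phi>_fst: "smooth_on ?D' (\<lambda>z. ?\<phi> (fst z))"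
      by (rule smooth_on_compose[OF D' \<phi> smooth_on_linear[OF bounded_linear_fst D']]) auto
    have "smooth_on ?D' (\<lambda>z. ddir ?\<psi> (?\<phi> (fst z)) u)" for u
      by (rule smooth_on_compose[OF D' smooth_on_frechet_derivative[OF \<psi>] \<phi>_fst]) (auto intro: \<phi>_in)
    then have "smooth_on ?D' (\<lambda>z. (?\<phi> (fst z), \<chi> j. snd z \<bullet> ddir ?\<psi> (?\<phi> (fst z)) (axis j 1)))"
      by (intro smooth_on_Pair \<phi>_fst smooth_on_componentwise D')
        (simp, intro smooth_on_bilinear[OF bounded_bilinear_inner] D' smooth_on_linear[OF bounded_linear_snd])
    then have "smooth_on ?D' ?\<Phi>"
      by (rule smooth_on_cong[OF D', rotated]) (simp add: repr)
    then show "?\<Phi> differentiable (at z)" if "z \<in> ?D'" for z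
      using smooth_on_differentiable that by blast
  qed
qed

section \<open>The Hermitian structures\<close>

text \<open>All the coefficients are rational expressions in \<open>A\<close>, \<open>t\<close>, \<open>l = \<lambda>(t)\<close>, \<open>m = \<mu>(t)\<close> and the
  two numbers \<open>P\<close> and \<open>Q\<close> in the proof, whose quotient is positive by assumption. The factors along
  \<open>p\<close> are \<open>P / (A Q)\<close> and its inverse for \<open>J\<close>, and \<open>l + 2 t m\<close> times these for \<open>G\<close>. In the last
  equation \<open>A (l + t l')\<close> is the derivative of \<open>a\<^sub>1 = A t \<lambda>\<close>.\<close>

lemma natural_coefficients:
  fixes A c t l l' m :: real
  assumes A: "A > 0" and t: "t > 0" and l: "l > 0" and pos: "(2 * c - A\<^sup>2 * t * l\<^sup>2) / (l + 2 * t * l') > 0"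
    and m: "l + 2 * t * m > 0"
    and a1: "a1 = A * t * l" and b1: "b1 = (c - A\<^sup>2 * t * l * (l + t * l')) / (A * t * (l + 2 * t * l'))"
    and a2: "a2 = 1 / (A * t * l)"
    and b2: "b2 = - ((c - A\<^sup>2 * t * l * (l + t * l')) / (A * t\<^sup>2 * l * (2 * c - A\<^sup>2 * t * l\<^sup>2)))"
    and c1: "c1 = A * t * l\<^sup>2"
    and d1: "d1 = (l * (c - A\<^sup>2 * t * l * (l + t * l')) + m * t * (2 * c - A\<^sup>2 * t * l\<^sup>2)) / (A * t * (l + 2 * t * l'))"
    and c2: "c2 = 1 / (A * t)"
    and d2: "d2 = (- c + A\<^sup>2 * t * l * (l + t * l') + m * A\<^sup>2 * t\<^sup>2 * (l + 2 * t * l')) / (A * t\<^sup>2 * (2 * c - A\<^sup>2 * t * l\<^sup>2))"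
  shows "l + 2 * t * l' \<noteq> 0" "2 * c - A\<^sup>2 * t * l\<^sup>2 \<noteq> 0"
    and "a1 * a2 = 1" "(a1 + 2 * t * b1) * (a2 + 2 * t * b2) = 1"
    and "c1 * a2\<^sup>2 = c2" "(c1 + 2 * t * d1) * (a2 + 2 * t * b2)\<^sup>2 = c2 + 2 * t * d2"
    and "0 < c1" "0 < c1 + 2 * t * d1" "0 < c2" "0 < c2 + 2 * t * d2"
    and "a1 * (A * (l + t * l')) + b1 * (2 * t * (A * (l + t * l')) - a1) = c"
proof -
  define P where "P = 2 * c - A\<^sup>2 * t * l\<^sup>2"
  define Q where "Q = l + 2 * t * l'"
  have PQ: "P / Q > 0" using pos by (simp add: P_def Q_def)
  then have Q: "Q \<noteq> 0" and P: "P \<noteq> 0" by auto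
  then show "l + 2 * t * l' \<noteq> 0" "2 * c - A\<^sup>2 * t * l\<^sup>2 \<noteq> 0" by (simp_all add: P_def Q_def)
  have N: "c - A\<^sup>2 * t * l * (l + t * l') = (P - A\<^sup>2 * t * l * Q) / 2"
    by (simp add: P_def Q_def field_simps power2_eq_square)
  have nz: "A \<noteq> 0" "t \<noteq> 0" "l \<noteq> 0" using A t l by auto
  have b1': "b1 = (P - A\<^sup>2 * t * l * Q) / (2 * A * t * Q)"
    unfolding b1 N Q_def[symmetric] by simp
  have b2': "b2 = - ((P - A\<^sup>2 * t * l * Q) / (2 * A * t\<^sup>2 * l * P))"
    unfolding b2 N P_def[symmetric] by simp
  have d1': "d1 = (l * (P - A\<^sup>2 * t * l * Q) / 2 + m * t * P) / (A * t * Q)"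
    unfolding d1 N P_def[symmetric] Q_def[symmetric] by simp
  have "- c + A\<^sup>2 * t * l * (l + t * l') = - ((P - A\<^sup>2 * t * l * Q) / 2)"
    unfolding N[symmetric] by simp
  then have d2': "d2 = (- ((P - A\<^sup>2 * t * l * Q) / 2) + m * A\<^sup>2 * t\<^sup>2 * Q) / (A * t\<^sup>2 * P)"
    unfolding d2 P_def[symmetric] Q_def[symmetric] by simp
  have ab1: "a1 + 2 * t * b1 = P / (A * Q)"
    unfolding a1 b1' using nz P Q by (simp add: field_simps power2_eq_square)
  have ab2: "a2 + 2 * t * b2 = A * Q / P"
    unfolding a2 b2' using nz P Q by (simp add: field_simps power2_eq_square)
  have cd1: "c1 + 2 * t * d1 = (l + 2 * t * m) * (P / (A * Q))"
    unfolding c1 d1' using nz P Q by (simp add: field_simps power2_eq_square)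
  have cd2: "c2 + 2 * t * d2 = (l + 2 * t * m) * (A * Q / P)"
    unfolding c2 d2' using nz P Q by (simp add: field_simps power2_eq_square)
  show "a1 * a2 = 1" "c1 * a2\<^sup>2 = c2"
    unfolding a1 a2 c1 c2 using nz by (simp_all add: field_simps power2_eq_square)
  show "(a1 + 2 * t * b1) * (a2 + 2 * t * b2) = 1"
    unfolding ab1 ab2 using nz P Q by simp
  show "(c1 + 2 * t * d1) * (a2 + 2 * t * b2)\<^sup>2 = c2 + 2 * t * d2"
    unfolding ab2 cd1 cd2 using nz P Q by (simp add: power2_eq_square)
  show "0 < c1" "0 < c2" using A t l by (simp_all add: c1 c2)
  have "P / (A * Q) > 0"
    using divide_pos_pos[OF PQ A] by (simp add: mult.commute)
  then show "0 < c1 + 2 * t * d1" unfolding cd1 using m by (rule mult_pos_pos[rotated])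
  have "A * Q / P > 0"
    using divide_pos_pos[OF A PQ] by simp
  then show "0 < c2 + 2 * t * d2" unfolding cd2 using m by (rule mult_pos_pos[rotated])
  have D: "2 * t * (A * (l + t * l')) - a1 = A * t * Q" by (simp add: a1 Q_def algebra_simps)
  have "b1 * (A * t * Q) = c - A\<^sup>2 * t * l * (l + t * l')"
    unfolding b1 Q_def[symmetric] using nz Q by simp
  then show "a1 * (A * (l + t * l')) + b1 * (2 * t * (A * (l + t * l')) - a1) = c"
    unfolding D by (simp add: a1 algebra_simps power2_eq_square)
qed

theorem theorem5:
  fixes \<AA> :: "('i, 'm, real^'n::finite) atlas"
    and g :: "('i, real^'n) bil_field"
    and c A :: real
    and lam \<mu> a\<^sub>1 b\<^sub>1 a\<^sub>2 b\<^sub>2 c\<^sub>1 d\<^sub>1 c\<^sub>2 d\<^sub>2 :: "real \<Rightarrow> real"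
  assumes "CARD('n) > 1"
    and "smooth_manifold \<AA>"
    and "riemannian_metric \<AA> g"
    and "constant_sectional_curvature \<AA> g c"
    and "A > 0"
    and "smooth_on {0<..} lam"
    and "smooth_on {0<..} \<mu>"
    and "\<And>t. t > 0 \<Longrightarrow> lam t > 0"
    and "\<And>t. t > 0 \<Longrightarrow> (2 * c - A\<^sup>2 * t * (lam t)\<^sup>2) / (lam t + 2 * t * deriv lam t) > 0"
    and "\<And>t. t > 0 \<Longrightarrow> lam t + 2 * t * \<mu> t > 0"
    and "\<And>t. t > 0 \<Longrightarrow> a\<^sub>1 t = A * t * lam t"
    and "\<And>t. t > 0 \<Longrightarrow> b\<^sub>1 t = (c - A\<^sup>2 * t * lam t * (lam t + t * deriv lam t)) /
                              (A * t * (lam t + 2 * t * deriv lam t))"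
    and "\<And>t. t > 0 \<Longrightarrow> a\<^sub>2 t = 1 / (A * t * lam t)"
    and "\<And>t. t > 0 \<Longrightarrow> b\<^sub>2 t = - ((c - A\<^sup>2 * t * lam t * (lam t + t * deriv lam t)) /
                              (A * t\<^sup>2 * lam t * (2 * c - A\<^sup>2 * t * (lam t)\<^sup>2)))"
    and "\<And>t. t > 0 \<Longrightarrow> c\<^sub>1 t = A * t * (lam t)\<^sup>2"
    and "\<And>t. t > 0 \<Longrightarrow> d\<^sub>1 t = (lam t * (c - A\<^sup>2 * t * lam t * (lam t + t * deriv lam t))
                                + \<mu> t * t * (2 * c - A\<^sup>2 * t * (lam t)\<^sup>2)) /
                              (A * t * (lam t + 2 * t * deriv lam t))"
    and "\<And>t. t > 0 \<Longrightarrow> c\<^sub>2 t = 1 / (A * t)"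
    and "\<And>t. t > 0 \<Longrightarrow> d\<^sub>2 t = (- c + A\<^sup>2 * t * lam t * (lam t + t * deriv lam t)
                                + \<mu> t * A\<^sup>2 * t\<^sup>2 * (lam t + 2 * t * deriv lam t)) /
                              (A * t\<^sup>2 * (2 * c - A\<^sup>2 * t * (lam t)\<^sup>2))"
  shows "hermitian_structure (nonzero_cotangent_atlas \<AA>)
           (natural_G g c\<^sub>1 d\<^sub>1 c\<^sub>2 d\<^sub>2) (natural_J g a\<^sub>1 b\<^sub>1 a\<^sub>2 b\<^sub>2)"
proof -
  let ?N = "nonzero_cotangent_atlas \<AA>"
  let ?G = "natural_G g c\<^sub>1 d\<^sub>1 c\<^sub>2 d\<^sub>2" and ?J = "natural_J g a\<^sub>1 b\<^sub>1 a\<^sub>2 b\<^sub>2"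
  have at: "smooth_atlas \<AA>" using assms(2) by (simp add: smooth_manifold_def)
  note g = assms(3) and A = assms(5) and lam = assms(6) and mu = assms(7) and lam_pos = assms(8)
  note coeffs = assms(11-18)
  {
    fix t :: real
    assume t: "t > 0"
    note natural_coefficients[OF A t assms(8-18)[OF t]]
  }
  note alg = this
  have S: "open {0::real<..}" by simp
  have dlam: "smooth_on {0<..} (deriv lam)" by (rule smooth_on_deriv[OF S lam])
  have ident: "smooth_on {0<..} (\<lambda>t::real. t)"
    by (rule smooth_on_linear[OF bounded_linear_ident S])
  have nz: "A \<noteq> 0" using A by simp
  have nzt: "t \<noteq> 0" "lam t \<noteq> 0" "lam t + 2 * t * deriv lam t \<noteq> 0" "2 * c - A\<^sup>2 * t * (lam t)\<^sup>2 \<noteq> 0"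
    if "t \<in> {0<..}" for t
    using that lam_pos[of t] alg(1,2)[of t] by simp_all
  note nonzero = no_zero_divisors power_not_zero nz nzt
  note smooth = smooth_on_add[OF S] smooth_on_diff[OF S] smooth_on_uminus[OF S] smooth_on_mult[OF S] smooth_on_divide[OF S]
    smooth_on_power[OF S] smooth_on_const[OF S] ident lam dlam mu
  have smooth_a1: "smooth_on {0<..} a\<^sub>1"
    by (rule smooth_on_cong[OF S, where f = "\<lambda>t. A * t * lam t"]) (simp add: coeffs, intro smooth)
  have smooth_b1: "smooth_on {0<..} b\<^sub>1"
    by (rule smooth_on_cong[OF S, where f = "\<lambda>t. (c - A\<^sup>2 * t * lam t * (lam t + t * deriv lam t)) /
        (A * t * (lam t + 2 * t * deriv lam t))"]) (simp add: coeffs, intro smooth nonzero, assumption+)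
  have smooth_a2: "smooth_on {0<..} a\<^sub>2"
    by (rule smooth_on_cong[OF S, where f = "\<lambda>t. 1 / (A * t * lam t)"]) (simp add: coeffs, intro smooth nonzero, assumption+)
  have smooth_b2: "smooth_on {0<..} b\<^sub>2"
    by (rule smooth_on_cong[OF S, where f = "\<lambda>t. - ((c - A\<^sup>2 * t * lam t * (lam t + t * deriv lam t)) /
        (A * t\<^sup>2 * lam t * (2 * c - A\<^sup>2 * t * (lam t)\<^sup>2)))"]) (simp add: coeffs, intro smooth nonzero, assumption+)
  have smooth_c1: "smooth_on {0<..} c\<^sub>1"
    by (rule smooth_on_cong[OF S, where f = "\<lambda>t. A * t * (lam t)\<^sup>2"]) (simp add: coeffs, intro smooth)
  have smooth_d1: "smooth_on {0<..} d\<^sub>1"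
    by (rule smooth_on_cong[OF S, where f = "\<lambda>t. (lam t * (c - A\<^sup>2 * t * lam t * (lam t + t * deriv lam t))
        + \<mu> t * t * (2 * c - A\<^sup>2 * t * (lam t)\<^sup>2)) / (A * t * (lam t + 2 * t * deriv lam t))"])
      (simp add: coeffs, intro smooth nonzero, assumption+)
  have smooth_c2: "smooth_on {0<..} c\<^sub>2"
    by (rule smooth_on_cong[OF S, where f = "\<lambda>t. 1 / (A * t)"]) (simp add: coeffs, intro smooth nonzero, assumption+)
  have smooth_d2: "smooth_on {0<..} d\<^sub>2"
    by (rule smooth_on_cong[OF S, where f = "\<lambda>t. (- c + A\<^sup>2 * t * lam t * (lam t + t * deriv lam t)
        + \<mu> t * A\<^sup>2 * t\<^sup>2 * (lam t + 2 * t * deriv lam t)) / (A * t\<^sup>2 * (2 * c - A\<^sup>2 * t * (lam t)\<^sup>2))"])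
      (simp add: coeffs, intro smooth nonzero, assumption+)
  have deriv_a1: "deriv a\<^sub>1 t = A * (lam t + t * deriv lam t)" if "t > 0" for t
  proof -
    have "lam differentiable (at t)" using smooth_on_differentiable[OF lam] that by simp
    then have "(lam has_real_derivative deriv lam t) (at t)"
      using DERIV_deriv_iff_real_differentiable by blast
    then have "((\<lambda>t. A * t * lam t) has_real_derivative A * (lam t + t * deriv lam t)) (at t)"
      by (auto intro!: derivative_eq_intros simp: algebra_simps)
    then have "(a\<^sub>1 has_real_derivative A * (lam t + t * deriv lam t)) (at t)"
      by (rule has_field_derivative_transform_within_open[OF _ S]) (use that coeffs(1) in auto)
    then show ?thesis by (rule DERIV_imp_deriv)
  qed
  have chart: "natural_complex_chart g \<alpha> (coord_range \<AA> \<alpha>) a\<^sub>1 b\<^sub>1 a\<^sub>2 b\<^sub>2" if \<alpha>: "\<alpha> \<in> index \<AA>" for \<alpha>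
    by (intro natural_complex_chart.intro natural_complex_chart_axioms.intro metric_chart_of_atlas[OF at g \<alpha>]
      smooth_a1 smooth_b1 smooth_a2 smooth_b2 alg)
  have range_eq: "coord_range ?N \<alpha> = metric_chart.punctured (coord_range \<AA> \<alpha>)" if "\<alpha> \<in> index \<AA>" for \<alpha>
    unfolding coord_range_nonzero_cotangent_atlas[OF at that]
      metric_chart.punctured_def[OF metric_chart_of_atlas[OF at g that]] ..
  have idx: "index ?N = index \<AA>" by (simp add: nonzero_cotangent_atlas_def)
  have endo: "endomorphism_field ?N ?J"
    unfolding endomorphism_field_def idx
  proof (intro conjI ballI allI)
    fix \<alpha> assume \<alpha>: "\<alpha> \<in> index \<AA>"
    interpret natural_complex_chart g \<alpha> "coord_range \<AA> \<alpha>" a\<^sub>1 b\<^sub>1 a\<^sub>2 b\<^sub>2 by (rule chart[OF \<alpha>])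
    show "smooth_on (coord_range ?N \<alpha>) (\<lambda>z. ?J \<alpha> z u)" for u
      unfolding range_eq[OF \<alpha>] by (rule J.smooth_J)
    show "linear (?J \<alpha> z)" if "z \<in> coord_range ?N \<alpha>" for z
      using that unfolding range_eq[OF \<alpha>] by (rule J.linear_J)
  next
    fix \<alpha> \<beta> z u
    assume \<alpha>: "\<alpha> \<in> index \<AA>" and \<beta>: "\<beta> \<in> index \<AA>" and z: "z \<in> overlap ?N \<alpha> \<beta>"
    show "?J \<beta> (transition ?N \<alpha> \<beta> z) (dtrans ?N \<alpha> \<beta> z u) = dtrans ?N \<alpha> \<beta> z (?J \<alpha> z u)"
      unfolding dtrans_def
      by (rule cotangent_chart_change.natural_J_transform[OF cotangent_chart_change_of_atlas[OF at g \<alpha> \<beta>]])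
        (use z in \<open>simp add: overlap_cotangent_eq[OF at \<alpha>]\<close>)
  qed
  have acs: "almost_complex_structure ?N ?J"
    unfolding almost_complex_structure_def idx
  proof (intro conjI ballI allI endo)
    fix \<alpha> z u assume \<alpha>: "\<alpha> \<in> index \<AA>" and z: "z \<in> coord_range ?N \<alpha>"
    interpret natural_complex_chart g \<alpha> "coord_range \<AA> \<alpha>" a\<^sub>1 b\<^sub>1 a\<^sub>2 b\<^sub>2 by (rule chart[OF \<alpha>])
    show "?J \<alpha> z (?J \<alpha> z u) = - u"
      using z unfolding range_eq[OF \<alpha>] by (rule J.J_J)
  qed
  have cs: "complex_structure ?N ?J"
    unfolding complex_structure_def idx
  proof (intro conjI ballI allI impI acs)
    fix X Y \<alpha> z assume XY: "vector_field ?N X \<and> vector_field ?N Y"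
      and \<alpha>: "\<alpha> \<in> index \<AA>" and z: "z \<in> coord_range ?N \<alpha>"
    interpret natural_complex_chart g \<alpha> "coord_range \<AA> \<alpha>" a\<^sub>1 b\<^sub>1 a\<^sub>2 b\<^sub>2 by (rule chart[OF \<alpha>])
    have zp: "z \<in> punctured" using z range_eq[OF \<alpha>] by simp
    have XY_diff: "X \<alpha> differentiable (at z)" "Y \<alpha> differentiable (at z)"
      using XY \<alpha> z smooth_on_differentiable unfolding vector_field_def idx by blast+
    have t: "energy g \<alpha> z > 0" by (rule energy_pos[OF zp])
    have curv: "curvature g \<alpha> (fst z) u v w = c *\<^sub>R (g \<alpha> (fst z) v w *\<^sub>R u - g \<alpha> (fst z) u w *\<^sub>R v)" for u v w
      by (rule constant_curvature_tensor[OF punctured_D(1)[OF zp]])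
        (use assms(4) \<alpha> punctured_D(1)[OF zp] in \<open>auto simp: constant_sectional_curvature_def\<close>)
    have "nijenhuis_form (?J \<alpha>) z (X \<alpha> z) (Y \<alpha> z) = 0"
      by (rule nijenhuis_form_zero[OF zp refl _ curv]) (simp only: deriv_a1[OF t] alg(11)[OF t])
    then show "nijenhuis ?J X Y \<alpha> z = 0"
      using J.nijenhuis_eq_form[where I = ?J and X = X and Y = Y and \<alpha> = \<alpha>, OF zp XY_diff refl] by simp
  qed
  have rm: "riemannian_metric ?N ?G"
    unfolding riemannian_metric_def idx
  proof (intro conjI ballI allI impI)
    fix \<alpha> assume \<alpha>: "\<alpha> \<in> index \<AA>"
    interpret natural_complex_chart g \<alpha> "coord_range \<AA> \<alpha>" a\<^sub>1 b\<^sub>1 a\<^sub>2 b\<^sub>2 by (rule chart[OF \<alpha>])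
    show "smooth_on (coord_range ?N \<alpha>) (\<lambda>z. ?G \<alpha> z u v)" for u v
      unfolding range_eq[OF \<alpha>] by (rule smooth_natural_G[OF smooth_c1 smooth_d1 smooth_c2 smooth_d2])
    fix z assume "z \<in> coord_range ?N \<alpha>"
    then have z: "z \<in> punctured" by (simp add: range_eq[OF \<alpha>])
    show "bilinear (?G \<alpha> z)" by (rule bilinear_natural_G[OF punctured_D(1)[OF z]])
    show "?G \<alpha> z u v = ?G \<alpha> z v u" for u v by (rule natural_G_sym[OF punctured_D(1)[OF z]])
    show "0 < ?G \<alpha> z u u" if "u \<noteq> 0" for u
      using alg(7-10)[OF energy_pos[OF z]] by (intro natural_G_pos[OF z refl _ _ _ _ that])
  next
    fix \<alpha> \<beta> z u v
    assume \<alpha>: "\<alpha> \<in> index \<AA>" and \<beta>: "\<beta> \<in> index \<AA>" and z: "z \<in> overlap ?N \<alpha> \<beta>"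
    show "?G \<beta> (transition ?N \<alpha> \<beta> z) (dtrans ?N \<alpha> \<beta> z u) (dtrans ?N \<alpha> \<beta> z v) = ?G \<alpha> z u v"
      unfolding dtrans_def
      by (rule cotangent_chart_change.natural_G_transform[OF cotangent_chart_change_of_atlas[OF at g \<alpha> \<beta>]])
        (use z in \<open>simp add: overlap_cotangent_eq[OF at \<alpha>]\<close>)
  qed
  show ?thesis
    unfolding hermitian_structure_def idx
  proof (intro conjI ballI allI impI cs rm)
    fix X Y \<alpha> z assume \<alpha>: "\<alpha> \<in> index \<AA>" and "z \<in> coord_range ?N \<alpha>"
    interpret natural_complex_chart g \<alpha> "coord_range \<AA> \<alpha>" a\<^sub>1 b\<^sub>1 a\<^sub>2 b\<^sub>2 by (rule chart[OF \<alpha>])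
    have z: "z \<in> punctured" using \<open>z \<in> _\<close> range_eq[OF \<alpha>] by simp
    show "?G \<alpha> z (act ?J X \<alpha> z) (act ?J Y \<alpha> z) = ?G \<alpha> z (X \<alpha> z) (Y \<alpha> z)"
      unfolding act_def using alg(3-6)[OF energy_pos[OF z]] by (intro natural_G_J[OF z refl])
  qed
qed


end
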